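(* Let $k$ be an algebraically closed field of characteristic zero and $G$ a finite group. Let $W$ be an $n$-dimensional representation of $G$ over $k$ and $V\subset \wedge^2(W)$ a subrepresentation of codimension $r\le n-2$ such that the $G$-actions on $\mathbb{P}(W)$ and $\mathbb{P}(V)$ are generically free. Put $$X:=\mathrm{Gr}(2,W)\cap \mathbb{P}(V)\subset \mathbb{P}(\wedge^2(W)),$$ and assume that $X$ is irreducible of dimension $\dim(\mathrm{Gr}(2,n))-r=2(n-2)-r$. Then there is a $G$-equivariant birational equivalence $$X\times\mathbb{P}^1\sim_G \mathbb{P}(W)\times\mathbb{P}^{n-2-r},$$ with trivial $G$-actions on the second factors $\mathbb{P}^1$ and $\mathbb{P}^{n-2-r}$.
   Context: $\mathrm{Gr}(2,W)$ denotes the Grassmannian of $2$-dimensional linear subspaces of $W$, embedded in $\mathbb{P}(\wedge^2(W))$ by the Plücker embedding; $\mathbb{P}(W)$ denotes the projective space of lines in $W$. The group $G$ acts on all of these through its representation $W$. The notation $Y\sim_G Z$ means that $Y$ and $Z$ are $G$-equivariantly birational. *)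

theory Defs
  imports
    "HOL-Analysis.Analysis"
    "HOL-Algebra.Group"
    "HOL-Library.Extended_Nat"
    "HOL-Computational_Algebra.Polynomial"
begin

section \<open>Irreducibility and dimension of topological spaces\<close>

definition irreducible_space :: "'p topology \<Rightarrow> bool" where
  "irreducible_space T \<longleftrightarrow> topspace T \<noteq> {} \<and>
     (\<forall>C D. closedin T C \<longrightarrow> closedin T D \<longrightarrow> C \<union> D = topspace T \<longrightarrow>
        C = topspace T \<or> D = topspace T)"

definition irreducible_chain :: "'p topology \<Rightarrow> nat \<Rightarrow> (nat \<Rightarrow> 'p set) \<Rightarrow> bool" where
  "irreducible_chain T m Z \<longleftrightarrow>
     (\<forall>i\<le>m. closedin T (Z i) \<and> irreducible_space (subtopology T (Z i))) \<and>
     (\<forall>i<m. Z i \<subset> Z (Suc i))"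

text \<open>The Krull dimension. The empty space gets the value \<open>0\<close>, since \<open>Sup {} = 0\<close> in
  \<^typ>\<open>enat\<close>.\<close>

definition krull_dim :: "'p topology \<Rightarrow> enat" where
  "krull_dim T = Sup {enat m |m. \<exists>Z. irreducible_chain T m Z}"

definition dense_open :: "'p topology \<Rightarrow> 'p set \<Rightarrow> bool" where
  "dense_open T U \<longleftrightarrow> openin T U \<and> T closure_of U = topspace T"

section \<open>Projective spaces and their Zariski topologies\<close>

text \<open>A point of a projective space is a line through the origin, as a set of vectors.\<close>

definition proj_space :: "('k::field ^ 'a) set \<Rightarrow> ('k ^ 'a) set set" where
  "proj_space V = {L. vec.subspace L \<and> vec.dim L = 1 \<and> L \<subseteq> V}"

definition proj_point :: "'k::field ^ 'a \<Rightarrow> ('k ^ 'a) set" where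
  "proj_point x = vec.span {x}"

text \<open>\<open>form d f\<close>: the function \<open>f\<close> is given by a homogeneous polynomial of degree \<open>d\<close>
  in the coordinates. \<open>biform d e f\<close>: it is given by a polynomial that is homogeneous of
  degree \<open>d\<close> in the first and of degree \<open>e\<close> in the second group of coordinates.
  The zero function is a form of every degree.\<close>

inductive form :: "nat \<Rightarrow> ('k::field ^ 'a \<Rightarrow> 'k) \<Rightarrow> bool" where
  form_const: "form 0 (\<lambda>x. c)"
| form_coord: "form d f \<Longrightarrow> form (Suc d) (\<lambda>x. x $ i * f x)"
| form_add: "form d f \<Longrightarrow> form d g \<Longrightarrow> form d (\<lambda>x. f x + g x)"

inductive biform :: "nat \<Rightarrow> nat \<Rightarrow> ('k::field ^ 'a \<Rightarrow> 'k ^ 'b \<Rightarrow> 'k) \<Rightarrow> bool" where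
  biform_const: "biform 0 0 (\<lambda>x y. c)"
| biform_fst: "biform d e f \<Longrightarrow> biform (Suc d) e (\<lambda>x y. x $ i * f x y)"
| biform_snd: "biform d e f \<Longrightarrow> biform d (Suc e) (\<lambda>x y. y $ j * f x y)"
| biform_add: "biform d e f \<Longrightarrow> biform d e g \<Longrightarrow> biform d e (\<lambda>x y. f x y + g x y)"

text \<open>The Zariski topologies of \<open>P(k\<^sup>a)\<close> and of \<open>P(k\<^sup>a) \<times> P(k\<^sup>b)\<close> have as basic open sets
  the non-vanishing loci of forms and of bihomogeneous forms. The latter is not the
  product topology; it is the topology induced by the Segre embedding. Subsets carry the
  subspace topology.\<close>

definition zariski :: "('k::field ^ 'a) set topology" where
  "zariski = topology_generated_by
     {{L \<in> proj_space UNIV. \<exists>x\<in>L. f x \<noteq> 0} |f. \<exists>d. form d f}"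

definition zariski2 :: "(('k::field ^ 'a) set \<times> ('k ^ 'b) set) topology" where
  "zariski2 = topology_generated_by
     {{(L, M). L \<in> proj_space UNIV \<and> M \<in> proj_space UNIV \<and> (\<exists>x\<in>L. \<exists>y\<in>M. f x y \<noteq> 0)} |f.
        \<exists>d e. biform d e f}"

lemma proj_space_zero_mem: "L \<in> proj_space V \<Longrightarrow> 0 \<in> L"
  by (simp add: proj_space_def vec.subspace_0)

lemma topspace_zariski: "topspace zariski = proj_space (UNIV :: ('k::field ^ 'a) set)"
proof (intro equalityI subsetI)
  fix L :: "('k ^ 'a) set"
  assume L: "L \<in> proj_space UNIV"
  have "L \<in> {L \<in> proj_space UNIV. \<exists>x\<in>L. (1::'k) \<noteq> 0}"
    using L proj_space_zero_mem[OF L] by auto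
  moreover have "\<exists>d. form d (\<lambda>x :: 'k ^ 'a. 1)"
    using form_const by (rule exI)
  ultimately show "L \<in> topspace zariski"
    unfolding zariski_def topology_generated_by_topspace
    by - (rule UnionI[rotated], assumption,
        intro CollectI exI[of _ "\<lambda>x. 1"] conjI refl, assumption)
next
  fix L :: "('k ^ 'a) set"
  assume "L \<in> topspace zariski"
  then show "L \<in> proj_space UNIV"
    unfolding zariski_def topology_generated_by_topspace by (elim UnionE CollectE exE conjE) simp
qed

lemma topspace_zariski2:
  "topspace zariski2 =
     proj_space (UNIV :: ('k::field ^ 'a) set) \<times> proj_space (UNIV :: ('k ^ 'b) set)"
proof (intro equalityI subsetI)
  fix p :: "('k ^ 'a) set \<times> ('k ^ 'b) set"
  assume p: "p \<in> proj_space UNIV \<times> proj_space UNIV"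
  then have "0 \<in> fst p" "0 \<in> snd p"
    by (auto intro: proj_space_zero_mem)
  with p have "p \<in> {(L, M). L \<in> proj_space UNIV \<and> M \<in> proj_space UNIV \<and>
                      (\<exists>x\<in>L. \<exists>y\<in>M. (1::'k) \<noteq> 0)}"
    by auto
  moreover have "\<exists>d e. biform d e (\<lambda>(x :: 'k ^ 'a) (y :: 'k ^ 'b). 1)"
    using biform_const by (intro exI)
  ultimately show "p \<in> topspace zariski2"
    unfolding zariski2_def topology_generated_by_topspace
    by - (rule UnionI[rotated], assumption,
        intro CollectI exI[of _ "\<lambda>x y. 1"] conjI refl, assumption)
next
  fix p :: "('k ^ 'a) set \<times> ('k ^ 'b) set"
  assume "p \<in> topspace zariski2"
  then show "p \<in> proj_space UNIV \<times> proj_space UNIV"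
    unfolding zariski2_def topology_generated_by_topspace
    by (elim UnionE CollectE exE conjE) (simp add: case_prod_unfold mem_Times_iff)
qed

section \<open>Regular maps and equivariant birational equivalence\<close>

text \<open>A map from a subset \<open>U\<close> of a product of two projective spaces to a projective space
  is regular if near every point of \<open>U\<close> it is given by bihomogeneous forms of one
  bidegree without common zeros there. A map to a product is regular if both of its
  components are.\<close>

definition regular_map ::
  "(('k::field ^ 'a) set \<times> ('k ^ 'b) set) set \<Rightarrow>
   (('k ^ 'a) set \<times> ('k ^ 'b) set \<Rightarrow> ('k ^ 'c) set) \<Rightarrow> bool" where
  "regular_map U \<phi> \<longleftrightarrow>
     (\<forall>p\<in>U. \<exists>N d e F. openin zariski2 N \<and> p \<in> N \<and>
        (\<forall>i. biform d e (\<lambda>x y. F x y $ i)) \<and>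
        (\<forall>x y. (proj_point x, proj_point y) \<in> U \<inter> N \<longrightarrow>
           F x y \<noteq> 0 \<and> \<phi> (proj_point x, proj_point y) = proj_point (F x y)))"

definition regular_map2 ::
  "(('k::field ^ 'a) set \<times> ('k ^ 'b) set) set \<Rightarrow>
   (('k ^ 'a) set \<times> ('k ^ 'b) set \<Rightarrow> ('k ^ 'c) set \<times> ('k ^ 'd) set) \<Rightarrow> bool" where
  "regular_map2 U \<phi> \<longleftrightarrow> regular_map U (fst \<circ> \<phi>) \<and> regular_map U (snd \<circ> \<phi>)"

definition stable_under :: "('g, 'x) monoid_scheme \<Rightarrow> ('g \<Rightarrow> 'p \<Rightarrow> 'p) \<Rightarrow> 'p set \<Rightarrow> bool" where
  "stable_under G act U \<longleftrightarrow> (\<forall>g\<in>carrier G. act g ` U \<subseteq> U)"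

text \<open>The varieties \<open>X\<close> and \<open>Y\<close>, with their \<open>G\<close>-actions, are equivariantly birational if they
  have \<open>G\<close>-stable dense open subsets that are equivariantly isomorphic.\<close>

definition equivariantly_birational ::
  "('g, 'x) monoid_scheme \<Rightarrow>
   ('g \<Rightarrow> ('k::field ^ 'a) set \<times> ('k ^ 'b) set \<Rightarrow> ('k ^ 'a) set \<times> ('k ^ 'b) set) \<Rightarrow>
   (('k ^ 'a) set \<times> ('k ^ 'b) set) set \<Rightarrow>
   ('g \<Rightarrow> ('k ^ 'c) set \<times> ('k ^ 'd) set \<Rightarrow> ('k ^ 'c) set \<times> ('k ^ 'd) set) \<Rightarrow>
   (('k ^ 'c) set \<times> ('k ^ 'd) set) set \<Rightarrow> bool" where
  "equivariantly_birational G actX X actY Y \<longleftrightarrow>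
     (\<exists>U U' \<phi> \<psi>.
        dense_open (subtopology zariski2 X) U \<and> stable_under G actX U \<and>
        dense_open (subtopology zariski2 Y) U' \<and> stable_under G actY U' \<and>
        regular_map2 U \<phi> \<and> regular_map2 U' \<psi> \<and>
        \<phi> ` U \<subseteq> U' \<and> \<psi> ` U' \<subseteq> U \<and>
        (\<forall>p\<in>U. \<psi> (\<phi> p) = p) \<and> (\<forall>q\<in>U'. \<phi> (\<psi> q) = q) \<and>
        (\<forall>g\<in>carrier G. \<forall>p\<in>U. \<phi> (actX g p) = actY g (\<phi> p)))"

section \<open>Representations and actions\<close>

definition general_linear :: "('k::field ^ 'n ^ 'n) monoid" where
  "general_linear = \<lparr>carrier = {M. invertible M}, mult = (**), one = mat 1\<rparr>"

definition representation ::
  "('g, 'x) monoid_scheme \<Rightarrow> ('g \<Rightarrow> 'k::field ^ 'n ^ 'n) \<Rightarrow> bool" where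
  "representation G \<rho> \<longleftrightarrow> \<rho> \<in> hom G general_linear"

definition subrepresentation ::
  "('g, 'x) monoid_scheme \<Rightarrow> ('g \<Rightarrow> 'k::field ^ 'n ^ 'n) \<Rightarrow> ('k ^ 'n) set \<Rightarrow> bool" where
  "subrepresentation G \<rho> V \<longleftrightarrow>
     vec.subspace V \<and> (\<forall>g\<in>carrier G. \<forall>x\<in>V. \<rho> g *v x \<in> V)"

definition proj_act :: "('g \<Rightarrow> 'k::field ^ 'n ^ 'n) \<Rightarrow> 'g \<Rightarrow> ('k ^ 'n) set \<Rightarrow> ('k ^ 'n) set" where
  "proj_act \<rho> g L = (\<lambda>x. \<rho> g *v x) ` L"

definition act_fst :: "('g \<Rightarrow> 'p \<Rightarrow> 'p) \<Rightarrow> 'g \<Rightarrow> 'p \<times> 'q \<Rightarrow> 'p \<times> 'q" where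
  "act_fst act g = map_prod (act g) id"

definition generically_free ::
  "('g, 'x) monoid_scheme \<Rightarrow> ('g \<Rightarrow> 'p \<Rightarrow> 'p) \<Rightarrow> 'p topology \<Rightarrow> bool" where
  "generically_free G act T \<longleftrightarrow>
     (\<exists>U. dense_open T U \<and> (\<forall>p\<in>U. \<forall>g\<in>carrier G. act g p = p \<longrightarrow> g = \<one>\<^bsub>G\<^esub>))"

section \<open>Exterior squares and the Grassmannian of planes\<close>

text \<open>\<open>\<and>\<^sup>2(k\<^sup>n)\<close> is realised inside \<open>k\<^sup>n \<otimes> k\<^sup>n = k\<^bsup>n \<times> n\<^esup>\<close>, with \<open>u \<and> v = u \<otimes> v - v \<otimes> u\<close>.\<close>

definition wedge :: "'k::field ^ 'n \<Rightarrow> 'k ^ 'n \<Rightarrow> 'k ^ ('n \<times> 'n)" where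
  "wedge u v = (\<chi> p. u $ fst p * v $ snd p - v $ fst p * u $ snd p)"

definition ext_square :: "('k::field ^ 'n) set \<Rightarrow> ('k ^ ('n \<times> 'n)) set" where
  "ext_square E = vec.span {wedge u v |u v. u \<in> E \<and> v \<in> E}"

text \<open>The matrix of \<open>M \<otimes> M\<close>; on \<open>\<and>\<^sup>2(k\<^sup>n)\<close> it restricts to the map induced by \<open>M\<close>.\<close>

definition tensor_square :: "'k::field ^ 'n ^ 'n \<Rightarrow> 'k ^ ('n \<times> 'n) ^ ('n \<times> 'n)" where
  "tensor_square M = (\<chi> p q. M $ fst p $ fst q * M $ snd p $ snd q)"

lemma tensor_square_wedge:
  fixes M :: "'k::field ^ 'n ^ 'n"
  shows "tensor_square M *v wedge u v = wedge (M *v u) (M *v v)"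
proof -
  have prod: "(M *v a) $ i * (M *v b) $ j =
      (\<Sum>q\<in>UNIV. M $ i $ fst q * M $ j $ snd q * (a $ fst q * b $ snd q))" for a b i j
    unfolding matrix_vector_mult_def vec_lambda_beta sum_product sum.cartesian_product
    by (intro sum.cong) (auto simp: mult_ac)
  show ?thesis
    unfolding vec_eq_iff
  proof
    fix p :: "'n \<times> 'n"
    have "(tensor_square M *v wedge u v) $ p =
        (\<Sum>q\<in>UNIV. M $ fst p $ fst q * M $ snd p $ snd q *
          (u $ fst q * v $ snd q - v $ fst q * u $ snd q))"
      by (simp only: matrix_vector_mult_def tensor_square_def wedge_def vec_lambda_beta)
    also have "\<dots> = wedge (M *v u) (M *v v) $ p"
      by (simp only: wedge_def vec_lambda_beta prod right_diff_distrib sum_subtractf)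
    finally show "(tensor_square M *v wedge u v) $ p = wedge (M *v u) (M *v v) $ p" .
  qed
qed

definition gr2 :: "('k::field ^ 'n) set set" where
  "gr2 = {E. vec.subspace E \<and> vec.dim E = 2}"

text \<open>The Pluecker embedding sends a plane \<open>E\<close> to the line \<open>\<and>\<^sup>2E\<close> in \<open>\<and>\<^sup>2(k\<^sup>n)\<close>.\<close>

definition pluecker_gr2 :: "('k::field ^ ('n::finite \<times> 'n)) set set" where
  "pluecker_gr2 = ext_square ` gr2"

end

theory Submission
  imports Defs
begin

text \<open>The two sides are birational to the variety of pairs of a plane in \<open>X\<close> and a line in it.
  Over \<open>X\<close> this is a projectivised plane bundle, over \<open>P(W)\<close> its fibre at \<open>w\<close> is the projective
  space of \<open>K_w / w\<close>, where \<open>K_w = {u. w \<and> u \<in> V}\<close>. Averaging polynomial sections that vanish on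
  all but one point of a free orbit gives \<open>G\<close>-invariant rational frames of both bundles, and
  these turn the pairs into \<open>X \<times> P\<^sup>1\<close> and \<open>P(W) \<times> P\<^sup>n\<^sup>-\<^sup>2\<^sup>-\<^sup>r\<close>. This needs two facts. The generic
  dimension of \<open>K_w\<close> is \<open>n - r\<close>, because otherwise \<open>X\<close> would contain too long a chain of
  irreducible closed sets. The action on \<open>X\<close> itself is generically free, because an element that fixes
  every point of \<open>X\<close> acts as a scalar on \<open>W\<close> or on \<open>V\<close>.\<close>

section \<open>Polynomial functions of one parameter\<close>

text \<open>Generic freeness is assumed on \<open>P(W)\<close> and \<open>P(V)\<close> only, and the
  free locus of \<open>P(V)\<close> could miss the closed subset \<open>X\<close>. Averaging over
  \<open>X\<close> needs a point of \<open>X\<close> with trivial stabiliser, which is why elements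
  fixing \<open>X\<close> pointwise have to be classified. A non-scalar one forces kernels of
  dimension 2, so only \<open>r = n - 2\<close> is delicate. The numbers behind the chain: if the
  least kernel has dimension \<open>k\<close>, a plane in \<open>X\<close> with a line in it has
  \<open>(n - 1) + (k - 2)\<close> parameters, and forgetting the line costs one. So
  \<open>X\<close> has dimension at least \<open>n + k - 4\<close>, which is at most
  \<open>2 * (n - 2) - r\<close> only if \<open>k \<le> n - r\<close>; the other inequality is
  linear algebra. No quotient of polynomials is ever formed. Sections are vectors of forms, inverses
  are Cramer numerators, and the scalars that would be denominators disappear in projective space.
  Nor does averaging divide: at the chosen point of the free orbit, the average of a section is a
  nonzero multiple of the section, so a frame there stays a frame.\<close>

definition polyfun :: "('k::field \<Rightarrow> 'k) \<Rightarrow> bool" where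
  "polyfun f \<longleftrightarrow> (\<exists>p. \<forall>s. f s = poly p s)"

lemma polyfun_const [simp, intro]: "polyfun (\<lambda>s. c)"
  unfolding polyfun_def by (rule exI[of _ "[:c:]"]) simp

lemma polyfun_id [simp, intro]: "polyfun (\<lambda>s. s)"
  unfolding polyfun_def by (rule exI[of _ "[:0, 1:]"]) simp

lemma polyfun_add [intro]: "polyfun f \<Longrightarrow> polyfun g \<Longrightarrow> polyfun (\<lambda>s. f s + g s)"
  unfolding polyfun_def by (metis poly_add)

lemma polyfun_mult [intro]: "polyfun f \<Longrightarrow> polyfun g \<Longrightarrow> polyfun (\<lambda>s. f s * g s)"
  unfolding polyfun_def by (metis poly_mult)

lemma polyfun_diff [intro]: "polyfun f \<Longrightarrow> polyfun g \<Longrightarrow> polyfun (\<lambda>s. f s - g s)"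
  unfolding polyfun_def by (metis poly_diff)

lemma polyfun_sum [intro]: "(\<And>i. i \<in> I \<Longrightarrow> polyfun (f i)) \<Longrightarrow> polyfun (\<lambda>s. \<Sum>i\<in>I. f i s)"
  by (induction I rule: infinite_finite_induct) auto

lemma polyfun_prod [intro]: "(\<And>i. i \<in> I \<Longrightarrow> polyfun (f i)) \<Longrightarrow> polyfun (\<lambda>s. \<Prod>i\<in>I. f i s)"
  by (induction I rule: infinite_finite_induct) auto

text \<open>Irreducibility of the affine line: a nonzero polynomial has finitely many roots and the
  field is infinite. The irreducibility of the explicit families below comes from restricting forms
  to a polynomial curve through two points.\<close>

lemma polyfun_common_nonzero:
  fixes f g :: "'k::field_char_0 \<Rightarrow> 'k"
  assumes "polyfun f" "polyfun g" "f s \<noteq> 0" "g t \<noteq> 0"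
  obtains u where "f u \<noteq> 0" "g u \<noteq> 0"
proof -
  obtain p q where pq: "\<And>s. f s = poly p s" "\<And>s. g s = poly q s"
    using assms(1,2) by (auto simp: polyfun_def)
  have "p \<noteq> 0" "q \<noteq> 0" using assms(3,4) pq by auto
  then have "finite {s. poly (p * q) s = 0}" by (intro poly_roots_finite) simp
  then obtain u where "u \<notin> {s. poly (p * q) s = 0}"
    using ex_new_if_finite infinite_UNIV_char_0 by blast
  with pq show ?thesis by (intro that[of u]) auto
qed

section \<open>Forms and biforms\<close>

lemma biform_zero [simp, intro]: "biform d e (\<lambda>(x :: 'k::field^'a) (y :: 'k^'b). 0)"
proof -
  have "biform 0 e (\<lambda>(x :: 'k^'a) (y :: 'k^'b). 0)"
  proof (induction e)
    case (Suc e)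
    then show ?case using biform_snd[OF Suc] by simp
  qed (rule biform_const)
  then show ?thesis
  proof (induction d)
    case (Suc d)
    then show ?case using biform_fst[OF Suc.IH] by simp
  qed
qed

lemma biform_cmult [intro]: "biform d e f \<Longrightarrow> biform d e (\<lambda>x y. c * f x y)"
proof (induction rule: biform.induct)
  case (biform_fst d e f i)
  show ?case using biform.biform_fst[OF biform_fst.IH, of i] by (simp add: mult_ac)
next
  case (biform_snd d e f j)
  show ?case using biform.biform_snd[OF biform_snd.IH, of j] by (simp add: mult_ac)
next
  case (biform_add d e f g)
  show ?case using biform.biform_add[OF biform_add.IH] by (simp add: algebra_simps)
qed (rule biform_const)

lemma biform_mult [intro]:
  assumes "biform d e f" "biform d' e' g"
  shows "biform (d + d') (e + e') (\<lambda>x y. f x y * g x y)"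
  using assms(1)
proof (induction rule: biform.induct)
  case (biform_const c)
  then show ?case using biform_cmult[OF assms(2)] by simp
next
  case (biform_fst d e f i)
  show ?case using biform.biform_fst[OF biform_fst.IH, of i] by (simp add: mult_ac)
next
  case (biform_snd d e f j)
  show ?case using biform.biform_snd[OF biform_snd.IH, of j] by (simp add: mult_ac)
next
  case (biform_add d e f g)
  show ?case using biform.biform_add[OF biform_add.IH] by (simp add: algebra_simps)
qed

lemma biform_uminus [intro]: "biform d e f \<Longrightarrow> biform d e (\<lambda>x y. - f x y)"
  using biform_cmult[of d e f "-1"] by simp

lemma biform_diff [intro]: "biform d e f \<Longrightarrow> biform d e g \<Longrightarrow> biform d e (\<lambda>x y. f x y - g x y)"
  using biform_add[OF _ biform_uminus, of d e f g] by simp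

lemma biform_sum [intro]:
  "(\<And>i. i \<in> I \<Longrightarrow> biform d e (f i)) \<Longrightarrow> biform d e (\<lambda>x y. \<Sum>i\<in>I. f i x y)"
  by (induction I rule: infinite_finite_induct) (auto intro: biform_add)

lemma biform_prod [intro]:
  assumes "\<And>i. i \<in> I \<Longrightarrow> biform (d i) (e i) (f i)"
  shows "biform (\<Sum>i\<in>I. d i) (\<Sum>i\<in>I. e i) (\<lambda>x y. \<Prod>i\<in>I. f i x y)"
  using assms
  by (induction I rule: infinite_finite_induct) (auto intro!: biform_mult biform_const)

lemma form_biform_fst: "form d f \<Longrightarrow> biform d 0 (\<lambda>x y. f x)"
  by (induction rule: form.induct) (auto intro: biform.intros)

lemma form_zero [simp, intro]: "form d (\<lambda>x. 0)"
proof (induction d)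
  case (Suc d)
  then show ?case using form_coord[OF Suc] by simp
qed (rule form_const)

lemma form_cmult [intro]: "form d f \<Longrightarrow> form d (\<lambda>x. c * f x)"
proof (induction rule: form.induct)
  case (form_coord d f i)
  show ?case using form.form_coord[OF form_coord.IH, of i] by (simp add: mult_ac)
next
  case (form_add d f g)
  show ?case using form.form_add[OF form_add.IH] by (simp add: algebra_simps)
qed (rule form_const)

lemma biform_form_fst: "biform d e f \<Longrightarrow> form d (\<lambda>x. f x y)"
  by (induction rule: biform.induct) (auto intro: form.intros)

lemma form_mult [intro]: "form d f \<Longrightarrow> form d' g \<Longrightarrow> form (d + d') (\<lambda>x. f x * g x)"
  using biform_form_fst[OF biform_mult[OF form_biform_fst form_biform_fst]] by blast

lemma form_diff [intro]: "form d f \<Longrightarrow> form d g \<Longrightarrow> form d (\<lambda>x. f x - g x)"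
  using biform_form_fst[OF biform_diff[OF form_biform_fst form_biform_fst]] by blast

lemma form_sum [intro]: "(\<And>i. i \<in> I \<Longrightarrow> form d (f i)) \<Longrightarrow> form d (\<lambda>x. \<Sum>i\<in>I. f i x)"
  by (induction I rule: infinite_finite_induct) (auto intro: form_add)

lemma form_prod [intro]:
  assumes "\<And>i. i \<in> I \<Longrightarrow> form (d i) (f i)"
  shows "form (\<Sum>i\<in>I. d i) (\<lambda>x. \<Prod>i\<in>I. f i x)"
  using assms
  by (induction I rule: infinite_finite_induct) (auto intro!: form_mult form_const)

lemma form_nth [intro]: "form 1 (\<lambda>x. x $ i)"
  using form_coord[OF form_const, of i 1] by simp

lemma biform_form_snd: "biform d e f \<Longrightarrow> form e (\<lambda>y. f x y)"
  by (induction rule: biform.induct) (auto intro: form.intros)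

lemma form_biform_snd: "form e f \<Longrightarrow> biform 0 e (\<lambda>x y. f y)"
  by (induction rule: form.induct) (auto intro: biform.intros)

lemma form_homogeneous: "form d f \<Longrightarrow> f (c *s x) = c ^ d * f x"
  by (induction rule: form.induct) (auto simp: algebra_simps)

lemma biform_homogeneous: "biform d e f \<Longrightarrow> f (a *s x) (b *s y) = a ^ d * b ^ e * f x y"
  by (induction rule: biform.induct) (auto simp: algebra_simps)

lemma form_compose_biform:
  assumes "form d f" "\<And>i. biform a b (\<lambda>x y. F x y $ i)"
  shows "biform (d * a) (d * b) (\<lambda>x y. f (F x y))"
  using assms(1)
  by (induction rule: form.induct) (auto intro: biform_const biform_add intro!: biform_mult assms(2))

lemma form_compose:
  assumes "form d f" "\<And>i. form a (\<lambda>x. F x $ i)"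
  shows "form (d * a) (\<lambda>x. f (F x))"
  using assms(1)
  by (induction rule: form.induct) (auto intro: form_const form_add intro!: form_mult assms(2))

text \<open>The second slot is filled with \<open>x\<close> as well, so its degree joins the first
  one. This is the shape of \<open>Cr (Wt x y) x\<close>; the next lemma serves
  \<open>Yt w (Xi w c)\<close>.\<close>

lemma biform_compose_fst:
  assumes "biform d e f" "\<And>i. biform a b (\<lambda>x y. F x y $ i)"
  shows "biform (d * a + e) (d * b) (\<lambda>x y. f (F x y) x)"
  using assms(1)
proof (induction rule: biform.induct)
  case (biform_fst d e f i)
  show ?case using biform_mult[OF assms(2)[of i] biform_fst.IH] by (simp add: algebra_simps)
next
  case (biform_snd d e f j)
  show ?case using biform.biform_fst[OF biform_snd.IH, of j] by simp
qed (auto intro: biform_const biform_add)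

lemma biform_compose_snd:
  assumes "biform d e f" "\<And>i. biform a b (\<lambda>x y. F x y $ i)"
  shows "biform (d + e * a) (e * b) (\<lambda>x y. f x (F x y))"
  using assms(1)
proof (induction rule: biform.induct)
  case (biform_fst d e f i)
  show ?case using biform.biform_fst[OF biform_fst.IH, of i] by simp
next
  case (biform_snd d e f j)
  show ?case using biform_mult[OF assms(2)[of j] biform_snd.IH] by (simp add: algebra_simps)
qed (auto intro: biform_const biform_add)

lemma form_polyfun:
  "form d f \<Longrightarrow> (\<And>i. polyfun (\<lambda>s. x s $ i)) \<Longrightarrow> polyfun (\<lambda>s. f (x s))"
  by (induction rule: form.induct) auto

lemma polyfun_line: "polyfun (\<lambda>s. (x + s *s (v :: 'k::field^'a)) $ i)"
  by (auto intro!: polyfun_add polyfun_mult)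

lemma form_matrix [intro]: "form 1 (\<lambda>x. (A *v x) $ i)"
  unfolding matrix_vector_mult_def vec_lambda_beta by (intro form_sum form_cmult form_nth)

text \<open>Degrees that depend only on the column give every Leibniz term the same bidegree. Cramer
  determinants are of this kind: one column is replaced by entries of another degree.\<close>

lemma biform_det:
  assumes "\<And>i j. biform (d j) (e j) (\<lambda>x y. A x y $ i $ j)"
  shows "biform (\<Sum>j\<in>UNIV. d j) (\<Sum>j\<in>UNIV. e j) (\<lambda>x y. det (A x y :: 'k::field^'n^'n))"
  unfolding det_def
proof (intro biform_sum biform_cmult)
  fix p :: "'n \<Rightarrow> 'n" assume "p \<in> {p. p permutes UNIV}"
  then have p: "bij p" by (simp add: permutes_bij)
  have "biform (\<Sum>i\<in>UNIV. d (p i)) (\<Sum>i\<in>UNIV. e (p i)) (\<lambda>x y. \<Prod>i\<in>UNIV. A x y $ i $ p i)"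
    by (intro biform_prod assms)
  then show "biform (sum d UNIV) (sum e UNIV) (\<lambda>x y. \<Prod>i\<in>UNIV. A x y $ i $ p i)"
    using sum.reindex_bij_betw[OF p, of d] sum.reindex_bij_betw[OF p, of e] by simp
qed

lemma form_det:
  assumes "\<And>i j. form (d j) (\<lambda>x. A x $ i $ j)"
  shows "form (\<Sum>j\<in>UNIV. d j) (\<lambda>x. det (A x :: 'k::field^'n^'n))"
  using biform_form_fst[OF biform_det[where e = "\<lambda>j. 0", OF form_biform_fst[OF assms]]] by simp

lemma polyfun_det:
  "(\<And>i j. polyfun (\<lambda>s. A s $ i $ j)) \<Longrightarrow> polyfun (\<lambda>s. det (A s :: 'k::field^'n^'n))"
  unfolding det_def by (intro polyfun_sum polyfun_mult polyfun_prod polyfun_const)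

section \<open>Points of projective space\<close>

lemma proj_pointI: "x \<noteq> 0 \<Longrightarrow> x \<in> V \<Longrightarrow> vec.subspace V \<Longrightarrow> proj_point x \<in> proj_space V"
  unfolding proj_space_def proj_point_def
  by (auto simp: vec.span_minimal)

lemma proj_point_UNIV [simp]: "proj_point x \<in> proj_space UNIV \<longleftrightarrow> x \<noteq> 0"
  by (auto intro: proj_pointI) (simp add: proj_point_def proj_space_def)

lemma mem_proj_point: "y \<in> proj_point x \<longleftrightarrow> (\<exists>c. y = c *s x)"
  by (auto simp: proj_point_def vec.span_singleton)

lemma proj_spaceE:
  assumes "L \<in> proj_space V"
  obtains x where "x \<noteq> 0" "x \<in> V" "L = proj_point x"
proof -
  have L: "vec.subspace L" "vec.dim L = 1" "L \<subseteq> V" using assms by (auto simp: proj_space_def)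
  from L(2) have "\<not> L \<subseteq> {0}" using vec.dim_eq_0 by (metis zero_neq_one)
  then obtain x where x: "x \<in> L" "x \<noteq> 0" by auto
  have "proj_point x \<subseteq> L" unfolding proj_point_def using L x by (simp add: vec.span_minimal)
  then have "proj_point x = L"
    by (intro vec.subspace_dim_equal) (use L x in \<open>auto simp: proj_point_def\<close>)
  with x L show ?thesis by (intro that[of x]) auto
qed

lemma proj_point_scale: "c \<noteq> 0 \<Longrightarrow> proj_point (c *s x) = proj_point x"
  unfolding proj_point_def vec.span_singleton
  by (auto simp: image_iff) (metis (no_types) divide_eq_eq times_divide_eq_left nonzero_eq_divide_eq)

lemma proj_point_eqD:
  assumes "proj_point x = proj_point y" "x \<noteq> 0"
  obtains c where "c \<noteq> 0" "x = c *s y"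
  by (metis assms mem_proj_point vector_smult_lid vector_smult_lzero)

text \<open>Equality of points as the vanishing of the 2 by 2 minors: being moved by a matrix
  becomes an open condition, given by quadratic forms.\<close>

lemma proj_point_eq_iff_minors:
  assumes "x \<noteq> 0" "y \<noteq> 0"
  shows "proj_point x = proj_point y \<longleftrightarrow> (\<forall>i j. x $ i * y $ j - x $ j * y $ i = 0)"
proof
  assume "proj_point x = proj_point y"
  then obtain c where "x = c *s y" using proj_point_eqD assms(1) by metis
  then show "\<forall>i j. x $ i * y $ j - x $ j * y $ i = 0" by simp
next
  assume R: "\<forall>i j. x $ i * y $ j - x $ j * y $ i = 0"
  obtain i where i: "y $ i \<noteq> 0" using assms(2) by (auto simp: vec_eq_iff)
  have "\<forall>j. x $ j = (x $ i / y $ i) * y $ j" using R i by (auto simp: field_simps)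
  then have *: "x = (x $ i / y $ i) *s y" unfolding vec_eq_iff vector_smult_component .
  then have "x $ i / y $ i \<noteq> 0" using assms(1) by (metis vector_smult_lzero)
  then show "proj_point x = proj_point y" by (subst *) (rule proj_point_scale)
qed

lemma proj_act_point: "proj_act \<rho> g (proj_point x) = proj_point (\<rho> g *v x)"
  unfolding proj_act_def proj_point_def
  using vec.linear_span_image[OF matrix_vector_mul_linear_gen[of "\<rho> g"], of "{x}"] by simp

definition nonvanishing :: "('k::field ^ 'a \<Rightarrow> 'k) \<Rightarrow> ('k ^ 'a) set set" where
  "nonvanishing f = {L \<in> proj_space UNIV. \<exists>x\<in>L. f x \<noteq> 0}"

definition nonvanishing2 ::
  "('k::field ^ 'a \<Rightarrow> 'k ^ 'b \<Rightarrow> 'k) \<Rightarrow> (('k ^ 'a) set \<times> ('k ^ 'b) set) set" where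
  "nonvanishing2 f =
     {(L, M). L \<in> proj_space UNIV \<and> M \<in> proj_space UNIV \<and> (\<exists>x\<in>L. \<exists>y\<in>M. f x y \<noteq> 0)}"

lemma proj_point_nonvanishing:
  assumes "form d f"
  shows "proj_point x \<in> nonvanishing f \<longleftrightarrow> x \<noteq> 0 \<and> f x \<noteq> 0"
proof
  assume "proj_point x \<in> nonvanishing f"
  then show "x \<noteq> 0 \<and> f x \<noteq> 0"
    using form_homogeneous[OF assms] by (auto simp: nonvanishing_def mem_proj_point)
next
  assume "x \<noteq> 0 \<and> f x \<noteq> 0"
  moreover have "x \<in> proj_point x" by (simp add: proj_point_def vec.span_base)
  ultimately show "proj_point x \<in> nonvanishing f" by (auto simp: nonvanishing_def)
qed

lemma proj_point_nonvanishing2: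
  assumes "biform d e f"
  shows "(proj_point x, proj_point y) \<in> nonvanishing2 f \<longleftrightarrow> x \<noteq> 0 \<and> y \<noteq> 0 \<and> f x y \<noteq> 0"
proof
  assume "(proj_point x, proj_point y) \<in> nonvanishing2 f"
  then show "x \<noteq> 0 \<and> y \<noteq> 0 \<and> f x y \<noteq> 0"
    using biform_homogeneous[OF assms] by (auto simp: nonvanishing2_def mem_proj_point)
next
  assume "x \<noteq> 0 \<and> y \<noteq> 0 \<and> f x y \<noteq> 0"
  moreover have "x \<in> proj_point x" "y \<in> proj_point y" by (simp_all add: proj_point_def vec.span_base)
  ultimately show "(proj_point x, proj_point y) \<in> nonvanishing2 f" by (auto simp: nonvanishing2_def)
qed

section \<open>Zariski-open sets\<close>

lemma openin_nonvanishing: "form d f \<Longrightarrow> openin zariski (nonvanishing f)"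
  unfolding zariski_def nonvanishing_def by (intro topology_generated_by_Basis) blast

lemma openin_nonvanishing2: "biform d e f \<Longrightarrow> openin zariski2 (nonvanishing2 f)"
  unfolding zariski2_def nonvanishing2_def by (intro topology_generated_by_Basis) blast

section \<open>Irreducibility\<close>

lemma irreducible_space_open:
  "irreducible_space T \<longleftrightarrow> topspace T \<noteq> {} \<and>
    (\<forall>U V. openin T U \<longrightarrow> openin T V \<longrightarrow> U \<noteq> {} \<longrightarrow> V \<noteq> {} \<longrightarrow> U \<inter> V \<noteq> {})"
proof (intro iffI conjI allI impI)
  assume irr: "irreducible_space T"
  then show "topspace T \<noteq> {}" by (simp add: irreducible_space_def)
  fix U V assume UV: "openin T U" "openin T V" "U \<noteq> {}" "V \<noteq> {}"
  show "U \<inter> V \<noteq> {}"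
  proof
    assume "U \<inter> V = {}"
    then have "(topspace T - U) \<union> (topspace T - V) = topspace T" by auto
    moreover have "closedin T (topspace T - U)" "closedin T (topspace T - V)" using UV by auto
    ultimately have "topspace T - U = topspace T \<or> topspace T - V = topspace T"
      using irr unfolding irreducible_space_def by blast
    then show False
      using UV openin_subset by (metis Diff_disjoint Int_absorb2 inf_commute)
  qed
next
  assume R: "topspace T \<noteq> {} \<and>
    (\<forall>U V. openin T U \<longrightarrow> openin T V \<longrightarrow> U \<noteq> {} \<longrightarrow> V \<noteq> {} \<longrightarrow> U \<inter> V \<noteq> {})"
  show "irreducible_space T" unfolding irreducible_space_def
  proof (intro conjI allI impI)
    fix C D assume CD: "closedin T C" "closedin T D" "C \<union> D = topspace T"
    have "(topspace T - C) \<inter> (topspace T - D) = {}" using CD(3) by auto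
    then have "topspace T - C = {} \<or> topspace T - D = {}"
      using R CD by (meson closedin_def)
    then show "C = topspace T \<or> D = topspace T"
      using CD closedin_subset by fastforce
  qed (use R in auto)
qed

lemma irreducible_space_finite_Inter:
  assumes "irreducible_space T" "finite I" "\<And>i. i \<in> I \<Longrightarrow> openin T (U i)" "\<And>i. i \<in> I \<Longrightarrow> U i \<noteq> {}"
  shows "\<exists>p\<in>topspace T. \<forall>i\<in>I. p \<in> U i"
proof -
  have "openin T (topspace T \<inter> (\<Inter>i\<in>I. U i)) \<and> topspace T \<inter> (\<Inter>i\<in>I. U i) \<noteq> {}"
    using assms(2,3,4)
  proof (induction I)
    case empty
    then show ?case using assms(1) by (simp add: irreducible_space_def)
  next
    case (insert i I)
    have eq: "topspace T \<inter> (\<Inter>i\<in>insert i I. U i) = U i \<inter> (topspace T \<inter> (\<Inter>i\<in>I. U i))" by auto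
    have "openin T (topspace T \<inter> (\<Inter>i\<in>I. U i))" "topspace T \<inter> (\<Inter>i\<in>I. U i) \<noteq> {}"
      using insert by auto
    moreover have "openin T (U i)" "U i \<noteq> {}" using insert by auto
    ultimately show ?case
      unfolding eq using assms(1) unfolding irreducible_space_open by (meson openin_Int)
  qed
  then show ?thesis by auto
qed

lemma irreducible_space_dense_open:
  assumes "irreducible_space T" "openin T U" "U \<noteq> {}"
  shows "dense_open T U"
  unfolding dense_open_def
proof
  show "T closure_of U = topspace T"
    unfolding closure_of_def using assms unfolding irreducible_space_open by blast
qed fact

text \<open>Applies to both Zariski topologies: products of forms are forms, so the nonvanishing
  loci are closed under intersection, and irreducibility needs testing on them only.\<close>

lemma openin_generated_by_basis:
  assumes Int: "\<And>A B. A \<in> \<B> \<Longrightarrow> B \<in> \<B> \<Longrightarrow> A \<inter> B \<in> \<B>"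
    and U: "openin (topology_generated_by \<B>) U"
  shows "\<forall>p\<in>U. \<exists>B\<in>\<B>. p \<in> B \<and> B \<subseteq> U"
proof -
  have "generate_topology_on \<B> U" using U by (simp add: openin_topology_generated_by_iff)
  then show ?thesis
  proof (induction rule: generate_topology_on.induct)
    case (Int U V)
    show ?case
    proof
      fix p assume p: "p \<in> U \<inter> V"
      obtain A where "A \<in> \<B>" "p \<in> A" "A \<subseteq> U" using Int.IH(1) p by blast
      moreover obtain B where "B \<in> \<B>" "p \<in> B" "B \<subseteq> V" using Int.IH(2) p by blast
      ultimately show "\<exists>B\<in>\<B>. p \<in> B \<and> B \<subseteq> U \<inter> V" using assms(1) by (intro bexI[of _ "A \<inter> B"]) auto
    qed
  next
    case (UN K)
    then show ?case by (meson UnionE Union_upper order_trans)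
  qed auto
qed

lemma irreducible_generated_byI:
  assumes Int: "\<And>A B. A \<in> \<B> \<Longrightarrow> B \<in> \<B> \<Longrightarrow> A \<inter> B \<in> \<B>"
    and S: "S \<noteq> {}" "S \<subseteq> topspace (topology_generated_by \<B>)"
    and meet: "\<And>A B. A \<in> \<B> \<Longrightarrow> B \<in> \<B> \<Longrightarrow> S \<inter> A \<noteq> {} \<Longrightarrow> S \<inter> B \<noteq> {} \<Longrightarrow> S \<inter> A \<inter> B \<noteq> {}"
  shows "irreducible_space (subtopology (topology_generated_by \<B>) S)"
  unfolding irreducible_space_open
proof (intro conjI allI impI)
  show "topspace (subtopology (topology_generated_by \<B>) S) \<noteq> {}"
    using S unfolding topspace_subtopology by blast
  fix U V
  assume "openin (subtopology (topology_generated_by \<B>) S) U"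
    "openin (subtopology (topology_generated_by \<B>) S) V" "U \<noteq> {}" "V \<noteq> {}"
  then obtain U' V' where UV: "openin (topology_generated_by \<B>) U'" "openin (topology_generated_by \<B>) V'"
    "U = U' \<inter> S" "V = V' \<inter> S" by (auto simp: openin_subtopology)
  obtain p q where pq: "p \<in> U' \<inter> S" "q \<in> V' \<inter> S" using UV(3,4) \<open>U \<noteq> {}\<close> \<open>V \<noteq> {}\<close> by blast
  obtain A where A: "A \<in> \<B>" "p \<in> A" "A \<subseteq> U'" using openin_generated_by_basis[OF Int UV(1)] pq(1) by blast
  obtain B where B: "B \<in> \<B>" "q \<in> B" "B \<subseteq> V'" using openin_generated_by_basis[OF Int UV(2)] pq(2) by blast
  have "S \<inter> A \<inter> B \<noteq> {}" using A B pq by (intro meet) auto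
  then show "U \<inter> V \<noteq> {}" using UV A B by blast
qed

lemma nonvanishing_Int:
  assumes "form d f" "form e g"
  shows "nonvanishing f \<inter> nonvanishing g = nonvanishing (\<lambda>x. f x * g x)"
proof (rule Set.set_eqI)
  fix L
  show "L \<in> nonvanishing f \<inter> nonvanishing g \<longleftrightarrow> L \<in> nonvanishing (\<lambda>x. f x * g x)"
  proof (cases "L \<in> proj_space UNIV")
    case True
    then obtain x where "L = proj_point x" by (rule proj_spaceE)
    then show ?thesis
      by (auto simp: proj_point_nonvanishing[OF assms(1)] proj_point_nonvanishing[OF assms(2)]
          proj_point_nonvanishing[OF form_mult[OF assms]])
  qed (auto simp: nonvanishing_def)
qed

lemma nonvanishing2_Int:
  assumes "biform d e f" "biform d' e' g"
  shows "nonvanishing2 f \<inter> nonvanishing2 g = nonvanishing2 (\<lambda>x y. f x y * g x y)"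
proof (rule Set.set_eqI)
  fix p
  show "p \<in> nonvanishing2 f \<inter> nonvanishing2 g \<longleftrightarrow> p \<in> nonvanishing2 (\<lambda>x y. f x y * g x y)"
  proof (cases "fst p \<in> proj_space UNIV \<and> snd p \<in> proj_space UNIV")
    case True
    then obtain x y where "fst p = proj_point x" "snd p = proj_point y" by (metis proj_spaceE)
    then have "p = (proj_point x, proj_point y)" by (simp add: prod_eq_iff)
    then show ?thesis
      by (auto simp: proj_point_nonvanishing2[OF assms(1)] proj_point_nonvanishing2[OF assms(2)]
          proj_point_nonvanishing2[OF biform_mult[OF assms]])
  qed (auto simp: nonvanishing2_def)
qed

lemma irreducible_zariskiI:
  fixes S :: "('k::field ^ 'a::finite) set set"
  assumes "S \<noteq> {}" "S \<subseteq> proj_space UNIV"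
    and "\<And>d e f g. form d f \<Longrightarrow> form e g \<Longrightarrow> S \<inter> nonvanishing f \<noteq> {} \<Longrightarrow> S \<inter> nonvanishing g \<noteq> {} \<Longrightarrow>
      S \<inter> nonvanishing f \<inter> nonvanishing g \<noteq> {}"
  shows "irreducible_space (subtopology zariski S)"
  unfolding zariski_def nonvanishing_def[symmetric]
proof (rule irreducible_generated_byI)
  show "S \<subseteq> topspace (topology_generated_by {nonvanishing f |f. \<exists>d. form d f})"
    using assms(2) topspace_zariski unfolding zariski_def nonvanishing_def[symmetric] by blast
next
  fix A B :: "('k ^ 'a) set set"
  assume "A \<in> {nonvanishing f |f. \<exists>d. form d f}" "B \<in> {nonvanishing f |f. \<exists>d. form d f}"
  then obtain d f e g where AB: "A = nonvanishing f" "form d f" "B = nonvanishing g" "form e g" by blast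
  show "A \<inter> B \<in> {nonvanishing f |f. \<exists>d. form d f}"
    unfolding AB(1,3) nonvanishing_Int[OF AB(2,4)] using form_mult[OF AB(2,4)] by blast
  show "S \<inter> A \<inter> B \<noteq> {}" if "S \<inter> A \<noteq> {}" "S \<inter> B \<noteq> {}"
    using assms(3)[OF AB(2,4)] that unfolding AB(1,3) by simp
qed (rule assms(1))

lemma irreducible_zariski2I:
  fixes S :: "(('k::field ^ 'a::finite) set \<times> ('k ^ 'b::finite) set) set"
  assumes "S \<noteq> {}" "S \<subseteq> proj_space UNIV \<times> proj_space UNIV"
    and "\<And>d e d' e' f g. biform d e f \<Longrightarrow> biform d' e' g \<Longrightarrow> S \<inter> nonvanishing2 f \<noteq> {} \<Longrightarrow>
      S \<inter> nonvanishing2 g \<noteq> {} \<Longrightarrow> S \<inter> nonvanishing2 f \<inter> nonvanishing2 g \<noteq> {}"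
  shows "irreducible_space (subtopology zariski2 S)"
  unfolding zariski2_def nonvanishing2_def[symmetric]
proof (rule irreducible_generated_byI)
  show "S \<subseteq> topspace (topology_generated_by {nonvanishing2 f |f. \<exists>d e. biform d e f})"
    using assms(2) topspace_zariski2 unfolding zariski2_def nonvanishing2_def[symmetric] by blast
next
  fix A B :: "(('k ^ 'a) set \<times> ('k ^ 'b) set) set"
  assume "A \<in> {nonvanishing2 f |f. \<exists>d e. biform d e f}" "B \<in> {nonvanishing2 f |f. \<exists>d e. biform d e f}"
  then obtain d e f d' e' g where
    AB: "A = nonvanishing2 f" "biform d e f" "B = nonvanishing2 g" "biform d' e' g" by blast
  show "A \<inter> B \<in> {nonvanishing2 f |f. \<exists>d e. biform d e f}"
    unfolding AB(1,3) nonvanishing2_Int[OF AB(2,4)] using biform_mult[OF AB(2,4)] by blast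
  show "S \<inter> A \<inter> B \<noteq> {}" if "S \<inter> A \<noteq> {}" "S \<inter> B \<noteq> {}"
    using assms(3)[OF AB(2,4)] that unfolding AB(1,3) by simp
qed (rule assms(1))

lemma form_common_nonzero:
  fixes f g :: "'k::field_char_0 ^ 'a \<Rightarrow> 'k"
  assumes f: "form d f" and g: "form e g" and "x \<noteq> 0" "f x \<noteq> 0" "g y \<noteq> 0"
  obtains z where "z \<noteq> 0" "f z \<noteq> 0" "g z \<noteq> 0"
proof -
  define z where "z = (\<lambda>s. x + s *s (y - x))"
  obtain i where i: "x $ i \<noteq> 0" using \<open>x \<noteq> 0\<close> by (auto simp: vec_eq_iff)
  have pz: "polyfun (\<lambda>s. z s $ j)" for j
    unfolding z_def by (rule polyfun_line)
  \<comment> \<open>The coordinate factor keeps \<open>z s\<close> away from the origin, which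
    \<open>f\<close> alone does not do in degree 0.\<close>
  have "polyfun (\<lambda>s. f (z s) * z s $ i)" "polyfun (\<lambda>s. g (z s))"
    by (intro polyfun_mult form_polyfun[OF f] form_polyfun[OF g] pz)+
  moreover have "f (z 0) * z 0 $ i \<noteq> 0" "g (z 1) \<noteq> 0"
    using assms i by (auto simp: z_def)
  ultimately obtain s where "f (z s) * z s $ i \<noteq> 0" "g (z s) \<noteq> 0"
    by (rule polyfun_common_nonzero)
  then show ?thesis by (intro that[of "z s"]) auto
qed

lemma irreducible_proj_space:
  "irreducible_space (subtopology zariski (proj_space (UNIV :: ('k::field_char_0 ^ 'a) set)))"
proof (rule irreducible_zariskiI)
  obtain i :: 'a where True by simp
  have "proj_point (axis i (1::'k)) \<in> proj_space UNIV" by (simp add: axis_eq_0_iff)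
  then show "proj_space (UNIV :: ('k ^ 'a) set) \<noteq> {}" by blast
next
  fix d e and f g :: "'k ^ 'a \<Rightarrow> 'k"
  assume fg: "form d f" "form e g"
    and ne: "proj_space UNIV \<inter> nonvanishing f \<noteq> {}" "proj_space UNIV \<inter> nonvanishing g \<noteq> {}"
  obtain L M where LM: "L \<in> proj_space UNIV" "L \<in> nonvanishing f" "M \<in> proj_space UNIV" "M \<in> nonvanishing g"
    using ne by blast
  obtain x y where "L = proj_point x" "M = proj_point y" using LM by (metis proj_spaceE)
  with LM fg have "x \<noteq> 0" "f x \<noteq> 0" "g y \<noteq> 0" by (auto simp: proj_point_nonvanishing)
  then obtain z where "z \<noteq> 0" "f z \<noteq> 0" "g z \<noteq> 0"
    by (rule form_common_nonzero[OF fg])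
  then have "proj_point z \<in> proj_space UNIV \<inter> nonvanishing f \<inter> nonvanishing g"
    using fg by (simp add: proj_point_nonvanishing)
  then show "proj_space UNIV \<inter> nonvanishing f \<inter> nonvanishing g \<noteq> {}" by blast
qed simp

text \<open>The topology is not the product topology, so slices are used: two slices with fixed
  second coordinate give forms on \<open>S\<close>, irreducibility of \<open>S\<close> gives one
  base point where both survive, and the fibre over it is a projective space.\<close>

lemma irreducible_times_proj_space:
  fixes S :: "('k::field_char_0 ^ 'a) set set"
  assumes "irreducible_space (subtopology zariski S)" "S \<subseteq> proj_space UNIV"
  shows "irreducible_space (subtopology zariski2 (S \<times> proj_space (UNIV :: ('k ^ 'b) set)))"
proof (rule irreducible_zariski2I)
  have "S \<noteq> {}" using assms(1) by (auto simp: irreducible_space_def)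
  moreover have "proj_space (UNIV :: ('k ^ 'b) set) \<noteq> {}"
    using irreducible_proj_space[where 'a = 'b and 'k = 'k] by (auto simp: irreducible_space_def)
  ultimately show "S \<times> proj_space (UNIV :: ('k ^ 'b) set) \<noteq> {}" by blast
next
  fix d e d' e' and f g :: "'k ^ 'a \<Rightarrow> 'k ^ 'b \<Rightarrow> 'k"
  assume f: "biform d e f" and g: "biform d' e' g"
    and ne: "S \<times> proj_space UNIV \<inter> nonvanishing2 f \<noteq> {}" "S \<times> proj_space UNIV \<inter> nonvanishing2 g \<noteq> {}"
  have point: "\<exists>x y. x \<noteq> 0 \<and> y \<noteq> 0 \<and> proj_point x \<in> S \<and> h x y \<noteq> 0"
    if "S \<times> proj_space UNIV \<inter> nonvanishing2 h \<noteq> {}" "biform d e h"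
    for h :: "'k ^ 'a \<Rightarrow> 'k ^ 'b \<Rightarrow> 'k" and d e
  proof -
    obtain L M where LM: "L \<in> S" "M \<in> proj_space UNIV" "(L, M) \<in> nonvanishing2 h"
      using \<open>S \<times> proj_space UNIV \<inter> nonvanishing2 h \<noteq> {}\<close> by blast
    moreover have "L \<in> proj_space UNIV" using LM assms(2) by blast
    moreover obtain x y where "L = proj_point x" "M = proj_point y"
      using calculation by (metis proj_spaceE)
    ultimately show ?thesis using \<open>biform d e h\<close> by (auto simp: proj_point_nonvanishing2)
  qed
  obtain x1 y1 where 1: "x1 \<noteq> 0" "y1 \<noteq> 0" "proj_point x1 \<in> S" "f x1 y1 \<noteq> 0"
    using point[OF ne(1) f] by blast
  obtain x2 y2 where 2: "x2 \<noteq> 0" "y2 \<noteq> 0" "proj_point x2 \<in> S" "g x2 y2 \<noteq> 0"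
    using point[OF ne(2) g] by blast
  have ff: "form d (\<lambda>x. f x y1)" and gg: "form d' (\<lambda>x. g x y2)"
    using f g by (auto intro: biform_form_fst)
  have "openin (subtopology zariski S) (S \<inter> nonvanishing (\<lambda>x. f x y1))"
    "openin (subtopology zariski S) (S \<inter> nonvanishing (\<lambda>x. g x y2))"
    using openin_nonvanishing[OF ff] openin_nonvanishing[OF gg] by (auto intro: openin_subtopology_Int2)
  moreover have "S \<inter> nonvanishing (\<lambda>x. f x y1) \<noteq> {}" "S \<inter> nonvanishing (\<lambda>x. g x y2) \<noteq> {}"
    using 1 2 proj_point_nonvanishing[OF ff] proj_point_nonvanishing[OF gg] by blast+
  ultimately have "(S \<inter> nonvanishing (\<lambda>x. f x y1)) \<inter> (S \<inter> nonvanishing (\<lambda>x. g x y2)) \<noteq> {}"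
    using assms(1) unfolding irreducible_space_open by simp
  then obtain L where L: "L \<in> S" "L \<in> nonvanishing (\<lambda>x. f x y1)" "L \<in> nonvanishing (\<lambda>x. g x y2)"
    by blast
  then have "L \<in> proj_space UNIV" using assms(2) by blast
  then obtain x where x: "L = proj_point x" by (rule proj_spaceE)
  with L have "x \<noteq> 0" "f x y1 \<noteq> 0" "g x y2 \<noteq> 0"
    by (auto simp: proj_point_nonvanishing[OF ff] proj_point_nonvanishing[OF gg])
  moreover from this obtain y where "y \<noteq> 0" "f x y \<noteq> 0" "g x y \<noteq> 0"
    using form_common_nonzero[OF biform_form_snd[OF f] biform_form_snd[OF g] 1(2)] by blast
  ultimately have "(proj_point x, proj_point y) \<in> S \<times> proj_space UNIV \<inter> nonvanishing2 f \<inter> nonvanishing2 g"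
    using L x f g by (auto simp: proj_point_nonvanishing2)
  then show "S \<times> proj_space UNIV \<inter> nonvanishing2 f \<inter> nonvanishing2 g \<noteq> {}" by blast
qed (use assms in auto)

lemma dense_open_meets_nonvanishing:
  assumes "dense_open (subtopology zariski S) U" "form d f" "x \<noteq> 0" "proj_point x \<in> S" "f x \<noteq> 0"
  obtains y where "y \<noteq> 0" "proj_point y \<in> U" "f y \<noteq> 0"
proof -
  let ?T = "subtopology zariski S"
  have mem: "proj_point x \<in> topspace ?T"
    using assms(3,4) by (simp add: topspace_zariski)
  have "openin ?T (S \<inter> nonvanishing f)"
    using openin_nonvanishing[OF assms(2)] by (rule openin_subtopology_Int2)
  moreover have "proj_point x \<in> S \<inter> nonvanishing f"
    using assms proj_point_nonvanishing by blast
  moreover have "proj_point x \<in> ?T closure_of U"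
    using assms(1) mem by (simp add: dense_open_def)
  ultimately obtain L where L: "L \<in> U" "L \<in> nonvanishing f"
    unfolding in_closure_of by blast
  then have "L \<in> proj_space UNIV" by (simp add: nonvanishing_def)
  then obtain y where y: "L = proj_point y" by (rule proj_spaceE)
  with L show ?thesis using that[of y] by (simp add: proj_point_nonvanishing[OF assms(2)])
qed

section \<open>A lower bound for the Krull dimension\<close>

lemma irreducible_closure_of:
  assumes "irreducible_space (subtopology T S)" "S \<subseteq> topspace T"
  shows "irreducible_space (subtopology T (T closure_of S))"
  unfolding irreducible_space_open
proof (intro conjI allI impI)
  have "S \<noteq> {}" using assms(1) by (auto simp: irreducible_space_def)
  then show "topspace (subtopology T (T closure_of S)) \<noteq> {}"
    using assms(2) closure_of_subset[OF assms(2)] by auto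
  fix U V
  assume "openin (subtopology T (T closure_of S)) U" "openin (subtopology T (T closure_of S)) V"
    "U \<noteq> {}" "V \<noteq> {}"
  then obtain U' V' where UV: "openin T U'" "openin T V'" "U = U' \<inter> T closure_of S" "V = V' \<inter> T closure_of S"
    by (auto simp: openin_subtopology)
  have "U' \<inter> S \<noteq> {}" "V' \<inter> S \<noteq> {}"
    using UV \<open>U \<noteq> {}\<close> \<open>V \<noteq> {}\<close> by (auto simp: closure_of_def)
  moreover have "openin (subtopology T S) (U' \<inter> S)" "openin (subtopology T S) (V' \<inter> S)"
    using UV by (auto simp: openin_subtopology)
  ultimately have "(U' \<inter> S) \<inter> (V' \<inter> S) \<noteq> {}"
    using assms(1) unfolding irreducible_space_open by blast
  then show "U \<inter> V \<noteq> {}" using UV closure_of_subset[OF assms(2)] by blast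
qed

lemma closure_of_vanishing:
  assumes "form d f" "S \<subseteq> proj_space UNIV" "S \<inter> nonvanishing f = {}"
  shows "subtopology zariski X closure_of S \<inter> nonvanishing f = {}"
proof -
  have "zariski closure_of S \<inter> nonvanishing f = {}"
    using openin_nonvanishing[OF assms(1)] assms(3) by (auto simp: closure_of_def)
  then show ?thesis using closure_of_subtopology_subset[of zariski X S] by blast
qed

text \<open>The sets need not be closed. Their closures are irreducible, and a form that vanishes on
  one set but not on the next one keeps the closures apart, so images of polynomial families serve
  as chains without any computation of closures.\<close>

lemma krull_dim_ge_chain:
  assumes X: "X \<subseteq> proj_space UNIV"
    and S: "\<And>i. i \<le> m \<Longrightarrow> S i \<subseteq> X" "\<And>i. i \<le> m \<Longrightarrow> irreducible_space (subtopology zariski (S i))"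
      "\<And>i. i < m \<Longrightarrow> S i \<subseteq> S (Suc i)"
    and sep: "\<And>i. i < m \<Longrightarrow> \<exists>d f. form d f \<and> S i \<inter> nonvanishing f = {} \<and> S (Suc i) \<inter> nonvanishing f \<noteq> {}"
  shows "enat m \<le> krull_dim (subtopology zariski X)"
proof -
  let ?T = "subtopology zariski X"
  have top: "topspace ?T = X" using X by (auto simp: topspace_zariski)
  have sub: "S i \<subseteq> ?T closure_of (S i)" if "i \<le> m" for i
    using S(1)[OF that] top by (metis closure_of_subset)
  have "irreducible_chain ?T m (\<lambda>i. ?T closure_of (S i))"
    unfolding irreducible_chain_def
  proof (intro conjI allI impI)
    fix i assume i: "i \<le> m"
    have "subtopology ?T (S i) = subtopology zariski (S i)"
      using S(1)[OF i] by (simp add: subtopology_subtopology Int_absorb1)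
    then show "irreducible_space (subtopology ?T (?T closure_of (S i)))"
      using S(1,2)[OF i] X by (intro irreducible_closure_of) (auto simp: topspace_zariski)
  next
    fix i assume i: "i < m"
    obtain d f where f: "form d f" "S i \<inter> nonvanishing f = {}" "S (Suc i) \<inter> nonvanishing f \<noteq> {}"
      using sep[OF i] by blast
    have "?T closure_of (S i) \<inter> nonvanishing f = {}"
      using f(1,2) S(1)[of i] X i by (intro closure_of_vanishing) auto
    moreover have "?T closure_of (S (Suc i)) \<inter> nonvanishing f \<noteq> {}"
      using f(3) sub[of "Suc i"] i by auto
    ultimately show "?T closure_of (S i) \<subset> ?T closure_of (S (Suc i))"
      using closure_of_mono[OF S(3)[OF i]] by blast
  qed auto
  then show ?thesis unfolding krull_dim_def by (intro Sup_upper) blast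
qed

section \<open>Linear algebra\<close>

lemma matrix_extend:
  fixes f :: "'k::field^'n \<Rightarrow> 'k^'m"
  assumes "vec.independent B"
  obtains A where "\<And>b. b \<in> B \<Longrightarrow> A *v b = f b"
proof -
  obtain g where "Vector_Spaces.linear (*s) (*s) g" "\<forall>x\<in>B. g x = f x"
    using vec.linear_independent_extend[OF assms] by blast
  then show ?thesis by (intro that[of "matrix g"]) (simp add: matrix_works)
qed

text \<open>\<open>Q\<close> is idempotent with kernel exactly \<open>V\<close>. Its range replaces
  the quotient by \<open>V\<close>, so that quotient maps stay matrices.\<close>

lemma projection_along:
  fixes V :: "('k::field^'n) set"
  assumes V: "vec.subspace V"
  obtains Q where "\<And>x. x \<in> V \<Longrightarrow> Q *v x = 0" "\<And>x. x - Q *v x \<in> V" "\<And>x. Q *v (Q *v x) = Q *v x"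
proof -
  obtain B where B: "B \<subseteq> V" "vec.independent B" "V \<subseteq> vec.span B" "card B = vec.dim V"
    by (rule vec.basis_exists)
  obtain C where C: "B \<subseteq> C" "C \<subseteq> UNIV" "vec.independent C" "UNIV \<subseteq> vec.span C"
    by (rule vec.maximal_independent_subset_extend[OF subset_UNIV B(2)])
  obtain Q where Q: "\<And>b. b \<in> C \<Longrightarrow> Q *v b = (if b \<in> B then 0 else b)"
    using matrix_extend[OF C(3), of "\<lambda>b. if b \<in> B then 0 else b"] by blast
  have zero: "Q *v x = 0" if "x \<in> V" for x
  proof -
    have "x \<in> vec.span B" using B(3) that by blast
    then show ?thesis
    proof (induction rule: vec.span_induct_alt)
      case (step c b y)
      have "Q *v b = 0" using Q[of b] step(1) C(1) by auto
      then show ?case by (simp only: matrix_vector_right_distrib vector_scalar_commute step(2)) simp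
    qed simp
  qed
  have diff: "x - Q *v x \<in> V" for x
  proof -
    have "x \<in> vec.span C" using C(4) by blast
    then show ?thesis
    proof (induction rule: vec.span_induct_alt)
      case base
      then show ?case using V by (simp add: vec.subspace_0)
    next
      case (step c b y)
      have "b - Q *v b \<in> V" using Q[OF step(1)] B(1) V by (auto simp: vec.subspace_0)
      then have "c *s (b - Q *v b) + (y - Q *v y) \<in> V"
        using step V by (intro vec.subspace_add vec.subspace_scale)
      then show ?case by (simp add: matrix_vector_right_distrib vector_scalar_commute algebra_simps vec.scale_right_diff_distrib)
    qed
  qed
  have "Q *v (Q *v x) = Q *v x" for x
    using zero[OF diff[of x]] by (simp add: matrix_vector_mult_diff_distrib)
  with zero diff show ?thesis by (intro that)
qed

text \<open>A complement \<open>C\<close> of the preimage is mapped injectively into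
  \<open>S\<close>, and its image meets \<open>V\<close> only in 0.\<close>

lemma dim_preimage:
  fixes A :: "'k::field^'n^'m"
  assumes V: "vec.subspace V" "V \<subseteq> S" and S: "vec.subspace S" "\<And>u. A *v u \<in> S"
  shows "CARD('n) + vec.dim V \<le> vec.dim {u. A *v u \<in> V} + vec.dim S"
proof -
  define K where "K = {u. A *v u \<in> V}"
  have K: "vec.subspace K"
    unfolding K_def using vec.subspace_linear_preimage V(1)
    by (metis vec.linear_subspace_linear_preimage[OF matrix_vector_mul_linear_gen V(1)])
  obtain Q where Q: "\<And>x. x \<in> K \<Longrightarrow> Q *v x = 0" "\<And>x. x - Q *v x \<in> K" "\<And>x. Q *v (Q *v x) = Q *v x"
    using projection_along[OF K] by blast
  define C where "C = range ((*v) Q)"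
  have C: "vec.subspace C"
    unfolding C_def by (intro vec.linear_subspace_image[OF matrix_vector_mul_linear_gen]) simp
  have QC: "Q *v x = x" if "x \<in> C" for x using that Q(3) by (auto simp: C_def)
  have KC: "K \<inter> C = {0}" using QC Q(1) K C by (force simp: vec.subspace_0)
  have "x \<in> {x + y |x y. x \<in> K \<and> y \<in> C}" for x
    using Q(2)[of x] by (intro CollectI exI[of _ "x - Q *v x"] exI[of _ "Q *v x"]) (auto simp: C_def)
  then have "{x + y |x y. x \<in> K \<and> y \<in> C} = UNIV" by blast
  with vec.dim_sums_Int[OF K C] KC have dK: "CARD('n) = vec.dim K + vec.dim C"
    by (simp only: vec_dim_card vec.dim_singleton) simp
  have inj: "inj_on ((*v) A) C"
  proof (rule inj_onI)
    fix x y assume "x \<in> C" "y \<in> C" "A *v x = A *v y"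
    then have "x - y \<in> K \<inter> C"
      using C V by (auto simp: K_def vec.subspace_diff matrix_vector_mult_diff_distrib vec.subspace_0)
    with KC show "x = y" by simp
  qed
  have "vec.dim ((*v) A ` C) = vec.dim C"
    by (rule vec.dim_image_eq) (use inj C in \<open>simp_all add: vec.span_eq_iff[THEN iffD2]\<close>)
  moreover have AC: "vec.subspace ((*v) A ` C)"
    by (rule vec.linear_subspace_image[OF matrix_vector_mul_linear_gen C])
  moreover have "V \<inter> (*v) A ` C = {0}"
  proof -
    have "y = 0" if "y \<in> V" "y = A *v x" "x \<in> C" for x y
    proof -
      have "x \<in> K \<inter> C" using that by (simp add: K_def)
      then show ?thesis using KC that(2) by simp
    qed
    then have "V \<inter> (*v) A ` C \<subseteq> {0}" by blast
    then show ?thesis using vec.subspace_0[OF V(1)] vec.subspace_0[OF AC] by blast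
  qed
  moreover have "vec.dim {x + y |x y. x \<in> V \<and> y \<in> (*v) A ` C} \<le> vec.dim S"
    by (rule vec.dim_subset) (use V S in \<open>auto intro: vec.subspace_add\<close>)
  ultimately have "vec.dim V + vec.dim C \<le> vec.dim S"
    using vec.dim_sums_Int[OF V(1) AC] by simp
  with dK show ?thesis by (simp add: K_def)
qed

lemma mem_span_pair: "x \<in> vec.span {u, v} \<longleftrightarrow> (\<exists>a b. x = a *s u + b *s (v :: 'k::field^'n))"
proof -
  have "x \<in> vec.span {u, v} \<longleftrightarrow> (\<exists>a b. x - a *s u = b *s v)"
    by (auto simp: vec.span_breakdown_eq vec.span_singleton)
  then show ?thesis by (metis add.commute diff_add_cancel add_diff_cancel_left')
qed

section \<open>Decomposable bivectors\<close>

lemma wedge_nth: "wedge u v $ (i, j) = u $ i * v $ j - v $ i * u $ j"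
  by (simp add: wedge_def)

lemma vec_prod_eq_iff: "x = y \<longleftrightarrow> (\<forall>i j. x $ (i, j) = y $ (i, j))"
  by (auto simp: vec_eq_iff)

lemma wedge_simps:
  "wedge (u + u') v = wedge u v + wedge u' v" "wedge u (v + v') = wedge u v + wedge u v'"
  "wedge (u - u') v = wedge u v - wedge u' v" "wedge u (v - v') = wedge u v - wedge u v'"
  "wedge (c *s u) v = c *s wedge u v" "wedge u (c *s v) = c *s wedge u v"
  "wedge 0 v = 0" "wedge u 0 = 0" "wedge u u = 0"
  by (simp_all add: vec_prod_eq_iff wedge_nth algebra_simps)

lemma wedge_commute: "wedge v u = - wedge u v"
  by (simp add: vec_prod_eq_iff wedge_nth)

lemma linear_wedge: "Vector_Spaces.linear (*s) (*s) (wedge u)"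
  by (simp add: Vector_Spaces.linear_iff vec.vector_space_axioms wedge_simps)

lemma wedge_matrix: "matrix (wedge u) *v v = wedge u v"
  by (rule matrix_works[OF linear_wedge])

lemma biform_wedge:
  assumes "\<And>i. biform d e (\<lambda>x y. F x y $ i)" "\<And>i. biform d' e' (\<lambda>x y. H x y $ i)"
  shows "biform (d + d') (e + e') (\<lambda>x y. wedge (F x y) (H x y) $ p)"
proof -
  have "biform (d + d') (e + e') (\<lambda>x y. F x y $ fst p * H x y $ snd p - F x y $ snd p * H x y $ fst p)"
    by (intro biform_diff biform_mult assms)
  then show ?thesis by (simp add: wedge_def mult.commute)
qed

lemma form_wedge:
  "(\<And>i. form d (\<lambda>x. F x $ i)) \<Longrightarrow> (\<And>i. form e (\<lambda>x. H x $ i)) \<Longrightarrow>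
    form (d + e) (\<lambda>x. wedge (F x) (H x) $ p)"
  using biform_form_fst[OF biform_wedge[OF form_biform_fst form_biform_fst]] by blast

lemma wedge_sum_right: "wedge u (\<Sum>i\<in>I. f i) = (\<Sum>i\<in>I. wedge u (f i))"
  by (induction I rule: infinite_finite_induct) (simp_all add: wedge_simps)

lemma wedge_eq_0_iff: "wedge u v = 0 \<longleftrightarrow> u = 0 \<or> (\<exists>c. v = c *s u)"
proof
  assume 0: "wedge u v = 0"
  show "u = 0 \<or> (\<exists>c. v = c *s u)"
  proof (cases "u = 0")
    case False
    then obtain i where i: "u $ i \<noteq> 0" by (auto simp: vec_eq_iff)
    have "\<forall>j. v $ j = (v $ i / u $ i) * u $ j"
      using 0 i by (auto simp: vec_prod_eq_iff wedge_nth field_simps)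
    then have "v = (v $ i / u $ i) *s u" unfolding vec_eq_iff vector_smult_component .
    then show ?thesis by blast
  qed simp
qed (auto simp: wedge_simps)

lemma wedge_combination:
  "wedge (a *s u + b *s v) (c *s u + d *s v) = (a * d - b * c) *s wedge u v"
  by (simp add: vec_prod_eq_iff wedge_nth algebra_simps)

text \<open>The condition is the vanishing of the coordinates of the triple wedge product of
  \<open>w\<close>, \<open>u\<close> and \<open>v\<close>. It depends on \<open>u\<close> and
  \<open>v\<close> only through \<open>wedge u v\<close>, so a plane is recovered from its Pluecker
  vector.\<close>

lemma mem_span_pair_iff_wedge:
  fixes u v :: "'k::field^'n"
  assumes "wedge u v \<noteq> 0"
  shows "w \<in> vec.span {u, v} \<longleftrightarrow>
    (\<forall>i j k. w $ i * wedge u v $ (j, k) + w $ j * wedge u v $ (k, i) + w $ k * wedge u v $ (i, j) = 0)"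
proof
  assume "w \<in> vec.span {u, v}"
  then obtain a b where w: "w = a *s u + b *s v" by (auto simp: mem_span_pair)
  show "\<forall>i j k. w $ i * wedge u v $ (j, k) + w $ j * wedge u v $ (k, i) + w $ k * wedge u v $ (i, j) = 0"
    by (simp add: w wedge_nth algebra_simps)
next
  assume R: "\<forall>i j k. w $ i * wedge u v $ (j, k) + w $ j * wedge u v $ (k, i) + w $ k * wedge u v $ (i, j) = 0"
  obtain j k where jk: "wedge u v $ (j, k) \<noteq> 0" using assms by (auto simp: vec_prod_eq_iff)
  \<comment> \<open>Cramer's rule for the coordinates \<open>j\<close> and \<open>k\<close>, where
    the minor of \<open>u\<close> and \<open>v\<close> is nonzero.\<close>
  define a where "a = (w $ j * v $ k - w $ k * v $ j) / wedge u v $ (j, k)"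
  define b where "b = (w $ k * u $ j - w $ j * u $ k) / wedge u v $ (j, k)"
  have "w $ i = a * u $ i + b * v $ i" for i
  proof -
    have "w $ i * wedge u v $ (j, k) = - (w $ j * wedge u v $ (k, i) + w $ k * wedge u v $ (i, j))"
      using R[rule_format, of i j k] unfolding eq_neg_iff_add_eq_0 by (simp only: add.assoc)
    also have "\<dots> = (a * u $ i + b * v $ i) * wedge u v $ (j, k)"
      using jk by (simp add: a_def b_def field_simps) (simp add: wedge_nth algebra_simps)
    finally show ?thesis using jk by simp
  qed
  then have "w = a *s u + b *s v" by (simp add: vec_eq_iff)
  then show "w \<in> vec.span {u, v}" by (auto simp: mem_span_pair)
qed

lemma span_eq_of_wedge_eq:
  assumes "wedge u v \<noteq> 0" "c \<noteq> 0" "wedge u' v' = c *s wedge u v"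
  shows "vec.span {u', v'} = vec.span {u, v}"
proof (rule Set.set_eqI)
  fix w
  have "wedge u' v' \<noteq> 0" using assms by simp
  show "w \<in> vec.span {u', v'} \<longleftrightarrow> w \<in> vec.span {u, v}"
  proof -
    have "w $ i * (c * a) + w $ j * (c * b) + w $ k * (c * d) = c * (w $ i * a + w $ j * b + w $ k * d)"
      for i j k a b d by (simp add: algebra_simps)
    then show ?thesis
      unfolding mem_span_pair_iff_wedge[OF assms(1)] mem_span_pair_iff_wedge[OF \<open>wedge u' v' \<noteq> 0\<close>]
      using assms(2) unfolding assms(3) vector_smult_component by simp
  qed
qed

text \<open>Turns a line in a plane into a presentation of the plane as one through that
  line.\<close>

lemma wedge_rebase:
  fixes x y :: "'k::field^'n"
  assumes "e \<in> vec.span {x, y}" "e \<noteq> 0"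
  obtains z where "z \<in> vec.span {x, y}" "wedge x y = wedge e z"
proof -
  obtain p q where pq: "e = p *s x + q *s y" using assms(1) by (auto simp: mem_span_pair)
  show ?thesis
  proof (cases "p = 0")
    case False
    then have "wedge x y = wedge e (inverse p *s y)" by (simp add: pq wedge_simps vector_smult_assoc)
    then show ?thesis by (rule that[rotated]) (intro vec.span_scale vec.span_base, simp)
  next
    case True
    then have "q \<noteq> 0" using assms(2) pq by auto
    then have "wedge x y = wedge e (- inverse q *s x)"
      by (simp add: pq True vec_prod_eq_iff wedge_nth field_simps)
    then show ?thesis by (rule that[rotated]) (intro vec.span_scale vec.span_base, simp)
  qed
qed

lemma ext_square_wedge: "wedge u v \<in> ext_square UNIV"
  unfolding ext_square_def by (auto intro: vec.span_base)

lemma ext_square_plane: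
  "ext_square (vec.span {u, v}) = proj_point (wedge u v)"
proof
  have "wedge x y \<in> proj_point (wedge u v)" if "x \<in> vec.span {u, v}" "y \<in> vec.span {u, v}" for x y
    using that by (auto simp: mem_span_pair mem_proj_point) (metis wedge_combination)
  then show "ext_square (vec.span {u, v}) \<subseteq> proj_point (wedge u v)"
    unfolding ext_square_def by (intro vec.span_minimal) (auto simp: proj_point_def)
  show "proj_point (wedge u v) \<subseteq> ext_square (vec.span {u, v})"
    unfolding ext_square_def proj_point_def
    by (intro vec.span_mono) (auto intro: vec.span_base)
qed

text \<open>Replaces planes by nonzero decomposable vectors; from here on \<open>X\<close> is
  handled through its affine cone.\<close>

lemma pluecker_gr2_iff:
  "L \<in> pluecker_gr2 \<longleftrightarrow> (\<exists>u v. wedge u v \<noteq> 0 \<and> L = proj_point (wedge u v))"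
proof
  assume "L \<in> pluecker_gr2"
  then obtain E where E: "vec.subspace E" "vec.dim E = 2" "L = ext_square E"
    by (auto simp: pluecker_gr2_def gr2_def)
  obtain B where B: "B \<subseteq> E" "vec.independent B" "E \<subseteq> vec.span B" "card B = 2"
    using vec.basis_exists[of E] E(2) by metis
  then obtain u v where uv: "B = {u, v}" "u \<noteq> v" by (meson card_2_iff)
  have "E = vec.span {u, v}" using B E(1) uv by (metis vec.span_subspace)
  moreover have "wedge u v \<noteq> 0"
  proof
    assume "wedge u v = 0"
    then have "u = 0 \<or> v \<in> vec.span {u}" by (auto simp: wedge_eq_0_iff vec.span_singleton)
    moreover have "u \<noteq> 0" using B(2) uv(1) vec.dependent_zero[of B] by auto
    moreover have "vec.independent (insert v {u})" using B(2) uv(1) by (simp add: insert_commute)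
    ultimately show False using uv(2) vec.independent_insert[of v "{u}"] by auto
  qed
  ultimately show "\<exists>u v. wedge u v \<noteq> 0 \<and> L = proj_point (wedge u v)"
    using E(3) ext_square_plane by blast
next
  assume "\<exists>u v. wedge u v \<noteq> 0 \<and> L = proj_point (wedge u v)"
  then obtain u v where uv: "wedge u v \<noteq> 0" "L = proj_point (wedge u v)" by blast
  have "u \<noteq> 0" "v \<notin> vec.span {u}" using uv(1) by (auto simp: wedge_eq_0_iff vec.span_singleton)
  then have "vec.independent {v, u}" "v \<noteq> u" using vec.span_base[of u "{u}"]
    by (auto simp: vec.independent_insert)
  then have "vec.dim (vec.span {u, v}) = 2"
    by (subst insert_commute) (simp add: vec.dim_eq_card_independent)
  then show "L \<in> pluecker_gr2"
    unfolding pluecker_gr2_def gr2_def uv(2) ext_square_plane[symmetric] by auto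
qed

definition wedge_ker :: "('k::field^('n::finite \<times> 'n)) set \<Rightarrow> 'k^'n \<Rightarrow> ('k^'n) set" where
  "wedge_ker V w = {u. wedge w u \<in> V}"

lemma subspace_wedge_ker: "vec.subspace V \<Longrightarrow> vec.subspace (wedge_ker V w)"
  unfolding wedge_ker_def by (rule vec.linear_subspace_linear_preimage[OF linear_wedge])

lemma self_mem_wedge_ker: "vec.subspace V \<Longrightarrow> w \<in> wedge_ker V w"
  by (simp add: wedge_ker_def wedge_simps vec.subspace_0)

text \<open>The codimension appears as a summand to stay clear of truncated subtraction.\<close>

lemma dim_wedge_ker:
  fixes V :: "('k::field^('n::finite \<times> 'n)) set"
  assumes "vec.subspace V" "V \<subseteq> ext_square UNIV" "vec.dim V + r = vec.dim (ext_square (UNIV :: ('k^'n) set))"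
  shows "CARD('n) \<le> vec.dim (wedge_ker V w) + r"
proof -
  have "CARD('n) + vec.dim V \<le> vec.dim {u. matrix (wedge w) *v u \<in> V} + vec.dim (ext_square (UNIV :: ('k^'n) set))"
    using assms(1,2) by (intro dim_preimage) (auto simp: ext_square_def wedge_matrix intro: vec.span_base)
  then show ?thesis using assms(3) by (simp add: wedge_ker_def wedge_matrix)
qed

lemma tensor_square_mult:
  "tensor_square (A ** B) = tensor_square A ** tensor_square (B :: 'k::field^'n^'n)"
  unfolding tensor_square_def matrix_matrix_mult_def vec_eq_iff vec_lambda_beta sum_product
    sum.cartesian_product UNIV_Times_UNIV
  by (intro allI sum.cong) (auto simp: mult_ac)

lemma tensor_square_one: "tensor_square (mat 1) = mat 1"
  by (auto simp: tensor_square_def vec_eq_iff mat_def)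

section \<open>Polynomial sections of the kernel bundle\<close>

text \<open>\<open>M w u = \<Lambda> (w \<and> u) + l w * P u\<close>, with \<open>P\<close> a projection to the kernel at \<open>w0\<close> and \<open>\<Lambda>\<close>
  killing \<open>V\<close>, is the identity at \<open>w = w0\<close>. The factor \<open>l w\<close> only serves to make it homogeneous.
  Solving \<open>M w u = c\<close> by Cramer's rule extends \<open>c\<close> to a section, because the kernels
  have constant dimension where \<open>det (M w) \<noteq> 0\<close>.\<close>

lemma wedge_ker_sections:
  fixes V :: "('k::field^('n::finite \<times> 'n)) set"
  assumes V: "vec.subspace V" and w0: "w0 \<noteq> 0"
    and min: "\<And>w. vec.dim (wedge_ker V w0) \<le> vec.dim (wedge_ker V w)"
  obtains d D e and t :: "'k^'n \<Rightarrow> 'k^'n \<Rightarrow> 'k^'n" where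
    "form d D" "D w0 \<noteq> 0" "\<And>w. D w \<noteq> 0 \<Longrightarrow> vec.dim (wedge_ker V w) = vec.dim (wedge_ker V w0)"
    "\<And>c i. form e (\<lambda>w. t c w $ i)" "\<And>c. c \<in> wedge_ker V w0 \<Longrightarrow> t c w0 = c"
    "\<And>c w. c \<in> wedge_ker V w0 \<Longrightarrow> t c w \<in> wedge_ker V w"
    "\<And>c w i. \<forall>j. polyfun (\<lambda>s. c s $ j) \<Longrightarrow> \<forall>j. polyfun (\<lambda>s. w s $ j) \<Longrightarrow>
       polyfun (\<lambda>s. t (c s) (w s) $ i)"
proof -
  let ?K = "wedge_ker V w0"
  have K: "vec.subspace ?K" using V by (rule subspace_wedge_ker)
  obtain Q where Q: "\<And>x. x \<in> ?K \<Longrightarrow> Q *v x = 0" "\<And>x. x - Q *v x \<in> ?K" "\<And>x. Q *v (Q *v x) = Q *v x"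
    using projection_along[OF K] by blast
  obtain q where q: "\<And>x. x \<in> V \<Longrightarrow> q *v x = 0" "\<And>x. x - q *v x \<in> V" "\<And>x. q *v (q *v x) = q *v x"
    using projection_along[OF V] by blast
  have qV: "q *v x = 0 \<longleftrightarrow> x \<in> V" for x
    using q(1)[of x] q(2)[of x] by (cases "q *v x = 0") auto
  define C where "C = range ((*v) Q)"
  have C: "vec.subspace C"
    unfolding C_def by (intro vec.linear_subspace_image[OF matrix_vector_mul_linear_gen]) simp
  have QC: "Q *v x = x" if "x \<in> C" for x using that Q(3) by (auto simp: C_def)
  let ?A = "q ** matrix (wedge w0)"
  have A: "?A *v u = q *v wedge w0 u" for u
    by (simp add: wedge_matrix flip: matrix_vector_mul_assoc)
  have "inj_on ((*v) ?A) C"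
  proof (rule inj_onI)
    fix x y assume xy: "x \<in> C" "y \<in> C" "?A *v x = ?A *v y"
    then have "q *v wedge w0 (x - y) = 0" by (simp add: A wedge_simps matrix_vector_mult_diff_distrib)
    then have "x - y \<in> ?K" by (simp add: qV wedge_ker_def)
    then have "Q *v (x - y) = 0" by (rule Q(1))
    then show "x = y" using xy QC by (simp add: matrix_vector_mult_diff_distrib)
  qed
  \<comment> \<open>A left inverse of \<open>wedge w0\<close> modulo \<open>V\<close>, on the
    complement \<open>C\<close> of the kernel at \<open>w0\<close>; it makes
    \<open>L *v wedge w0 u = Q *v u\<close>.\<close>
  from vec.linear_exists_left_inverse_on[OF matrix_vector_mul_linear_gen C this]
  obtain g where g: "range g \<subseteq> C" "Vector_Spaces.linear (*s) (*s) g" "\<forall>v\<in>C. g (?A *v v) = v" by blast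
  define L where "L = matrix g ** q"
  have L: "L *v x = g (q *v x)" for x
    using g(2) by (simp add: L_def matrix_works flip: matrix_vector_mul_assoc)
  have LV: "L *v x = 0" if "x \<in> V" for x
    using q(1)[OF that] by (simp add: L_def flip: matrix_vector_mul_assoc)
  have LC: "Q *v (L *v x) = L *v x" for x using g(1) by (intro QC) (auto simp: L)
  have Lw0: "L *v wedge w0 u = Q *v u" for u
  proof -
    have "wedge w0 (u - Q *v u) \<in> V" using Q(2)[of u] by (simp add: wedge_ker_def)
    then have "L *v wedge w0 u = L *v wedge w0 (Q *v u)"
      using LV[of "wedge w0 (u - Q *v u)"] by (simp add: wedge_simps matrix_vector_mult_diff_distrib)
    also have "\<dots> = Q *v u" using g(3) by (simp add: L A C_def)
    finally show ?thesis .
  qed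
  obtain i0 where i0: "w0 $ i0 \<noteq> 0" using w0 by (auto simp: vec_eq_iff)
  define l where "l w = inverse (w0 $ i0) * w $ i0" for w :: "'k^'n"
  have l: "form 1 l" unfolding l_def by (intro form_cmult form_nth)
  define P where "P = mat 1 - Q"
  have P: "P *v u = u - Q *v u" for u
    by (simp add: P_def matrix_vector_mult_diff_rdistrib)
  define M :: "'k^'n \<Rightarrow> 'k^'n^'n" where
    "M w = (\<chi> i j. (L *v wedge w (axis j 1)) $ i + P $ i $ j * l w)" for w
  have M: "M w *v u = L *v wedge w u + l w *s (P *v u)" for w u
  proof -
    have "M w = L ** matrix (wedge w) + (\<chi> i j. P $ i $ j * l w)"
      unfolding M_def vec_eq_iff
      by (simp add: matrix_def matrix_matrix_mult_def matrix_vector_mult_def)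
    moreover have "(\<chi> i j. P $ i $ j * l w) *v u = l w *s (P *v u)"
      by (simp add: vec_eq_iff matrix_vector_mult_def sum_distrib_left mult_ac)
    ultimately show ?thesis
      by (simp add: matrix_vector_mult_add_rdistrib wedge_matrix flip: matrix_vector_mul_assoc)
  qed
  define D where "D w = det (M w)" for w
  have M0: "M w0 = mat 1"
    unfolding matrix_eq by (simp add: M Lw0 P l_def i0)
  have Mform: "form 1 (\<lambda>w. M w $ i $ j)" for i j
  proof -
    have "form (1 + 0) (\<lambda>w. wedge w (axis j 1 :: 'k^'n) $ p)" for p
      by (intro form_wedge form_nth form_const)
    then have "form 1 (\<lambda>w. (L *v wedge w (axis j 1)) $ i)"
      unfolding matrix_vector_mult_def vec_lambda_beta by (intro form_sum form_cmult) simp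
    then show ?thesis unfolding M_def vec_lambda_beta by (intro form_add form_cmult l)
  qed
  have D: "form CARD('n) D"
    unfolding D_def using form_det[of "\<lambda>_. 1" M, OF Mform] by simp
  \<comment> \<open>On the kernel of \<open>L\<close> after \<open>wedge w\<close>,
    \<open>M w\<close> reduces to \<open>l w\<close> times \<open>P\<close>. So invertibility of
    \<open>M w\<close> makes \<open>P\<close> inject that kernel into the one at \<open>w0\<close>;
    as it contains \<open>wedge_ker V w\<close>, minimality at \<open>w0\<close> forces
    equality.\<close>
  have ker: "{u. L *v wedge w u = 0} = wedge_ker V w"
    and ker_dim: "vec.dim (wedge_ker V w) = vec.dim ?K" if Dw: "D w \<noteq> 0" for w
  proof -
    let ?N = "{u. L *v wedge w u = 0}"
    have N: "vec.subspace ?N"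
      using vec.linear_subspace_linear_preimage[OF matrix_vector_mul_linear_gen vec.subspace_single_0,
          of "L ** matrix (wedge w)"]
      by (simp add: wedge_matrix flip: matrix_vector_mul_assoc)
    have "inj_on ((*v) P) ?N"
    proof (rule inj_onI)
      fix x y assume "x \<in> ?N" "y \<in> ?N" "P *v x = P *v y"
      then have "M w *v x = M w *v y" by (simp add: M)
      moreover have "invertible (M w)" using Dw by (simp add: invertible_det_nz D_def)
      ultimately show "x = y" by (metis invertible_def matrix_vector_mul_assoc matrix_vector_mul_lid)
    qed
    then have "vec.dim ((*v) P ` ?N) = vec.dim ?N"
      by (intro vec.dim_image_eq) (use N in \<open>simp_all add: vec.span_eq_iff[THEN iffD2]\<close>)
    moreover have "(*v) P ` ?N \<subseteq> ?K" using Q(2) by (auto simp: P)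
    ultimately have dN: "vec.dim ?N \<le> vec.dim ?K" using vec.dim_subset by metis
    have sub: "wedge_ker V w \<subseteq> ?N" using LV by (auto simp: wedge_ker_def)
    then show eq: "?N = wedge_ker V w"
      using dN min[of w] N subspace_wedge_ker[OF V, of w] vec.subspace_dim_equal[of "wedge_ker V w" ?N]
      by simp
    show "vec.dim (wedge_ker V w) = vec.dim ?K"
      using eq dN min[of w] by simp
  qed
  \<comment> \<open>The Cramer numerators carry one more factor \<open>D w\<close>: then
    \<open>t\<close> vanishes where \<open>D\<close> does, and lies in the kernel for all
    \<open>w\<close>. The value at \<open>w0\<close> is unaffected since \<open>M w0\<close> is the
    identity.\<close>
  define t where "t c w = D w *s (\<chi> k. det (\<chi> i j. if j = k then c $ i else M w $ i $ j))" for c w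
  have Mt: "M w *v t c w = (D w * D w) *s c" for c w
  proof (cases "D w = 0")
    case False
    then have "M w *v (\<chi> k. det (\<chi> i j. if j = k then c $ i else M w $ i $ j) / det (M w)) = c"
      by (subst cramer) (auto simp: D_def)
    moreover have "t c w = (D w * D w) *s (\<chi> k. det (\<chi> i j. if j = k then c $ i else M w $ i $ j) / det (M w))"
      using False by (simp add: t_def vec_eq_iff D_def)
    ultimately show ?thesis by (simp add: vector_scalar_commute)
  qed (simp add: t_def)
  show ?thesis
  proof (rule that)
    show "form CARD('n) D" by (rule D)
    show "D w0 \<noteq> 0" by (simp add: D_def M0)
    show "vec.dim (wedge_ker V w) = vec.dim ?K" if "D w \<noteq> 0" for w
      by (rule ker_dim[OF that])
    show "form (CARD('n) + (\<Sum>j\<in>(UNIV :: 'n set). if j = i0 then 0 else 1)) (\<lambda>w. t c w $ k)" for c k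
    proof -
      have "form (\<Sum>j\<in>UNIV. if j = k then 0 else 1) (\<lambda>w. det (\<chi> i j. if j = k then c $ i else M w $ i $ j))"
        by (intro form_det) (auto intro: form_const Mform[unfolded One_nat_def])
      moreover have "(\<Sum>j\<in>(UNIV :: 'n set). if j = k then 0 else 1 :: nat) = (\<Sum>j\<in>UNIV. if j = i0 then 0 else 1)"
        by (simp add: sum.If_cases Compl_eq_Diff_UNIV card_Diff_singleton)
      ultimately show ?thesis unfolding t_def vector_smult_component vec_lambda_beta
        by (intro form_mult D) simp
    qed
    show "t c w0 = c" for c using Mt[of w0 c] by (simp add: M0 D_def)
    show "t c w \<in> wedge_ker V w" if c: "c \<in> ?K" for c w
    proof (cases "D w = 0")
      case True
      then show ?thesis using subspace_wedge_ker[OF V] by (simp add: t_def vec.subspace_0)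
    next
      case False
      \<comment> \<open>\<open>L\<close> has values in \<open>C\<close>, where \<open>Q\<close> is
        the identity, and \<open>Q\<close> kills the range of \<open>P\<close>; so \<open>Q\<close>
        extracts the \<open>L\<close> part of \<open>M w\<close>.\<close>
      have "Q *v (P *v x) = 0" for x by (simp add: P Q(3) matrix_vector_mult_diff_distrib)
      then have "L *v wedge w (t c w) = Q *v (M w *v t c w)"
        by (simp add: M LC matrix_vector_right_distrib vector_scalar_commute)
      also have "\<dots> = 0" using Q(1)[OF c] by (simp add: Mt vector_scalar_commute)
      finally show ?thesis using ker[OF False] by blast
    qed
    \<comment> \<open>Joint polynomial dependence on \<open>c\<close> and \<open>w\<close>: two
      members of a family of planes can be joined by moving both along lines.\<close>
    show "polyfun (\<lambda>s. t (c s) (w s) $ i)"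
      if "\<forall>j. polyfun (\<lambda>s. c s $ j)" "\<forall>j. polyfun (\<lambda>s. w s $ j)" for c w i
    proof -
      have that: "polyfun (\<lambda>s. c s $ j)" "polyfun (\<lambda>s. w s $ j)" for j using that by blast+
      have M': "polyfun (\<lambda>s. M (w s) $ i $ j)" for i j by (rule form_polyfun[OF Mform that(2)])
      have Mk: "polyfun (\<lambda>s. (\<chi> i j. if j = k then c s $ i else M (w s) $ i $ j) $ i $ j)" for i j k
        using M' that(1) by (cases "j = k") simp_all
      show ?thesis unfolding t_def vector_smult_component
        by (subst vec_lambda_beta) (intro polyfun_mult form_polyfun[OF D] that polyfun_det Mk)
    qed
  qed
qed

section \<open>Representations and averaging\<close>

lemma representation_mult:
  "representation G \<rho> \<Longrightarrow> g \<in> carrier G \<Longrightarrow> h \<in> carrier G \<Longrightarrow> \<rho> (g \<otimes>\<^bsub>G\<^esub> h) = \<rho> g ** \<rho> h"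
  unfolding representation_def general_linear_def by (auto dest: hom_mult)

lemma representation_invertible:
  "representation G \<rho> \<Longrightarrow> g \<in> carrier G \<Longrightarrow> invertible (\<rho> g)"
  unfolding representation_def general_linear_def by (auto dest: hom_in_carrier)

lemma representation_one:
  assumes "group G" "representation G \<rho>"
  shows "\<rho> \<one>\<^bsub>G\<^esub> = mat 1"
proof -
  interpret group G by fact
  have "\<rho> \<one>\<^bsub>G\<^esub> ** \<rho> \<one>\<^bsub>G\<^esub> = \<rho> \<one>\<^bsub>G\<^esub>"
    using representation_mult[OF assms(2), of "\<one>\<^bsub>G\<^esub>" "\<one>\<^bsub>G\<^esub>"] by simp
  moreover obtain A where "A ** \<rho> \<one>\<^bsub>G\<^esub> = mat 1"
    using representation_invertible[OF assms(2), of "\<one>\<^bsub>G\<^esub>"] by (auto simp: invertible_def)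
  ultimately show ?thesis by (metis matrix_mul_assoc matrix_mul_lid)
qed

lemma representation_inv:
  assumes "group G" "representation G \<rho>" "g \<in> carrier G"
  shows "\<rho> g *v (\<rho> (inv\<^bsub>G\<^esub> g) *v x) = x" "\<rho> (inv\<^bsub>G\<^esub> g) *v (\<rho> g *v x) = x"
proof -
  interpret group G by fact
  have "\<rho> g ** \<rho> (inv\<^bsub>G\<^esub> g) = mat 1" "\<rho> (inv\<^bsub>G\<^esub> g) ** \<rho> g = mat 1"
    using representation_mult[OF assms(2), symmetric] representation_one[OF assms(1,2)] assms(3) by simp_all
  then show "\<rho> g *v (\<rho> (inv\<^bsub>G\<^esub> g) *v x) = x" "\<rho> (inv\<^bsub>G\<^esub> g) *v (\<rho> g *v x) = x"
    by (simp_all add: matrix_vector_mul_assoc)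
qed

lemma representation_eq_0_iff:
  assumes "group G" "representation G \<rho>" "g \<in> carrier G"
  shows "\<rho> g *v x = 0 \<longleftrightarrow> x = 0"
  using representation_inv(2)[OF assms, of x] by auto

lemma representation_tensor_square:
  assumes "representation G \<rho>"
  shows "representation G (tensor_square \<circ> \<rho>)"
proof -
  have "invertible (tensor_square (\<rho> g))" if g: "g \<in> carrier G" for g
  proof -
    obtain A where "\<rho> g ** A = mat 1" "A ** \<rho> g = mat 1"
      using representation_invertible[OF assms g] by (auto simp: invertible_def)
    then show ?thesis
      unfolding invertible_def by (metis tensor_square_mult tensor_square_one)
  qed
  moreover have "tensor_square (\<rho> (g \<otimes>\<^bsub>G\<^esub> h)) = tensor_square (\<rho> g) ** tensor_square (\<rho> h)"
    if "g \<in> carrier G" "h \<in> carrier G" for g h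
    using representation_mult[OF assms that] by (simp add: tensor_square_mult)
  ultimately show ?thesis
    unfolding representation_def general_linear_def hom_def by auto
qed

text \<open>The Reynolds operator without division by the group order, applied to the product of
  \<open>h\<close> and \<open>t\<close>.\<close>

definition average ::
  "('g, 'x) monoid_scheme \<Rightarrow> ('g \<Rightarrow> 'k::field^'a^'a) \<Rightarrow> ('g \<Rightarrow> 'k^'b^'b) \<Rightarrow>
    ('k^'a \<Rightarrow> 'k) \<Rightarrow> ('k^'a \<Rightarrow> 'k^'b) \<Rightarrow> 'k^'a \<Rightarrow> 'k^'b" where
  "average G A B h t x =
    (\<Sum>g\<in>carrier G. h (A (inv\<^bsub>G\<^esub> g) *v x) *s (B g *v t (A (inv\<^bsub>G\<^esub> g) *v x)))"

lemma average_equivariant: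
  assumes "group G" "representation G A" "representation G B" "g \<in> carrier G"
  shows "average G A B h t (A g *v x) = B g *v average G A B h t x"
proof -
  interpret group G by fact
  have bij: "bij_betw (\<lambda>k. g \<otimes>\<^bsub>G\<^esub> k) (carrier G) (carrier G)"
    using assms(4) by (intro bij_betwI[where g = "\<lambda>k. inv\<^bsub>G\<^esub> g \<otimes>\<^bsub>G\<^esub> k"]) (auto simp flip: m_assoc)
  have "average G A B h t (A g *v x) = (\<Sum>k\<in>carrier G. h (A (inv\<^bsub>G\<^esub> (g \<otimes>\<^bsub>G\<^esub> k)) *v (A g *v x)) *s
      (B (g \<otimes>\<^bsub>G\<^esub> k) *v t (A (inv\<^bsub>G\<^esub> (g \<otimes>\<^bsub>G\<^esub> k)) *v (A g *v x))))"
    unfolding average_def by (rule sum.reindex_bij_betw[OF bij, symmetric])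
  also have "\<dots> = (\<Sum>k\<in>carrier G. B g *v (h (A (inv\<^bsub>G\<^esub> k) *v x) *s (B k *v t (A (inv\<^bsub>G\<^esub> k) *v x))))"
  proof (rule sum.cong)
    fix k assume k: "k \<in> carrier G"
    have "A (inv\<^bsub>G\<^esub> (g \<otimes>\<^bsub>G\<^esub> k)) *v (A g *v x) = A (inv\<^bsub>G\<^esub> k) *v x"
      using k assms by (simp add: inv_mult_group representation_mult[OF assms(2)] representation_inv
          flip: matrix_vector_mul_assoc)
    then show "h (A (inv\<^bsub>G\<^esub> (g \<otimes>\<^bsub>G\<^esub> k)) *v (A g *v x)) *s
        (B (g \<otimes>\<^bsub>G\<^esub> k) *v t (A (inv\<^bsub>G\<^esub> (g \<otimes>\<^bsub>G\<^esub> k)) *v (A g *v x))) =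
      B g *v (h (A (inv\<^bsub>G\<^esub> k) *v x) *s (B k *v t (A (inv\<^bsub>G\<^esub> k) *v x)))"
      using k assms by (simp add: representation_mult[OF assms(3)] vector_scalar_commute
          flip: matrix_vector_mul_assoc)
  qed simp
  also have "\<dots> = B g *v average G A B h t x"
    unfolding average_def
    by (induction "carrier G" rule: infinite_finite_induct)
      (simp_all add: vec.linear_sum[OF matrix_vector_mul_linear_gen])
  finally show ?thesis .
qed

lemma average_form:
  assumes "form d h" "\<And>i. form e (\<lambda>x. t x $ i)"
  shows "form (d + e) (\<lambda>x. average G A B h t x $ i)"
proof -
  have lin: "form 1 (\<lambda>x. (A g *v x) $ j)" for g j by (rule form_matrix)
  have "form (d * 1) (\<lambda>x. h (A g *v x))" for g by (rule form_compose[OF assms(1) lin])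
  moreover have "form (e * 1) (\<lambda>x. (B g *v t (A g' *v x)) $ i)" for g g'
    unfolding matrix_vector_mult_def[of "B g"] vec_lambda_beta
    by (intro form_sum form_cmult form_compose[OF assms(2) lin])
  ultimately show ?thesis
    unfolding average_def sum_component vector_smult_component
    by (intro form_sum form_mult) simp_all
qed

text \<open>Only the identity term survives, so averaging multiplies the value of \<open>t\<close>
  at \<open>x\<close> by \<open>h x\<close>. Sections that are independent at \<open>x\<close>
  remain so if \<open>h x\<close> is nonzero.\<close>

lemma average_at:
  assumes "group G" "finite (carrier G)" "representation G A" "representation G B"
    and "\<And>g. g \<in> carrier G \<Longrightarrow> g \<noteq> \<one>\<^bsub>G\<^esub> \<Longrightarrow> h (A g *v x) = 0"
  shows "average G A B h t x = h x *s t x"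
proof -
  interpret group G by fact
  have "average G A B h t x = (\<Sum>g\<in>carrier G. if g = \<one>\<^bsub>G\<^esub> then h x *s t x else 0)"
    unfolding average_def
  proof (rule sum.cong)
    fix g assume "g \<in> carrier G"
    then show "h (A (inv\<^bsub>G\<^esub> g) *v x) *s (B g *v t (A (inv\<^bsub>G\<^esub> g) *v x)) =
        (if g = \<one>\<^bsub>G\<^esub> then h x *s t x else 0)"
      using assms(5)[of "inv\<^bsub>G\<^esub> g"] representation_one[OF assms(1,3)] representation_one[OF assms(1,4)]
      by auto
  qed simp
  also have "\<dots> = h x *s t x" using assms(2) by (simp add: sum.delta)
  finally show ?thesis .
qed

lemma average_mem:
  assumes "\<And>y. vec.subspace (E y)"
    and "\<And>g. g \<in> carrier G \<Longrightarrow> B g *v t (A (inv\<^bsub>G\<^esub> g) *v x) \<in> E x"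
  shows "average G A B h t x \<in> E x"
  unfolding average_def using assms by (intro vec.subspace_sum vec.subspace_scale) auto

lemma linear_form_separating:
  fixes x y :: "'k::field^'a"
  assumes "x \<noteq> 0" "proj_point y \<noteq> proj_point x"
  obtains l where "form 1 l" "l x \<noteq> 0" "l y = 0"
proof (cases "y = 0")
  case True
  obtain i where "x $ i \<noteq> 0" using assms(1) by (auto simp: vec_eq_iff)
  then show ?thesis using that[OF form_nth, of i] True by simp
next
  case False
  then obtain i j where ij: "y $ i * x $ j - y $ j * x $ i \<noteq> 0"
    using proj_point_eq_iff_minors[of y x] assms by blast
  have "form 1 (\<lambda>x. y $ i * x $ j - y $ j * x $ i)" by (intro form_diff form_cmult form_nth)
  from this ij show ?thesis by (rule that) simp
qed

text \<open>A product of linear forms, one for each nontrivial group element.\<close>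

lemma form_separating_orbit:
  fixes A :: "'g \<Rightarrow> 'k::field^'a^'a"
  assumes "finite (carrier G)" "x \<noteq> 0"
    and "\<And>g. g \<in> carrier G \<Longrightarrow> proj_act A g (proj_point x) = proj_point x \<Longrightarrow> g = \<one>\<^bsub>G\<^esub>"
  obtains d h where "form d h" "h x \<noteq> 0" "\<And>g. g \<in> carrier G \<Longrightarrow> g \<noteq> \<one>\<^bsub>G\<^esub> \<Longrightarrow> h (A g *v x) = 0"
proof -
  have "\<forall>g\<in>carrier G - {\<one>\<^bsub>G\<^esub>}. \<exists>l. form 1 l \<and> l x \<noteq> 0 \<and> l (A g *v x) = 0"
  proof
    fix g assume "g \<in> carrier G - {\<one>\<^bsub>G\<^esub>}"
    then have "proj_point (A g *v x) \<noteq> proj_point x" using assms(3)[of g] by (auto simp: proj_act_point)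
    from linear_form_separating[OF assms(2) this]
    show "\<exists>l. form 1 l \<and> l x \<noteq> 0 \<and> l (A g *v x) = 0" by metis
  qed
  then obtain l where l: "\<And>g. g \<in> carrier G - {\<one>\<^bsub>G\<^esub>} \<Longrightarrow> form 1 (l g) \<and> l g x \<noteq> 0 \<and> l g (A g *v x) = 0"
    by metis
  define h where "h y = (\<Prod>g\<in>carrier G - {\<one>\<^bsub>G\<^esub>}. l g y)" for y
  show ?thesis
  proof (rule that)
    show "form (\<Sum>g\<in>carrier G - {\<one>\<^bsub>G\<^esub>}. 1) h"
      unfolding h_def using l by (intro form_prod) blast
    show "h x \<noteq> 0" unfolding h_def using l assms(1) by auto
    show "h (A g *v x) = 0" if "g \<in> carrier G" "g \<noteq> \<one>\<^bsub>G\<^esub>" for g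
      unfolding h_def using l that assms(1) by (intro prod_zero) auto
  qed
qed

section \<open>A lower bound for the dimension of a linear section of the Grassmannian\<close>

definition pairing :: "'k::field^'n \<Rightarrow> 'k^'n \<Rightarrow> 'k" where
  "pairing a x = (\<Sum>i\<in>UNIV. a $ i * x $ i)"

lemma pairing_simps:
  "pairing a (x + y) = pairing a x + pairing a y" "pairing a (c *s x) = c * pairing a x"
  "pairing a 0 = 0"
  by (simp_all add: pairing_def algebra_simps sum.distrib sum_distrib_left)

lemma pairing_span:
  "x \<in> vec.span S \<Longrightarrow> (\<And>y. y \<in> S \<Longrightarrow> pairing a y = 0) \<Longrightarrow> pairing a x = 0"
  by (induction rule: vec.span_induct_alt) (simp_all add: pairing_simps)

lemma polyfun_pairing: "(\<And>i. polyfun (\<lambda>s. x s $ i)) \<Longrightarrow> polyfun (\<lambda>s. pairing a (x s))"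
  unfolding pairing_def by (intro polyfun_sum polyfun_mult polyfun_const)

text \<open>Evaluation of the tensor product of the functionals \<open>a\<close> and
  \<open>b\<close>; on decomposable bivectors it is a 2 by 2 minor.\<close>

definition pairing2 :: "'k::field^'n \<Rightarrow> 'k^'n \<Rightarrow> 'k^('n \<times> 'n) \<Rightarrow> 'k" where
  "pairing2 a b x = (\<Sum>p\<in>UNIV. a $ fst p * b $ snd p * x $ p)"

lemma form_pairing2: "form 1 (pairing2 a b)"
  unfolding pairing2_def[abs_def] by (intro form_sum form_cmult form_nth)

lemma pairing2_linear:
  "pairing2 a b (x + y) = pairing2 a b x + pairing2 a b y"
  "pairing2 a b (c *s x) = c * pairing2 a b x"
  "pairing2 a b (\<Sum>i\<in>I. h i) = (\<Sum>i\<in>I. pairing2 a b (h i))"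
proof -
  show add: "pairing2 a b (x + y) = pairing2 a b x + pairing2 a b y" for x y
    by (simp add: pairing2_def algebra_simps sum.distrib)
  show "pairing2 a b (c *s x) = c * pairing2 a b x"
    by (simp add: pairing2_def sum_distrib_left mult_ac)
  show "pairing2 a b (\<Sum>i\<in>I. h i) = (\<Sum>i\<in>I. pairing2 a b (h i))"
    by (induction I rule: infinite_finite_induct) (simp_all add: add, simp_all add: pairing2_def)
qed

lemma pairing2_wedge:
  "pairing2 a b (wedge u v) = pairing a u * pairing b v - pairing a v * pairing b u"
proof -
  have "pairing a u * pairing b v = (\<Sum>p\<in>UNIV. a $ fst p * b $ snd p * (u $ fst p * v $ snd p))" for u v
    unfolding pairing_def sum_product sum.cartesian_product UNIV_Times_UNIV
    by (intro sum.cong) (auto simp: mult_ac)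
  from this[of u v] this[of v u] show ?thesis
    by (simp add: pairing2_def wedge_def right_diff_distrib sum_subtractf)
qed

text \<open>A row of a matrix that sends \<open>b\<close> to a unit vector and the other members of
  \<open>B\<close> to 0.\<close>

lemma dual_vector:
  fixes B :: "('k::field^'n) set"
  assumes "vec.independent B"
  obtains a where "\<And>c. c \<in> B \<Longrightarrow> pairing a c = (if c = b then 1 else 0)"
proof -
  obtain i :: 'n where True by simp
  obtain A where A: "\<And>c. c \<in> B \<Longrightarrow> A *v c = (if c = b then axis i 1 else (0 :: 'k^'n))"
    using matrix_extend[OF assms, of "\<lambda>c. if c = b then axis i 1 else 0"] by blast
  have "pairing (A $ i) c = (A *v c) $ i" for c
    by (simp add: pairing_def matrix_vector_mult_def)
  then show ?thesis by (intro that[of "A $ i"]) (simp add: A)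
qed

text \<open>A basis adapted to the flag of \<open>w\<close>, \<open>K\<close> and the whole space,
  with dual functionals. They separate the steps of the chain below and later evaluate the matrix of
  the averaged frame.\<close>

lemma enumerated_basis:
  fixes K :: "('k::field^'n) set"
  assumes K: "vec.subspace K" and w: "w \<in> K" "w \<noteq> 0"
  obtains b a where "b 0 = w" "\<And>i. i < vec.dim K \<Longrightarrow> b i \<in> K"
    "\<And>i j. i < CARD('n) \<Longrightarrow> j < CARD('n) \<Longrightarrow> pairing (a i) (b j) = (if i = j then 1 else 0)"
proof -
  have ind: "vec.independent {w}" using w by (simp add: vec.independent_insert)
  have "{w} \<subseteq> K" using w by simp
  from this ind obtain B where B: "{w} \<subseteq> B" "B \<subseteq> K" "vec.independent B" "K \<subseteq> vec.span B"
    by (rule vec.maximal_independent_subset_extend)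
  obtain C where C: "B \<subseteq> C" "C \<subseteq> UNIV" "vec.independent C" "UNIV \<subseteq> vec.span C"
    by (rule vec.maximal_independent_subset_extend[OF subset_UNIV B(3)])
  have cB: "card B = vec.dim K" using B by (intro vec.basis_card_eq_dim)
  have "card C = vec.dim (UNIV :: ('k^'n) set)" using C by (intro vec.basis_card_eq_dim)
  then have cC: "card C = CARD('n)" unfolding vec_dim_card .
  have fin: "finite B" "finite C" using B(3) C(3) by (auto intro: vec.finiteI_independent)
  obtain ys where ys: "set ys = B - {w}" "distinct ys" using fin finite_distinct_list by (metis finite_Diff)
  obtain zs where zs: "set zs = C - B" "distinct zs" using fin finite_distinct_list by (metis finite_Diff)
  define xs where "xs = (w # ys) @ zs"
  have xs: "distinct xs" "set xs = C" using ys zs B(1) C(1) by (auto simp: xs_def)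
  have len: "length xs = CARD('n)" using distinct_card[OF xs(1)] xs(2) cC by simp
  have "length (w # ys) = card (set (w # ys))" using ys by (intro distinct_card[symmetric]) auto
  also have "set (w # ys) = B" using ys B(1) by auto
  finally have lenB: "length (w # ys) = vec.dim K" using cB by simp
  have "\<forall>b. \<exists>a. \<forall>c\<in>C. pairing a c = (if c = b then 1 else 0)"
    using dual_vector[OF C(3)] by metis
  then obtain a where a: "\<And>b c. c \<in> C \<Longrightarrow> pairing (a b) c = (if c = b then 1 else 0)" by metis
  show ?thesis
  proof (rule that[of "\<lambda>i. xs ! i" "\<lambda>i. a (xs ! i)"])
    show "xs ! 0 = w" by (simp add: xs_def)
    show "xs ! i \<in> K" if "i < vec.dim K" for i
    proof -
      have "xs ! i = (w # ys) ! i" unfolding xs_def nth_append using that lenB by simp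
      moreover have "(w # ys) ! i \<in> set (w # ys)" using that lenB by (intro nth_mem) simp
      ultimately show ?thesis using \<open>set (w # ys) = B\<close> B(2) by auto
    qed
    show "pairing (a (xs ! i)) (xs ! j) = (if i = j then 1 else 0)" if "i < CARD('n)" "j < CARD('n)" for i j
      using that xs len nth_eq_iff_index_eq[of xs j i] nth_mem[of j xs] by (subst a) auto
  qed
qed

text \<open>With the line of \<open>w0\<close> fixed, the plane moves in \<open>k - 2\<close> steps;
  then the line moves in \<open>n - 2\<close> further steps, the sections \<open>t\<close> carrying
  the plane along. One of the \<open>n - 1\<close> directions of the line is left out because moving
  the line inside a plane gives nothing new.\<close>

lemma krull_dim_grassmannian_section_ge:
  fixes V :: "('k::field_char_0^('n::finite \<times> 'n)) set"
  assumes V: "vec.subspace V" and w0: "w0 \<noteq> 0"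
    and min: "\<And>w. vec.dim (wedge_ker V w0) \<le> vec.dim (wedge_ker V w)"
    and two: "2 \<le> vec.dim (wedge_ker V w0)"
  shows "enat (CARD('n) + vec.dim (wedge_ker V w0) - 4) \<le>
    krull_dim (subtopology zariski (pluecker_gr2 \<inter> proj_space V))"
proof -
  define k where "k = vec.dim (wedge_ker V w0)"
  define n where "n = CARD('n)"
  have kn: "2 \<le> k" "k \<le> n"
    using two vec.dim_subset[of "wedge_ker V w0" UNIV] by (simp_all add: k_def n_def vec_dim_card del: vec.dim_UNIV)
  obtain d D e and t :: "'k^'n \<Rightarrow> 'k^'n \<Rightarrow> 'k^'n" where "form d D" "D w0 \<noteq> 0" "\<And>w. D w \<noteq> 0 \<Longrightarrow> vec.dim (wedge_ker V w) = vec.dim (wedge_ker V w0)"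
    and t: "\<And>c i. form e (\<lambda>w. t c w $ i)" "\<And>c. c \<in> wedge_ker V w0 \<Longrightarrow> t c w0 = c"
    "\<And>c w. c \<in> wedge_ker V w0 \<Longrightarrow> t c w \<in> wedge_ker V w"
    "\<And>c w i. \<forall>j. polyfun (\<lambda>s. c s $ j) \<Longrightarrow> \<forall>j. polyfun (\<lambda>s. w s $ j) \<Longrightarrow>
       polyfun (\<lambda>s. t (c s) (w s) $ i)"
    using wedge_ker_sections[OF V w0 min] by blast
  obtain b a where b: "b 0 = w0" "\<And>i. i < k \<Longrightarrow> b i \<in> wedge_ker V w0"
    "\<And>i j. i < n \<Longrightarrow> j < n \<Longrightarrow> pairing (a i) (b j) = (if i = j then 1 else 0)"
    using enumerated_basis[OF subspace_wedge_ker[OF V] self_mem_wedge_ker[OF V] w0] unfolding k_def n_def by metis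
  define P where "P A C = {proj_point (wedge w (t c w)) |w c. w \<in> A \<and> c \<in> C \<and> wedge w (t c w) \<noteq> 0}" for A C
  have PI: "proj_point (wedge w (t c w)) \<in> P A C" if "w \<in> A" "c \<in> C" "wedge w (t c w) \<noteq> 0" for w c A C
    using that by (auto simp: P_def)
  have P_X: "P A C \<subseteq> pluecker_gr2 \<inter> proj_space V" if "C \<subseteq> wedge_ker V w0" for A C
  proof
    fix L assume "L \<in> P A C"
    then obtain w c where wc: "L = proj_point (wedge w (t c w))" "w \<in> A" "c \<in> C" "wedge w (t c w) \<noteq> 0"
      by (auto simp: P_def)
    then have "wedge w (t c w) \<in> V" using t(3)[of c w] that by (auto simp: wedge_ker_def)
    then show "L \<in> pluecker_gr2 \<inter> proj_space V"
      using wc V by (auto simp: pluecker_gr2_iff intro: proj_pointI)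
  qed
  have irr: "irreducible_space (subtopology zariski (P A C))"
    if A: "vec.subspace A" and C: "vec.subspace C" "C \<subseteq> wedge_ker V w0" and ne: "P A C \<noteq> {}" for A C
  proof (rule irreducible_zariskiI[OF ne])
    show "P A C \<subseteq> proj_space UNIV" by (auto simp: P_def)
    fix d e and f g :: "'k^('n \<times> 'n) \<Rightarrow> 'k"
    assume f: "form d f" and g: "form e g" and fg: "P A C \<inter> nonvanishing f \<noteq> {}" "P A C \<inter> nonvanishing g \<noteq> {}"
    obtain w1 c1 where 1: "w1 \<in> A" "c1 \<in> C" "wedge w1 (t c1 w1) \<noteq> 0" "f (wedge w1 (t c1 w1)) \<noteq> 0"
      using fg(1) by (auto simp: P_def proj_point_nonvanishing[OF f])
    obtain w2 c2 where 2: "w2 \<in> A" "c2 \<in> C" "g (wedge w2 (t c2 w2)) \<noteq> 0"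
      using fg(2) by (auto simp: P_def proj_point_nonvanishing[OF g])
    obtain p where p: "wedge w1 (t c1 w1) $ p \<noteq> 0" using 1(3) by (auto simp: vec_eq_iff)
    \<comment> \<open>Moving \<open>w\<close> and \<open>c\<close> along lines inside
      \<open>A\<close> and \<open>C\<close> gives a polynomial curve of decomposable vectors; the
      coordinate \<open>p\<close> guards against the zero vector.\<close>
    define w where "w s = w1 + s *s (w2 - w1)" for s
    define c where "c s = c1 + s *s (c2 - c1)" for s
    define x where "x s = wedge (w s) (t (c s) (w s))" for s
    have wp: "polyfun (\<lambda>s. w s $ j)" "polyfun (\<lambda>s. c s $ j)" for j
      unfolding w_def c_def by (rule polyfun_line)+
    have xp: "polyfun (\<lambda>s. x s $ j)" for j
      unfolding x_def wedge_def vec_lambda_beta by (intro polyfun_diff polyfun_mult t(4) allI wp)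
    have "polyfun (\<lambda>s. f (x s) * x s $ p)" "polyfun (\<lambda>s. g (x s))"
      by (intro polyfun_mult form_polyfun[OF f] form_polyfun[OF g] xp)+
    moreover have "f (x 0) * x 0 $ p \<noteq> 0" "g (x 1) \<noteq> 0"
      using 1 2 p by (simp_all add: x_def w_def c_def)
    ultimately obtain s where "f (x s) * x s $ p \<noteq> 0" "g (x s) \<noteq> 0" by (rule polyfun_common_nonzero)
    then have s: "f (x s) \<noteq> 0" "x s \<noteq> 0" "g (x s) \<noteq> 0" by auto
    have "w s \<in> A" "c s \<in> C"
      using A C 1 2 by (auto simp: w_def c_def intro!: vec.subspace_add vec.subspace_scale vec.subspace_diff)
    then have "proj_point (x s) \<in> P A C" using s(2) unfolding x_def by (rule PI)
    then have "proj_point (x s) \<in> P A C \<inter> nonvanishing f \<inter> nonvanishing g"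
      using s f g by (simp add: proj_point_nonvanishing)
    then show "P A C \<inter> nonvanishing f \<inter> nonvanishing g \<noteq> {}" by blast
  qed
  \<comment> \<open>Truncated subtraction keeps \<open>As i\<close> the line of \<open>w0\<close> up
    to \<open>i = k - 2\<close>, while \<open>Cs i\<close> grows to the span of
    \<open>b 1, ..., b (k - 1)\<close>; later \<open>Cs\<close> is constant and \<open>As\<close>
    gains \<open>b 2, ..., b (n - 1)\<close>. The vector \<open>b 1\<close> stays out of
    \<open>As\<close>, so \<open>a 1\<close> vanishes there.\<close>
  define As where "As i = vec.span (insert w0 (b ` {2..i + 1 - (k - 2)}))" for i
  define Cs where "Cs i = vec.span (b ` {1..min (i + 1) (k - 1)})" for i
  have A: "vec.subspace (As i)" "w0 \<in> As i" for i by (auto simp: As_def intro: vec.span_base)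
  have C: "vec.subspace (Cs i)" "b 1 \<in> Cs i" for i
    using kn by (auto simp: Cs_def intro!: vec.span_base)
  have CK: "Cs i \<subseteq> wedge_ker V w0" for i
    unfolding Cs_def using kn by (intro vec.span_minimal subspace_wedge_ker[OF V]) (auto intro!: b(2))
  have b1: "b i \<in> wedge_ker V w0" "t (b i) w0 = b i" if "i < k" for i
    using that b(2) t(2) by auto
  have ne: "P (As i) (Cs i) \<noteq> {}" for i
  proof -
    have "pairing2 (a 0) (a 1) (wedge w0 (b 1)) = 1"
      using kn b(3)[of 0 0] b(3)[of 0 1] b(3)[of 1 0] b(3)[of 1 1] by (simp add: pairing2_wedge b(1))
    then have "wedge w0 (t (b 1) w0) \<noteq> 0" using kn b1[of 1] form_homogeneous[OF form_pairing2, of _ _ 0]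
      by (auto simp: pairing2_def)
    then show ?thesis using A(2) C(2) PI by blast
  qed
  have "enat (k - 2 + (n - 2)) \<le> krull_dim (subtopology zariski (pluecker_gr2 \<inter> proj_space V))"
  proof (rule krull_dim_ge_chain[where S = "\<lambda>i. P (As i) (Cs i)"])
    show "pluecker_gr2 \<inter> proj_space V \<subseteq> proj_space UNIV" by (auto simp: proj_space_def)
    show "P (As i) (Cs i) \<subseteq> pluecker_gr2 \<inter> proj_space V" for i by (rule P_X[OF CK])
    show "irreducible_space (subtopology zariski (P (As i) (Cs i)))" for i
      by (rule irr[OF A(1) C(1) CK ne])
    show "P (As i) (Cs i) \<subseteq> P (As (Suc i)) (Cs (Suc i))" for i
    proof -
      have "As i \<subseteq> As (Suc i)" unfolding As_def by (intro vec.span_mono) auto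
      moreover have "Cs i \<subseteq> Cs (Suc i)" unfolding Cs_def by (intro vec.span_mono) auto
      ultimately show ?thesis unfolding P_def by blast
    qed
    fix i assume i: "i < k - 2 + (n - 2)"
    show "\<exists>d f. form d f \<and> P (As i) (Cs i) \<inter> nonvanishing f = {} \<and>
        P (As (Suc i)) (Cs (Suc i)) \<inter> nonvanishing f \<noteq> {}"
    proof (cases "i < k - 2")
      case True
      define f where "f = pairing2 (a 0) (a (i + 2))"
      have f: "form 1 f" unfolding f_def by (rule form_pairing2)
      have "f (wedge w (t c w)) = 0" if w: "w \<in> As i" and c: "c \<in> Cs i" for w c
      proof -
        have "w \<in> vec.span {w0}" using w True by (simp add: As_def)
        then obtain q where q: "w = q *s w0" by (auto simp: vec.span_singleton)
        have "c \<in> wedge_ker V w0" using c CK by blast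
        \<comment> \<open>Along the line of \<open>w0\<close>, homogeneity keeps the section a
          multiple of \<open>c\<close>.\<close>
        then have "t c w $ j = q ^ e * c $ j" for j
          using form_homogeneous[OF t(1)[of c j], of q w0] t(2)[of c] by (simp add: q)
        then have "t c w = q ^ e *s c" by (simp add: vec_eq_iff)
        moreover have "pairing (a (i + 2)) c = 0"
          using c unfolding Cs_def by (rule pairing_span) (use True kn in \<open>auto simp: b(3)\<close>)
        moreover have "pairing (a (i + 2)) w0 = 0" using b(3)[of "i + 2" 0] True kn by (simp add: b(1))
        ultimately show ?thesis by (simp add: f_def pairing2_wedge pairing_simps q)
      qed
      then have "P (As i) (Cs i) \<inter> nonvanishing f = {}"
        by (auto simp: P_def proj_point_nonvanishing[OF f])
      moreover have "P (As (Suc i)) (Cs (Suc i)) \<inter> nonvanishing f \<noteq> {}"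
      proof -
        have bi: "b (i + 2) \<in> Cs (Suc i)" unfolding Cs_def using True by (intro vec.span_base) auto
        have "f (wedge w0 (b (i + 2))) = 1"
          using True kn b(3)[of 0 0] b(3)[of 0 "i + 2"] b(3)[of "i + 2" 0] b(3)[of "i + 2" "i + 2"]
          by (simp add: f_def pairing2_wedge b(1))
        then have f1: "f (wedge w0 (t (b (i + 2)) w0)) \<noteq> 0" using b1(2)[of "i + 2"] True by simp
        then have "wedge w0 (t (b (i + 2)) w0) \<noteq> 0" by (auto simp: f_def pairing2_def)
        then have "proj_point (wedge w0 (t (b (i + 2)) w0)) \<in> P (As (Suc i)) (Cs (Suc i)) \<inter> nonvanishing f"
          using f1 PI[OF A(2) bi] by (simp add: proj_point_nonvanishing[OF f])
        then show ?thesis by blast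
      qed
      ultimately show ?thesis using f by blast
    next
      case False
      define j where "j = i - (k - 2) + 2"
      have j: "2 \<le> j" "j < n" and ij: "i + 1 - (k - 2) = j - 1" "Suc i + 1 - (k - 2) = j"
        using i False kn by (auto simp: j_def)
      \<comment> \<open>Both \<open>a j\<close> and \<open>a 1\<close> vanish on
        \<open>As i\<close>, so \<open>f\<close> vanishes whatever the value of the section
        is.\<close>
      define f where "f = pairing2 (a j) (a 1)"
      have f: "form 1 f" unfolding f_def by (rule form_pairing2)
      have "f (wedge w (t c w)) = 0" if w: "w \<in> As i" for w c
      proof -
        have "pairing (a j) w = 0"
          using w unfolding As_def ij
          by (rule pairing_span) (use j kn b(1) b(3)[of j] b(3)[of j 0] in auto)
        moreover have "pairing (a 1) w = 0"
          using w unfolding As_def ij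
          by (rule pairing_span) (use j kn b(1) b(3)[of 1] b(3)[of 1 0] in auto)
        ultimately show ?thesis by (simp add: f_def pairing2_wedge)
      qed
      then have "P (As i) (Cs i) \<inter> nonvanishing f = {}"
        by (auto simp: P_def proj_point_nonvanishing[OF f])
      moreover have "P (As (Suc i)) (Cs (Suc i)) \<inter> nonvanishing f \<noteq> {}"
      proof -
        \<comment> \<open>At \<open>w s\<close> the value of \<open>f\<close> is \<open>s\<close>
          times \<open>pairing (a 1) (t (b 1) (w s))\<close>. The second factor is 1 at
          \<open>s = 0\<close>, so both factors are nonzero for some \<open>s\<close>.\<close>
        define w where "w s = w0 + s *s b j" for s
        have wp: "polyfun (\<lambda>s. w s $ i)" for i unfolding w_def by (rule polyfun_line)
        have "polyfun (\<lambda>s. pairing (a 1) (t (b 1) (w s)))"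
          by (intro polyfun_pairing t(4) allI wp) simp
        moreover have "pairing (a 1) (t (b 1) (w 0)) \<noteq> 0"
          using kn b1[of 1] b(3)[of 1 1] by (simp add: w_def)
        moreover have "polyfun (\<lambda>s. s :: 'k)" "(1 :: 'k) \<noteq> 0" by auto
        ultimately obtain s where s: "pairing (a 1) (t (b 1) (w s)) \<noteq> 0" "s \<noteq> 0"
          using polyfun_common_nonzero by blast
        have "b j \<in> As (Suc i)" unfolding As_def ij using j by (intro vec.span_base) auto
        then have ws: "w s \<in> As (Suc i)"
          unfolding w_def using A by (intro vec.subspace_add vec.subspace_scale) auto
        have "pairing (a j) (w s) = s" "pairing (a 1) (w s) = 0"
          using j kn b(1) b(3)[of j j] b(3)[of j 0] b(3)[of 1 j] b(3)[of 1 0]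
          by (auto simp: w_def pairing_simps)
        then have f1: "f (wedge (w s) (t (b 1) (w s))) \<noteq> 0"
          using s by (simp add: f_def pairing2_wedge)
        then have "wedge (w s) (t (b 1) (w s)) \<noteq> 0" by (auto simp: f_def pairing2_def)
        then have "proj_point (wedge (w s) (t (b 1) (w s))) \<in> P (As (Suc i)) (Cs (Suc i)) \<inter> nonvanishing f"
          using f1 PI[OF ws C(2)] by (simp add: proj_point_nonvanishing[OF f])
        then show ?thesis by blast
      qed
      ultimately show ?thesis using f by blast
    qed
  qed
  moreover have "k - 2 + (n - 2) = n + k - 4" using kn by simp
  ultimately show ?thesis by (simp add: k_def n_def)
qed

section \<open>Group elements acting trivially on a linear section\<close>

text \<open>The coefficients are packed into a polynomial so that a linear factor can be split off.
  The sequence is arbitrary, because it will consist of iterates of a pointwise chosen map that is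
  not known to be linear.\<close>

lemma linear_relation:
  fixes u :: "nat \<Rightarrow> 'k::field^'n"
  obtains p where "p \<noteq> 0" "(\<Sum>i\<le>degree p. coeff p i *s u i) = 0"
proof (cases "inj_on u {..CARD('n)}")
  case False
  then obtain i j where ij: "i < j" "u i = u j" unfolding inj_on_def by (metis linorder_neqE_nat)
  define p :: "'k poly" where "p = monom 1 j - monom 1 i"
  have deg: "degree p \<le> j" unfolding p_def
    using ij(1) by (intro degree_diff_le) (auto intro: order_trans[OF degree_monom_le])
  have "coeff p j = 1" using ij by (simp add: p_def)
  then have "p \<noteq> 0" by auto
  moreover have "(\<Sum>i\<le>degree p. coeff p i *s u i) = 0"
  proof -
    have "(\<Sum>i\<le>degree p. coeff p i *s u i) = (\<Sum>i\<le>j. coeff p i *s u i)"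
      using deg by (intro sum.mono_neutral_left) (auto simp: coeff_eq_0)
    also have "\<dots> = (\<Sum>l\<le>j. (if l = j then u j else 0) - (if l = i then u i else 0))"
      by (intro sum.cong) (auto simp: p_def)
    also have "\<dots> = 0" using ij by (simp add: sum_subtractf)
    finally show ?thesis .
  qed
  ultimately show ?thesis by (rule that)
next
  case True
  let ?S = "u ` {..CARD('n)}"
  have "card ?S = CARD('n) + 1" using True by (simp add: card_image)
  moreover have "vec.dim ?S \<le> CARD('n)"
    using vec.dim_subset[of ?S UNIV] unfolding vec_dim_card by simp
  ultimately have "vec.dependent ?S" by (intro vec.dependent_biggerset_general) simp
  then obtain f v where f: "v \<in> ?S" "f v \<noteq> 0" "(\<Sum>v\<in>?S. f v *s v) = 0"
    unfolding vec.dependent_finite[OF finite_imageI[OF finite_atMost]] by blast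
  obtain i0 where i0: "i0 \<le> CARD('n)" "v = u i0" using f(1) by auto
  define p where "p = Poly (map (\<lambda>i. f (u i)) [0..<CARD('n) + 1])"
  have cp: "coeff p i = (if i \<le> CARD('n) then f (u i) else 0)" for i
    by (auto simp: p_def nth_default_def simp del: upt_Suc)
  have p0: "p \<noteq> 0" using cp[of i0] i0 f(2) by auto
  have "degree p \<le> CARD('n)" by (rule degree_le) (simp add: cp)
  then have "(\<Sum>i\<le>degree p. coeff p i *s u i) = (\<Sum>i\<le>CARD('n). coeff p i *s u i)"
    by (intro sum.mono_neutral_left) (auto simp: coeff_eq_0)
  also have "\<dots> = (\<Sum>v\<in>?S. f v *s v)"
    unfolding sum.reindex[OF True] by (intro sum.cong) (auto simp: cp)
  finally show ?thesis using f(3) p0 that by simp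
qed

text \<open>With \<open>R = V + b \<and> B\<close>, the conditions say that \<open>u \<mapsto> a \<and> u\<close> is an isomorphism from
  \<open>A / k a\<close> to the quotient of the exterior square by \<open>R\<close>, for every \<open>a\<close> in \<open>A - {0}\<close>. An
  eigenvector, modulo \<open>a1\<close> and \<open>a2\<close>, of the quotient of the isomorphisms for \<open>a2\<close>
  and \<open>a1\<close> shows that \<open>A\<close> is at most two-dimensional.\<close>

lemma subspace_le_plane:
  fixes V :: "('k::alg_closed_field^('n::finite \<times> 'n)) set"
  assumes V: "vec.subspace V" and A: "vec.subspace A" and B: "vec.subspace B"
    and inj: "\<And>a u v. a \<in> A \<Longrightarrow> a \<noteq> 0 \<Longrightarrow> u \<in> A \<Longrightarrow> v \<in> B \<Longrightarrow> wedge a u + wedge b v \<in> V \<Longrightarrow> \<exists>c. u = c *s a"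
    and surj: "\<And>a x. a \<in> A \<Longrightarrow> a \<noteq> 0 \<Longrightarrow> x \<in> ext_square UNIV \<Longrightarrow>
      \<exists>u\<in>A. \<exists>v\<in>B. x - wedge a u - wedge b v \<in> V"
    and a: "a1 \<in> A" "a2 \<in> A" "wedge a1 a2 \<noteq> 0"
  shows "A \<subseteq> vec.span {a1, a2}"
proof (rule ccontr)
  let ?E = "vec.span {a1, a2}"
  assume "\<not> A \<subseteq> ?E"
  then obtain u0 where u0: "u0 \<in> A" "u0 \<notin> ?E" by blast
  define R where "R = {x + wedge b v |x v. x \<in> V \<and> v \<in> B}"
  have subR: "vec.subspace R"
  proof -
    have "vec.subspace (wedge b ` B)" by (rule vec.linear_subspace_image[OF linear_wedge B])
    moreover have "R = {x + y |x y. x \<in> V \<and> y \<in> wedge b ` B}" unfolding R_def by blast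
    ultimately show ?thesis using vec.subspace_sums[OF V] by simp
  qed
  have a10: "a1 \<noteq> 0" using a(3) by (auto simp: wedge_simps)
  have "\<forall>u\<in>A. \<exists>u'\<in>A. wedge a2 u - wedge a1 u' \<in> R"
  proof
    fix u assume "u \<in> A"
    obtain u' v where "u' \<in> A" "v \<in> B" "wedge a2 u - wedge a1 u' - wedge b v \<in> V"
      using surj[OF a(1) a10 ext_square_wedge] by blast
    then show "\<exists>u'\<in>A. wedge a2 u - wedge a1 u' \<in> R"
      unfolding R_def by (intro bexI[of _ u']) (force intro!: exI[of _ "wedge a2 u - wedge a1 u' - wedge b v"] exI[of _ v])+
  qed
  \<comment> \<open>The quotient of the two isomorphisms. It is chosen pointwise, so only its
    defining relation modulo \<open>R\<close> is available.\<close>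
  then obtain N where N: "\<And>u. u \<in> A \<Longrightarrow> N u \<in> A \<and> wedge a2 u - wedge a1 (N u) \<in> R" by metis
  define u where "u i = (N ^^ i) u0" for i
  have uA: "u i \<in> A" for i by (induction i) (auto simp: u_def u0 N)
  have uN: "wedge a2 (u i) - wedge a1 (u (Suc i)) \<in> R" for i using N[OF uA] by (simp add: u_def)
  define ev where "ev p = (\<Sum>i\<le>degree p. coeff p i *s u i)" for p
  have ev: "ev p = (\<Sum>i\<le>m. coeff p i *s u i)" if "degree p \<le> m" for p m
    unfolding ev_def using that by (intro sum.mono_neutral_left) (auto simp: coeff_eq_0)
  obtain p0 where "p0 \<noteq> 0" "(\<Sum>i\<le>degree p0. coeff p0 i *s u i) = 0" by (rule linear_relation)
  then have "p0 \<noteq> 0 \<and> ev p0 \<in> ?E" by (simp add: ev_def vec.span_zero)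
  \<comment> \<open>\<open>p\<close> plays the role of the minimal polynomial of \<open>u0\<close>
    modulo the plane.\<close>
  then obtain p where p: "p \<noteq> 0" "ev p \<in> ?E" and
    p_min: "\<And>q. q \<noteq> 0 \<and> ev q \<in> ?E \<Longrightarrow> degree p \<le> degree q"
    using ex_has_least_nat[of "\<lambda>p. p \<noteq> 0 \<and> ev p \<in> ?E" p0 degree] by blast
  have "degree p > 0"
  proof (rule ccontr)
    assume "\<not> degree p > 0"
    then have "degree p = 0" by simp
    then have "ev p = coeff p 0 *s u0" by (simp add: ev_def u_def)
    moreover have "coeff p 0 \<noteq> 0" using p(1) \<open>degree p = 0\<close> by (metis leading_coeff_neq_0)
    ultimately have "u0 = inverse (coeff p 0) *s ev p" by simp
    then show False using p(2) u0(2) by (metis vec.span_scale)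
  qed
  \<comment> \<open>Removing one root lowers the degree, so \<open>ev q\<close> falls outside the
    plane although \<open>ev p\<close> lies in it.\<close>
  then obtain \<mu> where "poly p \<mu> = 0" using alg_closed_imp_poly_has_root by blast
  then obtain q where q: "p = [:-\<mu>, 1:] * q" by (auto simp: poly_eq_0_iff_dvd)
  have q0: "q \<noteq> 0" using q p(1) by auto
  then have dq: "degree p = Suc (degree q)" unfolding q by (subst degree_mult_eq) auto
  then have evq: "ev q \<notin> ?E" using p_min[of q] q0 by auto
  define v' where "v' = (\<Sum>i\<le>degree q. coeff q i *s u (Suc i))"
  have cp: "coeff p i = coeff (pCons 0 q) i - \<mu> * coeff q i" for i unfolding q by simp
  have "ev p = (\<Sum>i\<le>Suc (degree q). coeff (pCons 0 q) i *s u i) - (\<Sum>i\<le>Suc (degree q). (\<mu> * coeff q i) *s u i)"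
    unfolding ev_def dq cp sum_subtractf[symmetric] by (simp only: vec.scale_left_diff_distrib)
  also have "(\<Sum>i\<le>Suc (degree q). coeff (pCons 0 q) i *s u i) = v'"
    unfolding v'_def sum.atMost_Suc_shift by simp
  also have "(\<Sum>i\<le>Suc (degree q). (\<mu> * coeff q i) *s u i) = \<mu> *s ev q"
    unfolding ev[OF le_SucI[OF order_refl], of q] by (simp add: vec.scale_sum_right vector_smult_assoc)
  finally have evp: "ev p = v' - \<mu> *s ev q" .
  obtain \<kappa>1 \<kappa>2 where \<kappa>: "v' - \<mu> *s ev q = \<kappa>1 *s a1 + \<kappa>2 *s a2"
    using p(2) unfolding evp by (auto simp: mem_span_pair)
  have "wedge a2 (ev q) - wedge a1 v' = (\<Sum>i\<le>degree q. coeff q i *s (wedge a2 (u i) - wedge a1 (u (Suc i))))"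
    by (simp add: ev_def v'_def wedge_sum_right wedge_simps vec.scale_right_diff_distrib sum_subtractf)
  also have "\<dots> \<in> R" using uN by (intro vec.subspace_sum[OF subR] vec.subspace_scale[OF subR])
  \<comment> \<open>The multiple of \<open>a1\<close> in \<open>v'\<close> is killed by
    \<open>wedge a1\<close>, and the multiple of \<open>a2\<close> is absorbed into the second
    factor.\<close>
  also have "wedge a2 (ev q) - wedge a1 v' = wedge (a2 - \<mu> *s a1) (ev q + \<kappa>2 *s a1)"
  proof -
    have "v' = \<mu> *s ev q + \<kappa>1 *s a1 + \<kappa>2 *s a2" using \<kappa> by (simp add: algebra_simps)
    then show ?thesis
      by (simp add: wedge_simps wedge_commute[of a2 a1] algebra_simps vec.scale_minus_right)
  qed
  finally obtain x v where xv: "x \<in> V" "v \<in> B" "wedge (a2 - \<mu> *s a1) (ev q + \<kappa>2 *s a1) = x + wedge b v"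
    by (auto simp: R_def)
  have "wedge (a2 - \<mu> *s a1) (ev q + \<kappa>2 *s a1) + wedge b (- v) = x"
    unfolding xv(3) using wedge_simps(6)[of b "-1" v] by simp
  moreover have "ev q \<in> A"
    unfolding ev_def using uA by (intro vec.subspace_sum[OF A] vec.subspace_scale[OF A])
  moreover have "a2 - \<mu> *s a1 \<noteq> 0"
  proof
    assume "a2 - \<mu> *s a1 = 0"
    then have "a2 = \<mu> *s a1" by simp
    then show False using a(3) by (simp add: wedge_simps)
  qed
  ultimately have "\<exists>c. ev q + \<kappa>2 *s a1 = c *s (a2 - \<mu> *s a1)"
    using xv(1,2) a(1,2) A B
    by (intro inj[of _ _ "- v"]) (auto intro!: vec.subspace_add vec.subspace_diff vec.subspace_scale vec.subspace_neg)
  then obtain c where "ev q + \<kappa>2 *s a1 = c *s (a2 - \<mu> *s a1)" by blast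
  then have "ev q = (- c * \<mu> - \<kappa>2) *s a1 + c *s a2"
    by (simp add: vec_eq_iff algebra_simps eq_diff_eq)
  then show False using evq unfolding mem_span_pair by blast
qed

text \<open>The factors at \<open>w1\<close>, \<open>w\<close> and \<open>w1 + w\<close> give a
  linear relation between images under \<open>g\<close>. Injectivity carries it back to
  \<open>w1\<close> and \<open>w\<close>, which are therefore proportional unless the factors
  agree.\<close>

lemma pointwise_multiple:
  fixes f g :: "'k::field^'n \<Rightarrow> 'k^'n"
  assumes f: "Vector_Spaces.linear (*s) (*s) f" and g: "Vector_Spaces.linear (*s) (*s) g"
    and inj: "\<And>w. g w = 0 \<Longrightarrow> w = 0" and ex: "\<And>w. \<exists>c. f w = c *s g w"
  shows "\<exists>c. \<forall>w. f w = c *s g w"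
proof -
  obtain i :: 'n where True by simp
  define w1 :: "'k^'n" where "w1 = axis i 1"
  have w1: "w1 \<noteq> 0" by (simp add: w1_def axis_eq_0_iff)
  obtain c where c: "f w1 = c *s g w1" using ex by blast
  note lin = vec.linear_add[OF f] vec.linear_add[OF g] vec.linear_scale[OF f] vec.linear_scale[OF g]
  have "f w = c *s g w" for w
  proof -
    obtain d where d: "f w = d *s g w" using ex by blast
    obtain e where "f (w1 + w) = e *s g (w1 + w)" using ex by blast
    then have "c *s g w1 + d *s g w = e *s g w1 + e *s g w" by (simp add: lin c d vec.scale_right_distrib)
    then have "(e - c) *s g w1 + (e - d) *s g w = 0" by (simp add: algebra_simps vec.scale_left_diff_distrib)
    then have "g ((e - c) *s w1 + (e - d) *s w) = 0" by (simp only: lin)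
    then have eq: "(e - c) *s w1 + (e - d) *s w = 0" by (rule inj)
    show ?thesis
    proof (cases "e = d")
      case True
      then show ?thesis using eq w1 d by simp
    next
      case False
      have "w = ((c - e) / (e - d)) *s w1"
      proof -
        have "(e - c) * w1 $ i + (e - d) * w $ i = 0" for i
          using arg_cong[OF eq, of "\<lambda>x. x $ i"] unfolding vector_add_component vector_smult_component by simp
        then have "\<forall>i. w $ i = ((c - e) / (e - d)) * w1 $ i"
          using False by (simp add: field_simps)
        then show ?thesis unfolding vec_eq_iff vector_smult_component .
      qed
      then show ?thesis by (metis c lin(3,4) vector_smult_assoc mult.commute)
    qed
  qed
  then show ?thesis by blast
qed

text \<open>Where \<open>g\<close> is not scalar, the kernels are spanned by \<open>w\<close> and \<open>g w\<close>. Since \<open>g\<close> acts by \<open>\<kappa>\<close>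
  on these planes, \<open>g + \<kappa> / g\<close> has only eigenvectors. So \<open>g\<close> has two eigenspaces \<open>A\<close>
  and \<open>B\<close>, these are at most two-dimensional by the previous lemma, and \<open>V\<close> is the span
  of the \<open>a \<and> b\<close>.\<close>

lemma trivial_action_on_section:
  fixes V :: "('k::{alg_closed_field, field_char_0}^('n::finite \<times> 'n)) set" and g :: "'k^'n^'n"
  assumes V: "vec.subspace V" "V \<subseteq> ext_square UNIV"
      "vec.dim V + r = vec.dim (ext_square (UNIV :: ('k^'n) set))" "r + 2 \<le> CARD('n)"
    and order: "N > 0" "\<And>w. (((*v) g) ^^ N) w = w"
    and fixed: "\<And>u v. wedge u v \<in> V \<Longrightarrow> wedge (g *v u) (g *v v) = \<kappa> *s wedge u v"
  shows "(\<forall>w. \<exists>c. g *v w = c *s w) \<or> (\<forall>x\<in>V. tensor_square g *v x = \<kappa> *s x)"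
proof (rule disjCI)
  assume "\<not> (\<forall>x\<in>V. tensor_square g *v x = \<kappa> *s x)"
  show "\<forall>w. \<exists>c. g *v w = c *s w"
  proof (rule ccontr)
    assume "\<not> (\<forall>w. \<exists>c. g *v w = c *s w)"
    then obtain w1 where w1: "\<And>c. g *v w1 \<noteq> c *s w1" by blast
    note glin = matrix_vector_right_distrib matrix_vector_mult_diff_distrib vector_scalar_commute
    have g0: "w = 0" if "g *v w = 0" for w
    proof -
      have "(((*v) g) ^^ Suc m) w = 0" for m by (induction m) (simp_all add: that)
      then show ?thesis using order by (metis gr0_implies_Suc)
    qed
    have wedge_g: "wedge (g *v u) (g *v v) \<noteq> 0" if "wedge u v \<noteq> 0" for u v
    proof
      assume "wedge (g *v u) (g *v v) = 0"
      then consider "g *v u = 0" | c where "g *v v = c *s (g *v u)" by (auto simp: wedge_eq_0_iff)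
      then show False
      proof cases
        case 1
        then show ?thesis using g0[of u] that by (simp add: wedge_simps)
      next
        case 2
        then have "g *v (v - c *s u) = 0" by (simp add: glin)
        then have "v - c *s u = 0" by (rule g0)
        then show ?thesis using that by (simp add: wedge_simps)
      qed
    qed
    \<comment> \<open>A plane in \<open>X\<close> has its bivector scaled by a nonzero
      \<open>\<kappa>\<close>, hence is stable under \<open>g\<close>.\<close>
    have plane: "g *v w \<in> vec.span {w, u}" if "wedge w u \<in> V" "wedge w u \<noteq> 0" for w u
    proof -
      have "\<kappa> \<noteq> 0" using wedge_g[OF that(2)] fixed[OF that(1)] by auto
      then have "vec.span {g *v w, g *v u} = vec.span {w, u}"
        using span_eq_of_wedge_eq[OF that(2)] fixed[OF that(1)] by blast
      then show ?thesis using vec.span_base[of "g *v w" "{g *v w, g *v u}"] by simp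
    qed
    have dim_ker: "2 \<le> vec.dim (wedge_ker V w)" for w
      using dim_wedge_ker[OF V(1-3), of w] V(4) by simp
    \<comment> \<open>If \<open>w\<close> is no eigenvector, the only stable plane through
      \<open>w\<close> is the span of \<open>w\<close> and \<open>g *v w\<close>. The kernel has
      dimension at least 2, so it is exactly this plane.\<close>
    have ker: "u \<in> wedge_ker V w \<longleftrightarrow> u \<in> vec.span {w, g *v w}" if w: "\<And>c. g *v w \<noteq> c *s w" for w u
    proof
      have ker_le: "u \<in> vec.span {w, g *v w}" if "u \<in> wedge_ker V w" for u
      proof (cases "wedge w u = 0")
        case True
        then have "u \<in> vec.span {w}" using w[of 0] by (auto simp: wedge_eq_0_iff vec.span_singleton)
        then show ?thesis using vec.span_mono[of "{w}" "{w, g *v w}"] by blast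
      next
        case False
        then have "g *v w \<in> vec.span {w, u}" using that plane by (simp add: wedge_ker_def)
        then obtain a b where ab: "g *v w = a *s w + b *s u" by (auto simp: mem_span_pair)
        have "b \<noteq> 0" using w[of a] ab by auto
        then have "u = (- a / b) *s w + inverse b *s (g *v w)"
          unfolding ab by (simp add: vec_eq_iff field_simps)
        then show ?thesis unfolding mem_span_pair by blast
      qed
      then show "u \<in> wedge_ker V w \<Longrightarrow> u \<in> vec.span {w, g *v w}" .
      have "vec.dim (vec.span {w, g *v w}) \<le> 2"
      proof -
        have "vec.dim {w, g *v w} \<le> card {w, g *v w}" by (rule vec.dim_le_card[OF vec.span_superset]) simp
        also have "\<dots> \<le> 2" by (simp add: card_insert_if)
        finally show ?thesis by simp
      qed
      then have "wedge_ker V w = vec.span {w, g *v w}"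
        using dim_ker[of w] ker_le subspace_wedge_ker[OF V(1), of w]
        by (intro vec.subspace_dim_equal) auto
      then show "u \<in> vec.span {w, g *v w} \<Longrightarrow> u \<in> wedge_ker V w" by simp
    qed
    have quad: "\<exists>c. g *v (g *v w) + \<kappa> *s w = c *s (g *v w)" for w
    proof (cases "\<exists>c. g *v w = c *s w")
      case True
      then obtain c where c: "g *v w = c *s w" by blast
      show ?thesis
      proof (cases "w = 0 \<or> c = 0")
        case True
        then have "w = 0" using c g0[of w] by auto
        then show ?thesis by simp
      next
        case False
        then have "g *v (g *v w) + \<kappa> *s w = ((c * c + \<kappa>) / c) *s (g *v w)"
          by (simp add: c glin vec_eq_iff field_simps)
        then show ?thesis by blast
      qed
    next
      case False
      then have "g *v w \<in> wedge_ker V w" using ker[of w] by (auto intro: vec.span_base)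
      \<comment> \<open>Both sides combine into a single wedge with \<open>g *v w\<close>, whose
        vanishing is the proportionality.\<close>
      then have "wedge (g *v w) (g *v (g *v w)) = \<kappa> *s wedge w (g *v w)" using fixed by (simp add: wedge_ker_def)
      then have "wedge (g *v w) (g *v (g *v w) + \<kappa> *s w) = 0"
        by (simp add: wedge_simps wedge_commute[of "g *v w" w])
      then show ?thesis using False g0[of w] by (auto simp: wedge_eq_0_iff)
    qed
    have "Vector_Spaces.linear (*s) (*s) (\<lambda>w. g *v (g *v w) + \<kappa> *s w)"
      by (simp add: Vector_Spaces.linear_iff vec.vector_space_axioms glin algebra_simps vec.scale_right_distrib
          vector_smult_assoc)
    then obtain \<tau> where \<tau>: "\<And>w. g *v (g *v w) + \<kappa> *s w = \<tau> *s (g *v w)"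
      using pointwise_multiple[OF _ matrix_vector_mul_linear_gen[of g] g0 quad] by blast
    \<comment> \<open>The roots of the quadratic relation satisfied by \<open>g\<close> will be its
      two eigenvalues; their product is \<open>\<kappa>\<close>.\<close>
    have "degree [:\<kappa>, - \<tau>, 1:] > 0" by simp
    then obtain \<alpha> where "poly [:\<kappa>, - \<tau>, 1:] \<alpha> = 0" using alg_closed_imp_poly_has_root by blast
    then have \<alpha>: "\<kappa> = \<alpha> * (\<tau> - \<alpha>)" by (simp add: algebra_simps eq_neg_iff_add_eq_0 add_eq_0_iff)
    define \<beta> where "\<beta> = \<tau> - \<alpha>"
    have gg: "g *v (g *v w) = (\<alpha> + \<beta>) *s (g *v w) - (\<alpha> * \<beta>) *s w" for w
      using \<tau>[of w] \<alpha> by (simp add: \<beta>_def algebra_simps eq_diff_eq)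
    \<comment> \<open>A double root gives a Jordan block, whose \<open>N\<close>-th power has the
      off-diagonal entry \<open>N * \<alpha> ^ (N - 1)\<close>; this is nonzero in characteristic 0
      and contradicts finite order.\<close>
    have "\<alpha> \<noteq> \<beta>"
    proof
      assume eq: "\<alpha> = \<beta>"
      define y where "y = g *v w1 - \<alpha> *s w1"
      have gy: "g *v y = \<alpha> *s y"
        unfolding y_def by (simp add: glin gg eq vec_eq_iff algebra_simps)
      have gw: "g *v w1 = \<alpha> *s w1 + y" by (simp add: y_def)
      have y0: "y \<noteq> 0" using gw w1[of \<alpha>] by auto
      have powy: "(((*v) g) ^^ m) y = \<alpha> ^ m *s y" for m
        by (induction m) (simp_all add: glin gy vector_smult_assoc mult.commute)
      have poww: "(((*v) g) ^^ Suc m) w1 = \<alpha> ^ Suc m *s w1 + (of_nat (Suc m) * \<alpha> ^ m) *s y" for m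
      proof (induction m)
        case (Suc m)
        have "(((*v) g) ^^ Suc (Suc m)) w1 = g *v ((((*v) g) ^^ Suc m) w1)" by simp
        also have "\<dots> = \<alpha> ^ Suc (Suc m) *s w1 + (of_nat (Suc (Suc m)) * \<alpha> ^ Suc m) *s y"
          unfolding Suc.IH by (simp add: glin gy gw vec_eq_iff algebra_simps)
        finally show ?case .
      qed (simp add: gw)
      obtain m where m: "N = Suc m" using order(1) gr0_implies_Suc by blast
      have "\<alpha> ^ N *s y = 1 *s y" using powy[of N] order(2)[of y] by simp
      then have aN: "\<alpha> ^ N = 1" using y0 unfolding vec.scale_cancel_right by simp
      then have "w1 = w1 + (of_nat N * \<alpha> ^ m) *s y" using poww[of m] order(2)[of w1] m by simp
      then have "(of_nat N * \<alpha> ^ m) *s y = 0" by simp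
      then have "of_nat N * \<alpha> ^ m = 0" using y0 by simp
      moreover have "\<alpha> \<noteq> 0" using aN m by auto
      ultimately show False using order(1) by simp
    qed
    define A where "A = {w. g *v w = \<alpha> *s w}"
    define B where "B = {w. g *v w = \<beta> *s w}"
    have A: "vec.subspace A" and B: "vec.subspace B"
      by (auto simp: A_def B_def vec.subspace_def glin vec.scale_right_distrib vector_smult_assoc mult.commute)
    have AB: "a = 0" if "a \<in> A" "a \<in> B" for a
    proof -
      have "(\<alpha> - \<beta>) *s a = 0" using that by (simp add: A_def B_def vec.scale_left_diff_distrib)
      then show ?thesis using \<open>\<alpha> \<noteq> \<beta>\<close> by simp
    qed
    have decomp: "\<exists>a\<in>A. \<exists>b\<in>B. w = a + b" for w
    proof -
      \<comment> \<open>The two eigenprojections of \<open>g\<close>.\<close>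
      define a where "a = inverse (\<alpha> - \<beta>) *s (g *v w - \<beta> *s w)"
      define b where "b = inverse (\<alpha> - \<beta>) *s (\<alpha> *s w - g *v w)"
      have "a \<in> A" "b \<in> B"
        by (simp_all add: A_def B_def a_def b_def glin gg vec_eq_iff algebra_simps)
      moreover have "w = a + b"
      proof -
        have "a + b = (inverse (\<alpha> - \<beta>) * (\<alpha> - \<beta>)) *s w"
          by (simp add: a_def b_def vec_eq_iff algebra_simps)
        then show ?thesis using \<open>\<alpha> \<noteq> \<beta>\<close> by simp
      qed
      ultimately show ?thesis by blast
    qed
    have generic: "g *v (a + b) \<noteq> c *s (a + b)" if "a \<in> A" "b \<in> B" "a \<noteq> 0" "b \<noteq> 0" for a b c
    proof
      assume "g *v (a + b) = c *s (a + b)"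
      then have "\<alpha> *s a + \<beta> *s b = c *s a + c *s b"
        using that by (simp add: A_def B_def glin vec.scale_right_distrib)
      then have eq: "(\<alpha> - c) *s a = (c - \<beta>) *s b" by (simp add: vec_eq_iff algebra_simps)
      have "(\<alpha> - c) *s a \<in> A" using A that(1) by (rule vec.subspace_scale)
      moreover have "(\<alpha> - c) *s a \<in> B" unfolding eq using B that(2) by (rule vec.subspace_scale)
      ultimately have "(\<alpha> - c) *s a = 0" by (rule AB)
      then show False using eq that \<open>\<alpha> \<noteq> \<beta>\<close> by auto
    qed
    have mixed: "wedge a b \<in> V" if "a \<in> A" "b \<in> B" for a b
    proof (cases "a = 0 \<or> b = 0")
      case True
      then show ?thesis using V(1) by (auto simp: wedge_simps vec.subspace_0)
    next
      case False
      \<comment> \<open>\<open>a + b\<close> is not an eigenvector, so its kernel contains its image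
        under \<open>g\<close>, and the wedge of the two is a multiple of
        \<open>wedge a b\<close>.\<close>
      then have "g *v (a + b) \<in> wedge_ker V (a + b)"
        using ker[OF generic[OF that]] by (auto intro: vec.span_base)
      moreover have "wedge (a + b) (g *v (a + b)) = (\<beta> - \<alpha>) *s wedge a b"
        using that by (simp add: A_def B_def glin wedge_simps wedge_commute[of b a] vec.scale_left_diff_distrib)
      ultimately have "(\<beta> - \<alpha>) *s wedge a b \<in> V" by (simp add: wedge_ker_def)
      then have "inverse (\<beta> - \<alpha>) *s ((\<beta> - \<alpha>) *s wedge a b) \<in> V" by (rule vec.subspace_scale[OF V(1)])
      moreover have "inverse (\<beta> - \<alpha>) * (\<beta> - \<alpha>) = 1" using \<open>\<alpha> \<noteq> \<beta>\<close> by simp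
      ultimately show ?thesis unfolding vector_smult_assoc by simp
    qed
    have mixed': "wedge b a \<in> V" if "a \<in> A" "b \<in> B" for a b
      using mixed[OF that] V(1) by (subst wedge_commute) (rule vec.subspace_neg)
    have expand: "wedge (a + b) (u + v) = (wedge a u + wedge b v) + (wedge a v + wedge b u)" for a b u v
      by (simp add: wedge_simps)
    \<comment> \<open>The kernel at \<open>a + b\<close> is the span of \<open>a\<close> and
      \<open>b\<close>. The cross terms lie in \<open>V\<close>, so the assumption puts
      \<open>u + v\<close> into this kernel, and the components in the eigenspaces are
      compared.\<close>
    have inj: "(\<exists>c. u = c *s a) \<and> (\<exists>c. v = c *s b)"
      if "a \<in> A" "a \<noteq> 0" "b \<in> B" "b \<noteq> 0" "u \<in> A" "v \<in> B" "wedge a u + wedge b v \<in> V" for a b u v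
    proof -
      have "wedge (a + b) (u + v) \<in> V"
        unfolding expand
        by (rule vec.subspace_add[OF V(1) that(7) vec.subspace_add[OF V(1) mixed[OF that(1,6)] mixed'[OF that(5,3)]]])
      then have "u + v \<in> vec.span {a + b, g *v (a + b)}"
        using ker[OF generic[OF that(1,3,2,4)]] by (simp add: wedge_ker_def)
      then obtain p q where pq: "u + v = p *s (a + b) + q *s (g *v (a + b))" by (auto simp: mem_span_pair)
      define p' where "p' = p + q * \<alpha>"
      define q' where "q' = p + q * \<beta>"
      have "u + v = p' *s a + q' *s b"
        unfolding pq using that(1,3)
        by (simp add: p'_def q'_def A_def B_def glin vec_eq_iff algebra_simps)
      then have eq: "u - p' *s a = q' *s b - v" by (simp add: algebra_simps)
      have "u - p' *s a \<in> A" using that A by (intro vec.subspace_diff vec.subspace_scale)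
      moreover have "u - p' *s a \<in> B"
        unfolding eq using that B by (intro vec.subspace_diff vec.subspace_scale)
      ultimately have "u - p' *s a = 0" by (rule AB)
      then have "u = p' *s a" "v = q' *s b" using eq by auto
      then show ?thesis by blast
    qed
    have surj: "\<exists>u\<in>A. \<exists>v\<in>B. x - wedge a u - wedge b v \<in> V"
      if ab: "a \<in> A" "a \<noteq> 0" "b \<in> B" "b \<noteq> 0" and x: "x \<in> ext_square UNIV" for a b x
    proof -
      define w where "w = a + b"
      have gw: "g *v w \<noteq> c *s w" for c unfolding w_def using generic ab by blast
      have w0: "w \<noteq> 0" using gw[of 0] by auto
      \<comment> \<open>A dimension count: \<open>Y\<close> has dimension at least
        \<open>n - 1\<close> and meets \<open>V\<close> in at most a line, while \<open>V\<close>
        has codimension at most \<open>n - 2\<close>. Hence \<open>V\<close> and \<open>Y\<close>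
        span the exterior square.\<close>
      define Y where "Y = range (wedge w)"
      have Y: "vec.subspace Y" unfolding Y_def by (rule vec.linear_subspace_image[OF linear_wedge]) simp
      have "CARD('n) + vec.dim {0 :: 'k^('n \<times> 'n)} \<le> vec.dim {u. matrix (wedge w) *v u \<in> {0}} + vec.dim Y"
        using Y by (intro dim_preimage) (auto simp: vec.subspace_0 wedge_matrix Y_def)
      moreover have "{u. matrix (wedge w) *v u \<in> {0}} = vec.span {w}"
        using w0 by (auto simp: wedge_matrix wedge_eq_0_iff vec.span_singleton)
      ultimately have dY: "CARD('n) \<le> vec.dim Y + 1" using w0 by simp
      have "V \<inter> Y \<subseteq> vec.span {wedge w (g *v w)}"
      proof
        fix y assume "y \<in> V \<inter> Y"
        then obtain u where u: "y = wedge w u" "u \<in> wedge_ker V w" by (auto simp: Y_def wedge_ker_def)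
        then obtain p q where "u = p *s w + q *s (g *v w)" using ker[OF gw] by (auto simp: mem_span_pair)
        then show "y \<in> vec.span {wedge w (g *v w)}" by (auto simp: u wedge_simps vec.span_singleton)
      qed
      then have "vec.dim (V \<inter> Y) \<le> vec.dim {wedge w (g *v w)}" by (rule vec.dim_mono)
      also have "\<dots> \<le> 1" unfolding vec.dim_singleton by simp
      finally have dVY: "vec.dim (V \<inter> Y) \<le> 1" .
      let ?S = "{x + y |x y. x \<in> V \<and> y \<in> Y}"
      have "vec.dim ?S + vec.dim (V \<inter> Y) = vec.dim V + vec.dim Y" by (rule vec.dim_sums_Int[OF V(1) Y])
      then have "vec.dim (ext_square (UNIV :: ('k^'n) set)) \<le> vec.dim ?S" using dY dVY V(3,4) by linarith
      moreover have "?S \<subseteq> ext_square UNIV"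
      proof -
        have "vec.subspace (ext_square (UNIV :: ('k^'n) set))" by (simp add: ext_square_def)
        then show ?thesis using V(2) by (auto simp: Y_def intro!: vec.subspace_add ext_square_wedge)
      qed
      ultimately have "?S = ext_square UNIV"
        using vec.subspace_sums[OF V(1) Y] by (intro vec.subspace_dim_equal) (auto simp: ext_square_def)
      then have "x \<in> ?S" using x by simp
      then obtain x' z where xz: "x = x' + wedge w z" "x' \<in> V" unfolding Y_def by blast
      obtain u v where uv: "u \<in> A" "v \<in> B" "z = u + v" using decomp by blast
      have "x - wedge a u - wedge b v = x' + (wedge a v + wedge b u)"
        by (simp add: xz w_def uv expand)
      also have "\<dots> \<in> V"
        by (rule vec.subspace_add[OF V(1) xz(2) vec.subspace_add[OF V(1) mixed[OF ab(1) uv(2)] mixed'[OF uv(1) ab(3)]]])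
      finally show ?thesis using uv by blast
    qed
    obtain a b where ab: "a \<in> A" "b \<in> B" "w1 = a + b" using decomp by blast
    have a0: "a \<noteq> 0" using w1[of \<beta>] ab by (auto simp: B_def)
    have b0: "b \<noteq> 0" using w1[of \<alpha>] ab by (auto simp: A_def)
    \<comment> \<open>With \<open>b\<close> fixed, \<open>inj\<close> and \<open>surj\<close> are
      the hypotheses of the plane lemma for \<open>A\<close>; exchanging the roles gives
      \<open>B\<close>.\<close>
    have planeA: "A \<subseteq> vec.span {x, y}" if "x \<in> A" "y \<in> A" "wedge x y \<noteq> 0" for x y
      by (rule subspace_le_plane[OF V(1) A B, of b]) (use inj surj ab b0 that in blast)+
    have planeB: "B \<subseteq> vec.span {x, y}" if "x \<in> B" "y \<in> B" "wedge x y \<noteq> 0" for x y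
    proof (rule subspace_le_plane[OF V(1) B A, of a])
      show "\<exists>c. u = c *s b'" if "b' \<in> B" "b' \<noteq> 0" "u \<in> B" "v \<in> A" "wedge b' u + wedge a v \<in> V" for b' u v
        using inj[of a b' v u] that ab a0 by (simp add: add.commute)
      show "\<exists>u\<in>B. \<exists>v\<in>A. x - wedge b' u - wedge a v \<in> V" if b': "b' \<in> B" "b' \<noteq> 0" "x \<in> ext_square UNIV" for b' x
      proof -
        obtain u v where "u \<in> A" "v \<in> B" "x - wedge a u - wedge b' v \<in> V"
          using surj[of a b' x] b' ab a0 by blast
        moreover have "x - wedge b' v - wedge a u = x - wedge a u - wedge b' v" by simp
        ultimately show ?thesis by metis
      qed
    qed (use that in auto)
    have line: "\<exists>u\<in>E. wedge x y = wedge e u"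
      if E: "vec.subspace E" "\<And>x y. x \<in> E \<Longrightarrow> y \<in> E \<Longrightarrow> wedge x y \<noteq> 0 \<Longrightarrow> E \<subseteq> vec.span {x, y}"
        and e: "e \<in> E" "e \<noteq> 0" and xy: "x \<in> E" "y \<in> E" for E e x y
    proof (cases "wedge x y = 0")
      case True
      then show ?thesis using E(1) by (intro bexI[of _ 0]) (simp_all add: wedge_simps vec.subspace_0)
    next
      case False
      then have "e \<in> vec.span {x, y}" using E(2) e xy by blast
      then obtain u where u: "u \<in> vec.span {x, y}" "wedge x y = wedge e u" using e(2) by (rule wedge_rebase)
      have "vec.span {x, y} \<subseteq> E" using E(1) xy by (intro vec.span_minimal) auto
      with u show ?thesis by blast
    qed
    define Z where "Z = {x \<in> V. tensor_square g *v x = \<kappa> *s x}"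
    have Z: "vec.subspace Z"
      using V(1) by (auto simp: Z_def vec.subspace_def glin vec.scale_right_distrib vector_smult_assoc mult.commute)
    have mixZ: "wedge x y \<in> Z" if "wedge x y \<in> V" for x y
      using fixed[OF that] that by (simp add: Z_def tensor_square_wedge)
    \<comment> \<open>The mixed wedges lie in \<open>Z\<close>; since \<open>A\<close> and
      \<open>B\<close> are at most planes, their own bivectors are wedges with \<open>a\<close> and
      \<open>b\<close>. An element of \<open>V\<close> thus differs from one of \<open>Z\<close> by
      \<open>wedge a u + wedge b v\<close> in \<open>V\<close>, which \<open>inj\<close> shows to be
      0.\<close>
    let ?D = "{z + y |z y. z \<in> Z \<and> y \<in> {x + y |x y. x \<in> wedge a ` A \<and> y \<in> wedge b ` B}}"
    have subD: "vec.subspace ?D"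
      by (intro vec.subspace_sums Z vec.linear_subspace_image[OF linear_wedge] A B)
    have "ext_square UNIV \<subseteq> ?D"
      unfolding ext_square_def
    proof (rule vec.span_minimal[OF _ subD], clarify)
      fix x y :: "'k^'n"
      obtain x1 x2 where x: "x1 \<in> A" "x2 \<in> B" "x = x1 + x2" using decomp by blast
      obtain y1 y2 where y: "y1 \<in> A" "y2 \<in> B" "y = y1 + y2" using decomp by blast
      obtain u where u: "u \<in> A" "wedge x1 y1 = wedge a u"
        using line[OF A planeA] ab(1) a0 x y by metis
      obtain v where v: "v \<in> B" "wedge x2 y2 = wedge b v"
        using line[OF B planeB] ab(2) b0 x y by metis
      have "wedge x1 y2 + wedge x2 y1 \<in> Z"
        by (rule vec.subspace_add[OF Z mixZ[OF mixed[OF x(1) y(2)]] mixZ[OF mixed'[OF y(1) x(2)]]])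
      moreover have "wedge x y = (wedge x1 y2 + wedge x2 y1) + (wedge a u + wedge b v)"
        by (simp add: x y expand u v)
      ultimately show "\<exists>z ya. wedge x y = z + ya \<and> z \<in> Z \<and> ya \<in> {x + y |x y. x \<in> wedge a ` A \<and> y \<in> wedge b ` B}"
        using u(1) v(1) by blast
    qed
    have "tensor_square g *v x = \<kappa> *s x" if "x \<in> V" for x
    proof -
      have "x \<in> ?D" using that V(2) \<open>ext_square UNIV \<subseteq> ?D\<close> by blast
      then obtain z u v where zuv: "z \<in> Z" "u \<in> A" "v \<in> B" "x = z + (wedge a u + wedge b v)" by blast
      have "x - z \<in> V" using that zuv(1) V(1) by (intro vec.subspace_diff) (auto simp: Z_def)
      then have "wedge a u + wedge b v \<in> V" using zuv(4) by simp
      then have "(\<exists>c. u = c *s a) \<and> (\<exists>c. v = c *s b)" using inj ab a0 b0 zuv by blast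
      then have "wedge a u + wedge b v = 0" by (auto simp: wedge_simps)
      then show ?thesis using zuv by (simp add: Z_def)
    qed
    then show False using \<open>\<not> (\<forall>x\<in>V. tensor_square g *v x = \<kappa> *s x)\<close> by blast
  qed
qed

section \<open>Free points on \<open>X\<close> and the generic dimension of the kernels\<close>

lemma dense_open_nonempty:
  assumes "dense_open (subtopology zariski S) U" "S \<noteq> {}" "S \<subseteq> proj_space UNIV"
  shows "U \<noteq> {}" "U \<subseteq> S"
proof -
  have top: "topspace (subtopology zariski S) = S"
    using assms(3) by (auto simp: topspace_zariski)
  show "U \<noteq> {}" using assms(1,2) top by (auto simp: dense_open_def)
  show "U \<subseteq> S" using assms(1) top openin_subset by (fastforce simp: dense_open_def)
qed

lemma generically_free_faithful:
  assumes "generically_free G act (subtopology zariski S)" "S \<noteq> {}" "S \<subseteq> proj_space UNIV"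
    and "g \<in> carrier G" "\<And>L. L \<in> S \<Longrightarrow> act g L = L"
  shows "g = \<one>\<^bsub>G\<^esub>"
proof -
  obtain U where U: "dense_open (subtopology zariski S) U"
    "\<forall>p\<in>U. \<forall>g\<in>carrier G. act g p = p \<longrightarrow> g = \<one>\<^bsub>G\<^esub>"
    using assms(1) by (auto simp: generically_free_def)
  from dense_open_nonempty[OF U(1) assms(2,3)] obtain p where "p \<in> U" "p \<in> S" by blast
  then show ?thesis using U(2) assms(4,5) by blast
qed

lemma finite_group_power:
  assumes "group G" "finite (carrier G)" "representation G \<rho>" "g \<in> carrier G"
  obtains N where "N > 0" "\<And>w. (((*v) (\<rho> g)) ^^ N) w = w"
proof -
  interpret group G by fact
  have "range (\<lambda>i::nat. g [^]\<^bsub>G\<^esub> i) \<subseteq> carrier G" using assms(4) by auto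
  then have "\<not> inj (\<lambda>i::nat. g [^]\<^bsub>G\<^esub> i)"
    using assms(2) finite_subset finite_imageD infinite_UNIV_nat by metis
  then obtain i j :: nat where ij: "i < j" "g [^]\<^bsub>G\<^esub> i = g [^]\<^bsub>G\<^esub> j"
    unfolding inj_def by (metis linorder_neqE_nat)
  have "g [^]\<^bsub>G\<^esub> i \<otimes>\<^bsub>G\<^esub> g [^]\<^bsub>G\<^esub> (j - i) = g [^]\<^bsub>G\<^esub> i \<otimes>\<^bsub>G\<^esub> \<one>\<^bsub>G\<^esub>"
    using ij nat_pow_mult[OF assms(4), of i "j - i"] assms(4) by simp
  then have one: "g [^]\<^bsub>G\<^esub> (j - i) = \<one>\<^bsub>G\<^esub>" using assms(4) using Units_l_cancel[of "g [^]\<^bsub>G\<^esub> i" "g [^]\<^bsub>G\<^esub> (j - i)" "\<one>\<^bsub>G\<^esub>"] by simp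
  have pow: "(((*v) (\<rho> g)) ^^ m) w = \<rho> (g [^]\<^bsub>G\<^esub> m) *v w" for m w
  proof (induction m arbitrary: w)
    case 0
    then show ?case by (simp add: representation_one[OF assms(1,3)])
  next
    case (Suc m)
    then show ?case using assms(4)
      by (simp add: representation_mult[OF assms(3)] funpow_Suc_right del: funpow.simps flip: matrix_vector_mul_assoc)
  qed
  show ?thesis
  proof (rule that)
    show "j - i > 0" using ij by simp
    show "(((*v) (\<rho> g)) ^^ (j - i)) w = w" for w
      unfolding pow one by (simp add: representation_one[OF assms(1,3)])
  qed
qed

lemma proj_act_scalar:
  assumes "\<And>x. x \<noteq> 0 \<Longrightarrow> A g *v x \<noteq> 0" "\<And>x. x \<in> V \<Longrightarrow> \<exists>c. A g *v x = c *s x" "L \<in> proj_space V"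
  shows "proj_act A g L = L"
proof -
  obtain x where x: "x \<noteq> 0" "x \<in> V" "L = proj_point x" using assms(3) by (rule proj_spaceE)
  obtain c where c: "A g *v x = c *s x" using assms(2)[OF x(2)] by blast
  then have "c \<noteq> 0" using assms(1)[OF x(1)] by auto
  then show ?thesis by (simp add: x(3) proj_act_point c proj_point_scale)
qed

text \<open>The index \<open>p\<close> lists the forms of one open condition, such as all minors of
  a matrix; \<open>i\<close> runs through finitely many nonempty conditions, to be met at one
  point.\<close>

lemma irreducible_zariski_finite:
  assumes "irreducible_space (subtopology zariski S)" "finite I"
    and "\<And>i p. i \<in> I \<Longrightarrow> form (d i) (f i p)"
    and "\<And>i. i \<in> I \<Longrightarrow> \<exists>x p. x \<noteq> 0 \<and> proj_point x \<in> S \<and> f i p x \<noteq> 0"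
  obtains x where "x \<noteq> 0" "proj_point x \<in> S" "\<And>i. i \<in> I \<Longrightarrow> \<exists>p. f i p x \<noteq> 0"
proof -
  let ?U = "\<lambda>i. S \<inter> (\<Union>p. nonvanishing (f i p))"
  have "\<exists>L\<in>topspace (subtopology zariski S). \<forall>i\<in>I. L \<in> ?U i"
  proof (rule irreducible_space_finite_Inter[OF assms(1,2)])
    fix i assume i: "i \<in> I"
    show "openin (subtopology zariski S) (?U i)"
      by (intro openin_subtopology_Int2 openin_Union) (use openin_nonvanishing[OF assms(3)[OF i]] in auto)
    obtain x p where "x \<noteq> 0" "proj_point x \<in> S" "f i p x \<noteq> 0" using assms(4)[OF i] by blast
    then have "proj_point x \<in> ?U i" using proj_point_nonvanishing[OF assms(3)[OF i]] by blast
    then show "?U i \<noteq> {}" by blast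
  qed
  then obtain L where L: "L \<in> proj_space UNIV" "L \<in> S" "\<forall>i\<in>I. L \<in> ?U i" by (auto simp: topspace_zariski)
  obtain x where x: "x \<noteq> 0" "L = proj_point x" using L(1) by (rule proj_spaceE)
  show ?thesis
  proof (rule that[OF x(1)])
    show "proj_point x \<in> S" using L x by simp
    show "\<exists>p. f i p x \<noteq> 0" if "i \<in> I" for i
      using L(3) that proj_point_nonvanishing[OF assms(3)[OF that]] x by blast
  qed
qed

lemma plane_section_iff:
  assumes "vec.subspace V"
  shows "x \<noteq> 0 \<and> proj_point x \<in> pluecker_gr2 \<inter> proj_space V \<longleftrightarrow> x \<noteq> 0 \<and> x \<in> V \<and> (\<exists>u v. x = wedge u v)"
proof
  assume x: "x \<noteq> 0 \<and> proj_point x \<in> pluecker_gr2 \<inter> proj_space V"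
  then obtain u v where uv: "wedge u v \<noteq> 0" "proj_point x = proj_point (wedge u v)"
    by (auto simp: pluecker_gr2_iff)
  then obtain c where "x = c *s wedge u v" using x proj_point_eqD by metis
  then have "x = wedge (c *s u) v" by (simp add: wedge_simps)
  moreover have "x \<in> V" using x by (auto simp: proj_space_def proj_point_def intro: vec.span_base)
  ultimately show "x \<noteq> 0 \<and> x \<in> V \<and> (\<exists>u v. x = wedge u v)" using x by blast
qed (use assms in \<open>auto simp: pluecker_gr2_iff intro: proj_pointI\<close>)

text \<open>For each nontrivial \<open>g\<close> the points of \<open>X\<close> moved by
  \<open>g\<close> form an open set. It is nonempty by the classification above and generic
  freeness, and irreducibility yields a point in all these sets.\<close>

lemma free_point_on_section:
  fixes V :: "('k::{alg_closed_field, field_char_0}^('n::finite \<times> 'n)) set" and \<rho> :: "'g \<Rightarrow> 'k^'n^'n"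
  assumes G: "group G" "finite (carrier G)" and \<rho>: "representation G \<rho>"
    and V: "V \<subseteq> ext_square UNIV" "subrepresentation G (tensor_square \<circ> \<rho>) V"
      "vec.dim V + r = vec.dim (ext_square (UNIV :: ('k^'n) set))" "r + 2 \<le> CARD('n)"
    and free: "generically_free G (proj_act \<rho>) (subtopology zariski (proj_space (UNIV :: ('k^'n) set)))"
      "generically_free G (proj_act (tensor_square \<circ> \<rho>)) (subtopology zariski (proj_space V))"
    and irr: "irreducible_space (subtopology zariski (pluecker_gr2 \<inter> proj_space V))"
  obtains x where "x \<noteq> 0" "proj_point x \<in> pluecker_gr2 \<inter> proj_space V"
    "\<And>g. g \<in> carrier G \<Longrightarrow> proj_act (tensor_square \<circ> \<rho>) g (proj_point x) = proj_point x \<Longrightarrow> g = \<one>\<^bsub>G\<^esub>"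
proof -
  let ?X = "pluecker_gr2 \<inter> proj_space V"
  let ?T = "\<lambda>g. tensor_square (\<rho> g)"
  have subV: "vec.subspace V" using V(2) by (simp add: subrepresentation_def)
  note X_iff = plane_section_iff[OF subV]
  have X_UNIV: "?X \<subseteq> proj_space UNIV" by (auto simp: proj_space_def)
  have T: "representation G ?T" using representation_tensor_square[OF \<rho>] by (simp add: comp_def)
  have moved: "\<exists>x. x \<noteq> 0 \<and> proj_point x \<in> ?X \<and> proj_point (?T g *v x) \<noteq> proj_point x"
    if g: "g \<in> carrier G" "g \<noteq> \<one>\<^bsub>G\<^esub>" for g
  proof (rule ccontr)
    assume neg: "\<not> ?thesis"
    obtain N where N: "N > 0" "\<And>w. (((*v) (\<rho> g)) ^^ N) w = w"
      by (rule finite_group_power[OF G \<rho> g(1)]) blast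
    \<comment> \<open>The eigenvalue is a root of unity because \<open>g\<close> has finite order;
      so only finitely many are possible.\<close>
    have eig: "\<exists>c. c ^ N = 1 \<and> ?T g *v x = c *s x" if x: "x \<noteq> 0" "proj_point x \<in> ?X" for x
    proof -
      have "proj_point (?T g *v x) = proj_point x" using neg x by blast
      moreover have "?T g *v x \<noteq> 0" using representation_eq_0_iff[OF G(1) T g(1)] x by simp
      ultimately obtain c where c: "?T g *v x = c *s x" by (metis proj_point_eqD)
      obtain u v where uv: "x = wedge u v" using x X_iff by blast
      have "wedge ((((*v) (\<rho> g)) ^^ m) u) ((((*v) (\<rho> g)) ^^ m) v) = c ^ m *s x" for m
      proof (induction m)
        case (Suc m)
        have "wedge ((((*v) (\<rho> g)) ^^ Suc m) u) ((((*v) (\<rho> g)) ^^ Suc m) v) = ?T g *v (c ^ m *s x)"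
          by (simp flip: Suc tensor_square_wedge)
        then show ?case by (simp add: vector_scalar_commute c vector_smult_assoc mult.commute)
      qed (simp add: uv)
      from this[of N] have "c ^ N *s x = 1 *s x" by (simp add: N uv)
      then have "c ^ N = 1" using x unfolding vec.scale_cancel_right by simp
      with c show ?thesis by blast
    qed
    \<comment> \<open>One eigenvalue serves all points: otherwise each of the finitely many
      candidates fails on a nonempty open subset of \<open>X\<close>, and these subsets have a
      common point.\<close>
    have "\<exists>\<kappa>. \<forall>x. x \<noteq> 0 \<and> proj_point x \<in> ?X \<longrightarrow> ?T g *v x = \<kappa> *s x"
    proof (rule ccontr)
      assume neg2: "\<not> ?thesis"
      have fin: "finite {c :: 'k. c ^ N = 1}"
      proof -
        have "coeff (monom 1 N - 1 :: 'k poly) N \<noteq> 0" using N(1) by simp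
        then have "monom 1 N - 1 \<noteq> (0 :: 'k poly)" by (metis coeff_0)
        from poly_roots_finite[OF this] show ?thesis by (simp add: poly_monom)
      qed
      obtain x where x: "x \<noteq> 0" "proj_point x \<in> ?X" "\<And>c. c \<in> {c. c ^ N = 1} \<Longrightarrow> \<exists>p. (?T g *v x) $ p - c * x $ p \<noteq> 0"
      proof (rule irreducible_zariski_finite[OF irr fin, of "\<lambda>_. 1" "\<lambda>c p x. (?T g *v x) $ p - c * x $ p"])
        show "form 1 (\<lambda>x. (?T g *v x) $ p - c * x $ p)" for c p
          by (intro form_diff form_cmult form_nth form_matrix)
        show "\<exists>x p. x \<noteq> 0 \<and> proj_point x \<in> ?X \<and> (?T g *v x) $ p - c * x $ p \<noteq> 0" for c
        proof -
          obtain x where "x \<noteq> 0" "proj_point x \<in> ?X" "?T g *v x \<noteq> c *s x" using neg2 by blast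
          then show ?thesis by (auto simp: vec_eq_iff)
        qed
      qed blast
      from eig[OF x(1,2)] obtain c where "c ^ N = 1" "?T g *v x = c *s x" by blast
      with x(3)[of c] show False by simp
    qed
    then obtain \<kappa> where \<kappa>: "\<And>x. x \<noteq> 0 \<Longrightarrow> proj_point x \<in> ?X \<Longrightarrow> ?T g *v x = \<kappa> *s x" by blast
    have "wedge (\<rho> g *v u) (\<rho> g *v v) = \<kappa> *s wedge u v" if "wedge u v \<in> V" for u v
    proof (cases "wedge u v = 0")
      case True
      then show ?thesis by (simp flip: tensor_square_wedge)
    next
      case False
      then have "proj_point (wedge u v) \<in> ?X" using that X_iff by blast
      then show ?thesis using \<kappa> False by (simp flip: tensor_square_wedge)
    qed
    from trivial_action_on_section[OF subV V(1,3,4) N this]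
    show False
    proof
      assume sc: "\<forall>w. \<exists>c. \<rho> g *v w = c *s w"
      have "proj_act \<rho> g L = L" if "L \<in> proj_space UNIV" for L
        by (rule proj_act_scalar[OF _ _ that]) (use sc representation_eq_0_iff[OF G(1) \<rho> g(1)] in auto)
      moreover have "proj_space (UNIV :: ('k^'n) set) \<noteq> {}"
        using irreducible_proj_space by (force simp: irreducible_space_def)
      ultimately have "g = \<one>\<^bsub>G\<^esub>" using generically_free_faithful[OF free(1)] g(1) by blast
      then show False using g(2) by simp
    next
      assume sc: "\<forall>x\<in>V. ?T g *v x = \<kappa> *s x"
      have "proj_act (tensor_square \<circ> \<rho>) g L = L" if "L \<in> proj_space V" for L
        by (rule proj_act_scalar[OF _ _ that]) (use sc representation_eq_0_iff[OF G(1) T g(1)] in auto)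
      moreover have "proj_space V \<noteq> {}" using irr by (auto simp: irreducible_space_def)
      moreover have "proj_space V \<subseteq> proj_space UNIV" by (auto simp: proj_space_def)
      ultimately have "g = \<one>\<^bsub>G\<^esub>" using generically_free_faithful[OF free(2)] g(1) by blast
      then show False using g(2) by simp
    qed
  qed
  let ?f = "\<lambda>g (p, q) x. (?T g *v x) $ p * x $ q - (?T g *v x) $ q * x $ p"
  obtain x where x: "x \<noteq> 0" "proj_point x \<in> ?X" "\<And>g. g \<in> carrier G - {\<one>\<^bsub>G\<^esub>} \<Longrightarrow> \<exists>p. ?f g p x \<noteq> 0"
  proof (rule irreducible_zariski_finite[OF irr, of "carrier G - {\<one>\<^bsub>G\<^esub>}" "\<lambda>_. 1 + 1" ?f])
    show "finite (carrier G - {\<one>\<^bsub>G\<^esub>})" using G(2) by simp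
    show "form (1 + 1) (?f g p)" for g p
      by (cases p) (auto simp only: split_conv intro!: form_diff form_mult form_nth form_matrix)
    show "\<exists>x p. x \<noteq> 0 \<and> proj_point x \<in> ?X \<and> ?f g p x \<noteq> 0" if "g \<in> carrier G - {\<one>\<^bsub>G\<^esub>}" for g
    proof -
      obtain x where x: "x \<noteq> 0" "proj_point x \<in> ?X" "proj_point (?T g *v x) \<noteq> proj_point x"
        using moved \<open>g \<in> carrier G - {\<one>\<^bsub>G\<^esub>}\<close> by blast
      have "g \<in> carrier G" using \<open>g \<in> carrier G - {\<one>\<^bsub>G\<^esub>}\<close> by blast
      then have "?T g *v x \<noteq> 0" using representation_eq_0_iff[OF G(1) T] x(1) by simp
      then obtain p q where "?f g (p, q) x \<noteq> 0"
        using x(3) proj_point_eq_iff_minors[of "?T g *v x" x] x(1) by auto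
      then show ?thesis using x by blast
    qed
  qed blast
  show ?thesis
  proof (rule that[OF x(1,2)])
    fix g assume g: "g \<in> carrier G" "proj_act (tensor_square \<circ> \<rho>) g (proj_point x) = proj_point x"
    have "?T g *v x \<noteq> 0" using representation_eq_0_iff[OF G(1) T g(1)] x(1) by simp
    moreover have "proj_point (?T g *v x) = proj_point x" using g(2) by (simp add: proj_act_point)
    ultimately have "\<forall>p. ?f g p x = 0" using proj_point_eq_iff_minors[of "?T g *v x" x] x(1) by (simp add: split_paired_all)
    then show "g = \<one>\<^bsub>G\<^esub>" using x(3)[of g] g(1) by blast
  qed
qed

text \<open>The chain bounds the least kernel dimension by \<open>n - r\<close> from above. An open
  set on which it is attained then meets the free locus.\<close>

lemma generic_kernel_point:
  fixes V :: "('k::field_char_0^('n::finite \<times> 'n)) set" and \<rho> :: "'g \<Rightarrow> 'k^'n^'n"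
  assumes V: "vec.subspace V" "V \<subseteq> ext_square UNIV"
      "vec.dim V + r = vec.dim (ext_square (UNIV :: ('k^'n) set))" "r + 2 \<le> CARD('n)"
    and free: "generically_free G (proj_act \<rho>) (subtopology zariski (proj_space (UNIV :: ('k^'n) set)))"
    and dim: "krull_dim (subtopology zariski (pluecker_gr2 \<inter> proj_space V)) = enat (2 * (CARD('n) - 2) - r)"
  obtains w where "w \<noteq> 0" "vec.dim (wedge_ker V w) = CARD('n) - r"
    "\<And>w'. CARD('n) - r \<le> vec.dim (wedge_ker V w')"
    "\<And>g. g \<in> carrier G \<Longrightarrow> proj_act \<rho> g (proj_point w) = proj_point w \<Longrightarrow> g = \<one>\<^bsub>G\<^esub>"
proof -
  obtain i :: 'n where True by simp
  have "axis i (1::'k) \<noteq> 0" by (simp add: axis_eq_0_iff)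
  \<comment> \<open>The minimum is taken over nonzero vectors; at 0 the kernel is
    everything.\<close>
  then obtain w1 where w1: "w1 \<noteq> 0" and w1_min: "\<And>w. w \<noteq> 0 \<Longrightarrow> vec.dim (wedge_ker V w1) \<le> vec.dim (wedge_ker V w)"
    using ex_has_least_nat[of "\<lambda>w. w \<noteq> 0" "axis i (1::'k)" "\<lambda>w. vec.dim (wedge_ker V w)"] by blast
  have min: "vec.dim (wedge_ker V w1) \<le> vec.dim (wedge_ker V w)" for w
  proof (cases "w = 0")
    case True
    then have "wedge_ker V w = UNIV" using V(1) by (auto simp: wedge_ker_def wedge_simps vec.subspace_0)
    then show ?thesis by (metis vec.dim_subset subset_UNIV)
  qed (rule w1_min)
  have ge: "CARD('n) - r \<le> vec.dim (wedge_ker V w)" for w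
    using dim_wedge_ker[OF V(1-3), of w] by simp
  have "enat (CARD('n) + vec.dim (wedge_ker V w1) - 4) \<le> enat (2 * (CARD('n) - 2) - r)"
    unfolding dim[symmetric]
    by (rule krull_dim_grassmannian_section_ge[OF V(1) w1 min]) (use ge[of w1] V(4) in linarith)
  then have k: "vec.dim (wedge_ker V w1) = CARD('n) - r" using ge[of w1] V(4) by simp
  obtain d D e and t :: "'k^'n \<Rightarrow> 'k^'n \<Rightarrow> 'k^'n" where D: "form d D" "D w1 \<noteq> 0"
    "\<And>w. D w \<noteq> 0 \<Longrightarrow> vec.dim (wedge_ker V w) = vec.dim (wedge_ker V w1)"
    using wedge_ker_sections[OF V(1) w1 min] by metis
  obtain U where U: "dense_open (subtopology zariski (proj_space (UNIV :: ('k^'n) set))) U"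
    "\<forall>p\<in>U. \<forall>g\<in>carrier G. proj_act \<rho> g p = p \<longrightarrow> g = \<one>\<^bsub>G\<^esub>"
    using free by (auto simp: generically_free_def)
  have "proj_point w1 \<in> proj_space UNIV" using w1 by simp
  then obtain w where "w \<noteq> 0" "proj_point w \<in> U" "D w \<noteq> 0"
    using dense_open_meets_nonvanishing[OF U(1) D(1) w1] D(2) by metis
  with U(2) D(3) k ge show ?thesis by (intro that[of w]) auto
qed

section \<open>Maps given by biforms\<close>

text \<open>Junk if \<open>L\<close> is not a line.\<close>

definition rep_vec :: "('k::field^'a) set \<Rightarrow> 'k^'a" where
  "rep_vec L = (SOME x. x \<noteq> 0 \<and> L = proj_point x)"

definition lift2 ::
  "('k::field^'a \<Rightarrow> 'k^'b \<Rightarrow> 'k^'c) \<Rightarrow> ('k^'a) set \<times> ('k^'b) set \<Rightarrow> ('k^'c) set" where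
  "lift2 F p = proj_point (F (rep_vec (fst p)) (rep_vec (snd p)))"

lemma rep_vec_point:
  assumes "x \<noteq> 0"
  obtains c where "c \<noteq> 0" "rep_vec (proj_point x) = c *s x"
proof -
  have "rep_vec (proj_point x) \<noteq> 0 \<and> proj_point x = proj_point (rep_vec (proj_point x))"
    unfolding rep_vec_def by (rule someI[of _ x]) (simp add: assms)
  then show ?thesis using proj_point_eqD that by metis
qed

text \<open>Homogeneity makes the chosen representatives irrelevant: they change the value by a
  nonzero scalar.\<close>

lemma lift2_point:
  assumes "\<And>i. biform d e (\<lambda>x y. F x y $ i)" "x \<noteq> 0" "y \<noteq> 0"
  shows "lift2 F (proj_point x, proj_point y) = proj_point (F x y)"
proof -
  obtain a where a: "a \<noteq> 0" "rep_vec (proj_point x) = a *s x" using rep_vec_point[OF assms(2)] .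
  obtain b where b: "b \<noteq> 0" "rep_vec (proj_point y) = b *s y" using rep_vec_point[OF assms(3)] .
  have "F (a *s x) (b *s y) = (a ^ d * b ^ e) *s F x y"
    using biform_homogeneous[OF assms(1)] by (simp add: vec_eq_iff)
  then show ?thesis using a b by (simp add: lift2_def proj_point_scale)
qed

text \<open>One vector of biforms serves on all of \<open>U\<close>, so the neighbourhood in
  \<open>regular_map\<close> is the whole space.\<close>

lemma regular_lift2:
  fixes F :: "'k::field^'a::finite \<Rightarrow> 'k^'b::finite \<Rightarrow> 'k^'c::finite"
  assumes "\<And>i. biform d e (\<lambda>x y. F x y $ i)" "U \<subseteq> proj_space UNIV \<times> proj_space UNIV"
    and "\<And>x y. x \<noteq> 0 \<Longrightarrow> y \<noteq> 0 \<Longrightarrow> (proj_point x, proj_point y) \<in> U \<Longrightarrow> F x y \<noteq> 0"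
  shows "regular_map U (lift2 F)"
  unfolding regular_map_def
proof
  fix p assume p: "p \<in> U"
  have "openin zariski2 (topspace zariski2 :: (('k^'a) set \<times> ('k^'b) set) set)" by (rule openin_topspace)
  moreover have "p \<in> topspace zariski2" using p assms(2) by (auto simp: topspace_zariski2)
  moreover have "F x y \<noteq> 0 \<and> lift2 F (proj_point x, proj_point y) = proj_point (F x y)"
    if "(proj_point x, proj_point y) \<in> U \<inter> topspace zariski2" for x y
  proof -
    have "x \<noteq> 0" "y \<noteq> 0" using that by (auto simp: topspace_zariski2)
    then show ?thesis using assms(3) lift2_point[OF assms(1)] that by blast
  qed
  ultimately show "\<exists>N d e F'. openin zariski2 N \<and> p \<in> N \<and> (\<forall>i. biform d e (\<lambda>x y. F' x y $ i)) \<and>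
      (\<forall>x y. (proj_point x, proj_point y) \<in> U \<inter> N \<longrightarrow>
        F' x y \<noteq> 0 \<and> lift2 F (proj_point x, proj_point y) = proj_point (F' x y))"
    using assms(1) by blast
qed

section \<open>The birational correspondence\<close>

text \<open>\<open>S1\<close> and \<open>S2\<close> are sections of the tautological plane bundle on the cone over \<open>X\<close>, and the
  \<open>t i\<close> are sections of the bundle with fibre \<open>wedge_ker V w\<close> over \<open>w\<close>, generically a basis
  modulo \<open>w\<close>. A pair of a plane in \<open>X\<close> and a line \<open>w\<close> in it is described on one side by the
  coordinates of \<open>w\<close> with respect to \<open>S1\<close> and \<open>S2\<close>, and on the other side by the
  coordinates of the plane with respect to the \<open>t i\<close>.\<close>

locale plane_sections =
  fixes G :: "('g, 'x) monoid_scheme" and \<rho> :: "'g \<Rightarrow> 'k::field_char_0^'n^'n"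
    and V :: "('k^('n::finite \<times> 'n)) set"
    and S1 S2 :: "'k^('n \<times> 'n) \<Rightarrow> 'k^'n" and e1 :: nat
    and t :: "'m::finite \<Rightarrow> 'k^'n \<Rightarrow> 'k^'n" and e2 :: nat
    and \<alpha> :: "'k^'n" and \<beta> :: "'m \<Rightarrow> 'k^'n" and p0 :: "'n \<times> 'n"
    and q :: "'k^('n \<times> 'n) \<Rightarrow> 'k" and dq :: nat and f :: "'k^'n \<Rightarrow> 'k" and df :: nat
  assumes grp: "group G" and rep: "representation G \<rho>"
    and subV: "vec.subspace V" and stabV: "\<And>g x. g \<in> carrier G \<Longrightarrow> x \<in> V \<Longrightarrow> tensor_square (\<rho> g) *v x \<in> V"
    and irrX: "irreducible_space (subtopology zariski (pluecker_gr2 \<inter> proj_space V))"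
    and S_form: "\<And>i. form e1 (\<lambda>x. S1 x $ i)" "\<And>i. form e1 (\<lambda>x. S2 x $ i)"
    and S_mem: "\<And>u v. S1 (wedge u v) \<in> vec.span {u, v}" "\<And>u v. S2 (wedge u v) \<in> vec.span {u, v}"
    and S_equiv: "\<And>g x. g \<in> carrier G \<Longrightarrow> S1 (tensor_square (\<rho> g) *v x) = \<rho> g *v S1 x"
      "\<And>g x. g \<in> carrier G \<Longrightarrow> S2 (tensor_square (\<rho> g) *v x) = \<rho> g *v S2 x"
    and t_form: "\<And>i j. form e2 (\<lambda>w. t i w $ j)"
    and t_mem: "\<And>i w. t i w \<in> wedge_ker V w"
    and t_equiv: "\<And>i g w. g \<in> carrier G \<Longrightarrow> t i (\<rho> g *v w) = \<rho> g *v t i w"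
    and q_form: "form dq q" and f_form: "form df f"
    and q_nz: "\<And>x. q x \<noteq> 0 \<Longrightarrow> wedge (S1 x) (S2 x) $ p0 \<noteq> 0"
    and q_stab: "\<And>g x. g \<in> carrier G \<Longrightarrow> q x \<noteq> 0 \<Longrightarrow> q (tensor_square (\<rho> g) *v x) \<noteq> 0"
    and f_det: "\<And>w. f w \<noteq> 0 \<Longrightarrow> det (\<chi> j i. pairing2 \<alpha> (\<beta> j) (wedge w (t i w))) \<noteq> 0"
    and f_dim: "\<And>w. f w \<noteq> 0 \<Longrightarrow> vec.dim (wedge_ker V w) = CARD('m) + 1"
    and f_stab: "\<And>g w. g \<in> carrier G \<Longrightarrow> f w \<noteq> 0 \<Longrightarrow> f (\<rho> g *v w) \<noteq> 0"
    and q_ex: "\<exists>x. x \<noteq> 0 \<and> proj_point x \<in> pluecker_gr2 \<inter> proj_space V \<and> q x \<noteq> 0"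
    and f_ex: "\<exists>w. f w \<noteq> 0"
begin

abbreviation "X \<equiv> pluecker_gr2 \<inter> proj_space V"
abbreviation "T g \<equiv> tensor_square (\<rho> g)"
abbreviation "actX \<equiv> act_fst (proj_act (tensor_square \<circ> \<rho>))"
abbreviation "actW \<equiv> act_fst (proj_act \<rho>)"

section \<open>The two frames and their coordinates\<close>

definition N :: "'k^'n \<Rightarrow> 'k^'m^'m" where
  "N w = (\<chi> j i. pairing2 \<alpha> (\<beta> j) (wedge w (t i w)))"

definition Wt :: "'k^('n \<times> 'n) \<Rightarrow> 'k^2 \<Rightarrow> 'k^'n" where
  "Wt x y = y $ 1 *s S1 x + y $ 2 *s S2 x"

text \<open>Cramer numerators for the coordinates of a plane through \<open>w\<close> in the frame
  \<open>t i w\<close>, without the division by \<open>det (N w)\<close>: this keeps them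
  biforms.\<close>

definition Cr :: "'k^'n \<Rightarrow> 'k^('n \<times> 'n) \<Rightarrow> 'k^'m" where
  "Cr w x = (\<chi> k. det (\<chi> i j. if j = k then pairing2 \<alpha> (\<beta> i) x else N w $ i $ j))"

definition Xi :: "'k^'n \<Rightarrow> 'k^'m \<Rightarrow> 'k^('n \<times> 'n)" where
  "Xi w c = wedge w (\<Sum>i\<in>UNIV. c $ i *s t i w)"

text \<open>Cramer numerators for the coordinates of \<open>w\<close> in the basis
  \<open>S1 x\<close>, \<open>S2 x\<close>, taken at the Pluecker coordinate \<open>p0\<close>; the
  omitted denominator is \<open>wedge (S1 x) (S2 x) $ p0\<close>.\<close>

definition Yt :: "'k^'n \<Rightarrow> 'k^('n \<times> 'n) \<Rightarrow> 'k^2" where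
  "Yt w x = (\<chi> i. if i = 1 then wedge w (S2 x) $ p0 else wedge (S1 x) w $ p0)"

lemma X_iff: "x \<noteq> 0 \<and> proj_point x \<in> X \<longleftrightarrow> x \<noteq> 0 \<and> x \<in> V \<and> (\<exists>u v. x = wedge u v)"
  by (rule plane_section_iff[OF subV])

lemma T_rep: "representation G T"
  using representation_tensor_square[OF rep] by (simp add: comp_def)

lemma Wt_biform: "biform e1 1 (\<lambda>x y. Wt x y $ i)"
proof -
  have 1: "biform (0 + e1) (1 + 0) (\<lambda>x y. y $ j * S1 x $ i)" for j :: 2
    by (intro biform_mult form_biform_fst[OF S_form(1)] form_biform_snd[OF form_nth])
  have 2: "biform (0 + e1) (1 + 0) (\<lambda>x y. y $ j * S2 x $ i)" for j :: 2
    by (intro biform_mult form_biform_fst[OF S_form(2)] form_biform_snd[OF form_nth])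
  from biform_add[OF 1[of 1] 2[of 2]] show ?thesis by (simp add: Wt_def)
qed

lemma Xi_biform: "biform (1 + e2) 1 (\<lambda>w c. Xi w c $ p)"
proof -
  have "biform (0 + e2) (1 + 0) (\<lambda>w c. c $ k * t k w $ j)" for j k
    by (intro biform_mult form_biform_fst[OF t_form] form_biform_snd[OF form_nth])
  then have "biform e2 1 (\<lambda>w c. (\<Sum>k\<in>UNIV. c $ k *s t k w) $ j)" for j
    unfolding sum_component vector_smult_component by (intro biform_sum) simp
  from biform_wedge[OF form_biform_fst[OF form_nth] this] show ?thesis by (simp add: Xi_def)
qed

lemma Cr_biform: "biform ((CARD('m) - 1) * (1 + e2)) 1 (\<lambda>w x. Cr w x $ k)"
proof -
  have "form (1 + e2) (\<lambda>w. N w $ i $ j)" for i j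
  proof -
    have "form (1 + e2) (\<lambda>w. wedge w (t j w) $ p)" for p by (intro form_wedge form_nth t_form)
    from form_compose[OF form_pairing2 this] show ?thesis by (simp add: N_def)
  qed
  then have N: "biform (1 + e2) 0 (\<lambda>w (x :: 'k^('n \<times> 'n)). N w $ i $ j)" for i j
    by (rule form_biform_fst)
  have "biform (\<Sum>j\<in>UNIV. if j = k then 0 else 1 + e2) (\<Sum>j\<in>UNIV. if j = k then 1 else 0)
      (\<lambda>w x. det (\<chi> i j. if j = k then pairing2 \<alpha> (\<beta> i) x else N w $ i $ j))"
  proof (rule biform_det)
    show "biform (if j = k then 0 else 1 + e2) (if j = k then 1 else 0)
        (\<lambda>w x. (\<chi> i j. if j = k then pairing2 \<alpha> (\<beta> i) x else N w $ i $ j) $ i $ j)" for i j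
      using N[of i j] form_biform_snd[OF form_pairing2] by (cases "j = k") simp_all
  qed
  moreover have "(\<Sum>j\<in>(UNIV :: 'm set). if j = k then 0 else 1 + e2) = (CARD('m) - 1) * (1 + e2)"
    by (simp add: sum.If_cases Compl_eq_Diff_UNIV card_Diff_singleton)
  ultimately show ?thesis by (simp add: Cr_def)
qed

lemma Yt_biform: "biform 1 e1 (\<lambda>w x. Yt w x $ i)"
proof -
  have "biform (1 + 0) (0 + e1) (\<lambda>w x. wedge w (S2 x) $ p0)" "biform (0 + 1) (e1 + 0) (\<lambda>w x. wedge (S1 x) w $ p0)"
    by (intro biform_wedge form_biform_fst[OF form_nth] form_biform_snd S_form)+
  then show ?thesis by (cases "i = 1") (simp_all add: Yt_def)
qed

text \<open>A form of degree 0 could be nonzero at 0, but \<open>f\<close> controls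
  \<open>det (N w)\<close>, and \<open>N 0\<close> has a zero row.\<close>

lemma f_nonzero: "f w \<noteq> 0 \<Longrightarrow> w \<noteq> 0"
proof
  assume fw: "f w \<noteq> 0" "w = 0"
  obtain i :: 'm where True by simp
  have "row i (N w) = 0" unfolding fw(2) N_def row_def wedge_simps pairing2_def by (simp add: vec_eq_iff)
  then show False using f_det[OF fw(1)] det_zero_row(1)[of i "N w"] by (simp add: N_def)
qed

lemma Xi_linear: "Vector_Spaces.linear (*s) (*s) (Xi w)"
  by (simp add: Vector_Spaces.linear_iff vec.vector_space_axioms Xi_def wedge_sum_right wedge_simps
      algebra_simps sum.distrib vec.scale_sum_right vector_smult_assoc)

lemma Xi_scale: "Xi w (c *s z) = c *s Xi w z"
  by (rule vec.linear_scale[OF Xi_linear])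

lemma Cr_Xi: "Cr w (Xi w c) = det (N w) *s c"
proof -
  have *: "pairing2 \<alpha> (\<beta> i) (Xi w c) = (N w *v c) $ i" for i
    by (simp add: Xi_def wedge_sum_right pairing2_linear wedge_simps N_def matrix_vector_mult_def mult.commute)
  show ?thesis unfolding Cr_def * cramer_lemma by (simp add: vec_eq_iff mult.commute)
qed

lemma Cr_scale: "Cr (a *s w) (b *s x) = (a ^ ((CARD('m) - 1) * (1 + e2)) * b) *s Cr w x"
  using biform_homogeneous[OF Cr_biform] by (simp add: vec_eq_iff)

lemma Xi_nonzero: "f w \<noteq> 0 \<Longrightarrow> Xi w c = 0 \<Longrightarrow> c = 0"
  using Cr_Xi[of w c] Cr_scale[of 1 w 0 0] f_det[of w] by (simp add: N_def)

lemma Xi_in_V: "Xi w c \<in> V"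
proof -
  have "(\<Sum>i\<in>UNIV. c $ i *s t i w) \<in> wedge_ker V w"
    using subspace_wedge_ker[OF subV] t_mem by (intro vec.subspace_sum vec.subspace_scale)
  then show ?thesis by (simp add: Xi_def wedge_ker_def)
qed

text \<open>A rank count: \<open>Xi w\<close> has rank \<open>CARD('m)\<close> because
  \<open>det (N w)\<close> is nonzero, and \<open>wedge w\<close> maps the kernel, of dimension
  \<open>CARD('m) + 1\<close>, to at most this dimension since it kills \<open>w\<close>.\<close>

lemma Xi_surj:
  assumes fw: "f w \<noteq> 0" and z: "wedge w z \<in> V"
  obtains c where "wedge w z = Xi w c"
proof -
  let ?K = "wedge_ker V w"
  have K: "vec.subspace ?K" by (rule subspace_wedge_ker[OF subV])
  have "inj (Xi w)"
  proof (rule injI)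
    fix x y assume "Xi w x = Xi w y"
    then have "Xi w (x - y) = 0" by (simp add: vec.linear_diff[OF Xi_linear])
    then show "x = y" using Xi_nonzero[OF fw] by fastforce
  qed
  then have "vec.dim (range (Xi w)) = vec.dim (UNIV :: ('k^'m) set)"
    by (intro vec.dim_image_eq[OF Xi_linear]) simp
  then have dim1: "vec.dim (range (Xi w)) = CARD('m)" unfolding vec_dim_card .
  have "{w} \<subseteq> ?K" using self_mem_wedge_ker[OF subV] by simp
  moreover have "vec.independent {w}" using f_nonzero[OF fw] by (simp add: vec.independent_insert)
  ultimately obtain B where B: "{w} \<subseteq> B" "B \<subseteq> ?K" "vec.independent B" "?K \<subseteq> vec.span B"
    by (rule vec.maximal_independent_subset_extend)
  have "card B = CARD('m) + 1" using vec.basis_card_eq_dim[OF B(2,4,3)] f_dim[OF fw] by simp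
  then have cB: "card (B - {w}) = CARD('m)" using B(1) by (simp add: card_Diff_singleton)
  have finB: "finite B" using B(3) by (rule vec.finiteI_independent)
  have "wedge w ` ?K \<subseteq> vec.span (wedge w ` (B - {w}))"
  proof -
    have "wedge w ` ?K \<subseteq> wedge w ` vec.span B" using B(4) by blast
    also have "\<dots> = vec.span (wedge w ` B)" by (rule vec.linear_span_image[OF linear_wedge, symmetric])
    also have "\<dots> \<subseteq> vec.span (insert 0 (wedge w ` (B - {w})))"
      by (rule vec.span_mono) (auto simp: wedge_simps)
    finally show ?thesis by simp
  qed
  then have "vec.dim (wedge w ` ?K) \<le> card (wedge w ` (B - {w}))"
    using finB by (intro vec.dim_le_card) auto
  also have "\<dots> \<le> CARD('m)" using card_image_le[of "B - {w}" "wedge w"] finB cB by simp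
  finally have dim2: "vec.dim (wedge w ` ?K) \<le> CARD('m)" .
  have sub: "range (Xi w) \<subseteq> wedge w ` ?K"
  proof clarify
    fix c
    have "(\<Sum>i\<in>UNIV. c $ i *s t i w) \<in> ?K"
      using K t_mem by (intro vec.subspace_sum vec.subspace_scale)
    then show "Xi w c \<in> wedge w ` ?K" by (simp add: Xi_def)
  qed
  have "range (Xi w) = wedge w ` ?K"
    using dim1 dim2 sub
    by (intro vec.subspace_dim_equal vec.linear_subspace_image[OF Xi_linear]
        vec.linear_subspace_image[OF linear_wedge K]) simp_all
  moreover have "wedge w z \<in> wedge w ` ?K" using z by (simp add: wedge_ker_def)
  ultimately show ?thesis using that by (metis rangeE)
qed

lemma Xi_Cr:
  assumes "f w \<noteq> 0" "wedge u v \<in> V" "w \<in> vec.span {u, v}"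
  shows "Xi w (Cr w (wedge u v)) = det (N w) *s wedge u v"
proof -
  obtain z where z: "wedge u v = wedge w z" using wedge_rebase[OF assms(3) f_nonzero[OF assms(1)]] by metis
  then obtain c where "wedge u v = Xi w c" using Xi_surj[OF assms(1)] assms(2) by metis
  then show ?thesis by (simp add: Cr_Xi Xi_scale)
qed

lemma Wt_mem: "Wt (wedge u v) y \<in> vec.span {u, v}"
  unfolding Wt_def by (intro vec.span_add vec.span_scale S_mem)

lemma Yt_Wt: "Yt (Wt x y) x = wedge (S1 x) (S2 x) $ p0 *s y"
  by (simp add: Yt_def Wt_def vec_eq_iff forall_2 wedge_def algebra_simps)

text \<open>\<open>S1 x\<close> and \<open>S2 x\<close> span the plane of \<open>x\<close> because
  their wedge is nonzero; the identity then reduces to \<open>Yt_Wt\<close>.\<close>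

lemma Wt_Yt:
  assumes "q x \<noteq> 0" "x = wedge u v" "w \<in> vec.span {u, v}"
  shows "Wt x (Yt w x) = wedge (S1 x) (S2 x) $ p0 *s w"
proof -
  have nz: "wedge (S1 x) (S2 x) \<noteq> 0" using q_nz[OF assms(1)] by auto
  obtain a b c d where ab: "S1 x = a *s u + b *s v" "S2 x = c *s u + d *s v"
    using S_mem[of u v] assms(2) by (metis mem_span_pair)
  then have "wedge (S1 x) (S2 x) = (a * d - b * c) *s wedge u v" by (simp add: wedge_combination)
  moreover from this have "a * d - b * c \<noteq> 0" "wedge u v \<noteq> 0" using nz by auto
  ultimately have "vec.span {S1 x, S2 x} = vec.span {u, v}" using span_eq_of_wedge_eq by blast
  with assms(3) have "w \<in> vec.span {S1 x, S2 x}" by simp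
  then obtain r s where w: "w = r *s S1 x + s *s S2 x" unfolding mem_span_pair by blast
  define y :: "'k^2" where "y = (\<chi> i. if i = 1 then r else s)"
  have y: "Wt x y = w" by (simp add: Wt_def y_def w)
  have "Wt x (Yt w x) = Wt x (wedge (S1 x) (S2 x) $ p0 *s y)" using Yt_Wt[of x y] by (simp add: y)
  also have "\<dots> = wedge (S1 x) (S2 x) $ p0 *s Wt x y"
    by (simp add: Wt_def vec.scale_right_distrib vector_smult_assoc)
  finally show ?thesis by (simp add: y)
qed

lemma Wt_equiv: "g \<in> carrier G \<Longrightarrow> Wt (T g *v x) y = \<rho> g *v Wt x y"
  by (simp add: Wt_def S_equiv matrix_vector_right_distrib vector_scalar_commute)

lemma Xi_equiv: "g \<in> carrier G \<Longrightarrow> Xi (\<rho> g *v w) c = T g *v Xi w c"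
  by (simp add: Xi_def t_equiv tensor_square_wedge vec.linear_sum[OF matrix_vector_mul_linear_gen]
      vector_scalar_commute)

section \<open>The open sets and the maps between them\<close>

definition P1 :: "'k^('n \<times> 'n) \<Rightarrow> 'k^2 \<Rightarrow> 'k" where "P1 x y = q x * f (Wt x y)"
text \<open>The same two conditions as in \<open>P1\<close>, seen from the other side:
  \<open>q\<close> makes \<open>S1\<close> and \<open>S2\<close> a basis of the plane,
  \<open>f\<close> makes the \<open>t i\<close> a basis of the kernel modulo the line.\<close>

definition P2 :: "'k^'n \<Rightarrow> 'k^'m \<Rightarrow> 'k" where "P2 w c = f w * q (Xi w c)"

lemma P1_biform: "biform (dq + df * e1) (0 + df * 1) P1"
  unfolding P1_def[abs_def]
  by (intro biform_mult form_biform_fst[OF q_form] form_compose_biform[OF f_form Wt_biform])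

lemma P2_biform: "biform (df + dq * (1 + e2)) (0 + dq * 1) P2"
  unfolding P2_def[abs_def]
  by (intro biform_mult form_biform_fst[OF f_form] form_compose_biform[OF q_form Xi_biform])

definition U1 where "U1 = (X \<times> proj_space (UNIV :: ('k^2) set)) \<inter> nonvanishing2 P1"
definition U2 where "U2 = (proj_space (UNIV :: ('k^'n) set) \<times> proj_space (UNIV :: ('k^'m) set)) \<inter> nonvanishing2 P2"

lemma U1E:
  assumes "p \<in> U1"
  obtains u v y where "p = (proj_point (wedge u v), proj_point y)" "wedge u v \<noteq> 0" "y \<noteq> 0"
    "wedge u v \<in> V" "q (wedge u v) \<noteq> 0" "f (Wt (wedge u v) y) \<noteq> 0"
proof -
  obtain L M where LM: "p = (L, M)" "L \<in> X" "M \<in> proj_space UNIV" "(L, M) \<in> nonvanishing2 P1"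
    using assms by (auto simp: U1_def)
  have "L \<in> proj_space V" using LM(2) by blast
  then obtain x where x: "x \<noteq> 0" "L = proj_point x" by (rule proj_spaceE)
  obtain y where y: "y \<noteq> 0" "M = proj_point y" using LM(3) by (rule proj_spaceE)
  obtain u v where uv: "x = wedge u v" "x \<in> V" using X_iff[of x] x LM(2) by blast
  have "P1 x y \<noteq> 0" using LM(4) x y by (simp add: proj_point_nonvanishing2[OF P1_biform])
  then show ?thesis using that x y uv LM(1) by (simp add: P1_def)
qed

lemma U1I:
  assumes "wedge u v \<noteq> 0" "y \<noteq> 0" "wedge u v \<in> V" "q (wedge u v) \<noteq> 0" "f (Wt (wedge u v) y) \<noteq> 0"
  shows "(proj_point (wedge u v), proj_point y) \<in> U1"
proof -
  have "proj_point (wedge u v) \<in> X" using X_iff assms by blast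
  moreover have "P1 (wedge u v) y \<noteq> 0" using assms by (simp add: P1_def)
  ultimately show ?thesis using assms by (simp add: U1_def proj_point_nonvanishing2[OF P1_biform])
qed

lemma U2E:
  assumes "p \<in> U2"
  obtains w c where "p = (proj_point w, proj_point c)" "w \<noteq> 0" "c \<noteq> 0" "f w \<noteq> 0" "q (Xi w c) \<noteq> 0"
proof -
  obtain L M where LM: "p = (L, M)" "L \<in> proj_space UNIV" "M \<in> proj_space UNIV" "(L, M) \<in> nonvanishing2 P2"
    using assms by (auto simp: U2_def)
  obtain w where w: "w \<noteq> 0" "L = proj_point w" using LM(2) by (rule proj_spaceE)
  obtain c where c: "c \<noteq> 0" "M = proj_point c" using LM(3) by (rule proj_spaceE)
  have "P2 w c \<noteq> 0" using LM(4) w c by (simp add: proj_point_nonvanishing2[OF P2_biform])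
  then show ?thesis using that w c LM(1) by (simp add: P2_def)
qed

lemma U2I:
  assumes "c \<noteq> 0" "f w \<noteq> 0" "q (Xi w c) \<noteq> 0"
  shows "(proj_point w, proj_point c) \<in> U2"
  using assms f_nonzero[of w] by (simp add: U2_def P2_def proj_point_nonvanishing2[OF P2_biform])

text \<open>The coordinates \<open>y\<close> of the line are traded for the coordinates
  \<open>c\<close> of the plane; \<open>\<psi>\<close> trades them back.\<close>

definition \<phi> where "\<phi> p = (lift2 Wt p, lift2 (\<lambda>x y. Cr (Wt x y) x) p)"
definition \<psi> where "\<psi> p = (lift2 Xi p, lift2 (\<lambda>w c. Yt w (Xi w c)) p)"

lemma Cr_Wt_biform: "\<exists>d e. \<forall>i. biform d e (\<lambda>x y. Cr (Wt x y) x $ i)"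
  using biform_compose_fst[OF Cr_biform Wt_biform] by blast

lemma Yt_Xi_biform: "\<exists>d e. \<forall>i. biform d e (\<lambda>w c. Yt w (Xi w c) $ i)"
  using biform_compose_snd[OF Yt_biform Xi_biform] by blast

lemma \<phi>_point:
  "x \<noteq> 0 \<Longrightarrow> y \<noteq> 0 \<Longrightarrow> \<phi> (proj_point x, proj_point y) = (proj_point (Wt x y), proj_point (Cr (Wt x y) x))"
proof -
  assume xy: "x \<noteq> 0" "y \<noteq> 0"
  obtain d e where "\<And>i. biform d e (\<lambda>x y. Cr (Wt x y) x $ i)" using Cr_Wt_biform by blast
  from lift2_point[OF this xy] lift2_point[OF Wt_biform xy] show ?thesis by (simp add: \<phi>_def)
qed

lemma \<psi>_point:
  "w \<noteq> 0 \<Longrightarrow> c \<noteq> 0 \<Longrightarrow> \<psi> (proj_point w, proj_point c) = (proj_point (Xi w c), proj_point (Yt w (Xi w c)))"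
proof -
  assume wc: "w \<noteq> 0" "c \<noteq> 0"
  obtain d e where "\<And>i. biform d e (\<lambda>w c. Yt w (Xi w c) $ i)" using Yt_Xi_biform by blast
  from lift2_point[OF this wc] lift2_point[OF Xi_biform wc] show ?thesis by (simp add: \<psi>_def)
qed

text \<open>After a trip through the Cramer numerators the plane returns multiplied by
  \<open>det (N w)\<close>, which is nonzero and so invisible projectively.\<close>

lemma forward:
  assumes x: "wedge u v \<noteq> 0" "wedge u v \<in> V" "q (wedge u v) \<noteq> 0" "f (Wt (wedge u v) y) \<noteq> 0"
  defines "w \<equiv> Wt (wedge u v) y" and "c \<equiv> Cr (Wt (wedge u v) y) (wedge u v)"
  shows "Xi w c = det (N w) *s wedge u v" "det (N w) \<noteq> 0" "c \<noteq> 0" "q (Xi w c) \<noteq> 0"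
proof -
  show Xi: "Xi w c = det (N w) *s wedge u v"
    unfolding w_def c_def by (rule Xi_Cr[OF x(4,2) Wt_mem])
  show d: "det (N w) \<noteq> 0" using f_det x(4) by (simp add: w_def N_def)
  show "c \<noteq> 0"
  proof
    assume "c = 0"
    then have "Xi w c = 0" using Xi_scale[of w 0 0] by simp
    then show False using Xi d x(1) by simp
  qed
  show "q (Xi w c) \<noteq> 0" unfolding Xi form_homogeneous[OF q_form] using d x(3) by simp
qed

lemma backward:
  assumes w: "f w \<noteq> 0" "c \<noteq> 0" "q (Xi w c) \<noteq> 0"
  defines "x \<equiv> Xi w c" and "y \<equiv> Yt w (Xi w c)"
  shows "\<exists>u v. x = wedge u v" "x \<noteq> 0" "x \<in> V" "y \<noteq> 0"
    "Wt x y = wedge (S1 x) (S2 x) $ p0 *s w" "wedge (S1 x) (S2 x) $ p0 \<noteq> 0"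
proof -
  show "\<exists>u v. x = wedge u v" "x \<in> V" "x \<noteq> 0"
    using Xi_in_V Xi_nonzero[OF w(1)] w(2) by (auto simp: x_def Xi_def)
  show W: "Wt x y = wedge (S1 x) (S2 x) $ p0 *s w"
    unfolding x_def y_def by (rule Wt_Yt[OF w(3) Xi_def]) (simp add: vec.span_base)
  show nz: "wedge (S1 x) (S2 x) $ p0 \<noteq> 0" using q_nz w(3) by (simp add: x_def)
  show "y \<noteq> 0"
  proof
    assume "y = 0"
    then have "Wt x y = 0" by (simp add: Wt_def)
    then show False using W nz f_nonzero[OF w(1)] by simp
  qed
qed

lemma \<phi>_U1: "p \<in> U1 \<Longrightarrow> \<phi> p \<in> U2 \<and> \<psi> (\<phi> p) = p"
proof (erule U1E)
  fix u v y
  assume p: "p = (proj_point (wedge u v), proj_point y)" and y: "y \<noteq> 0"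
    and x: "wedge u v \<noteq> 0" "wedge u v \<in> V" "q (wedge u v) \<noteq> 0" "f (Wt (wedge u v) y) \<noteq> 0"
  define w where "w = Wt (wedge u v) y"
  define c where "c = Cr w (wedge u v)"
  note fw = forward[OF x, folded w_def, folded c_def]
  have fw0: "f w \<noteq> 0" "w \<noteq> 0" using x(4) f_nonzero by (simp_all add: w_def)
  have \<phi>p: "\<phi> p = (proj_point w, proj_point c)"
    unfolding p w_def c_def by (rule \<phi>_point[OF x(1) y])
  have "Yt w (Xi w c) = (det (N w) ^ e1 * wedge (S1 (wedge u v)) (S2 (wedge u v)) $ p0) *s y"
  proof -
    have "Yt w (Xi w c) = det (N w) ^ e1 *s Yt w (wedge u v)"
      using biform_homogeneous[OF Yt_biform, of 1 w] by (simp add: fw(1) vec_eq_iff)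
    then show ?thesis using Yt_Wt[of "wedge u v" y] by (simp add: w_def vector_smult_assoc)
  qed
  then have "\<psi> (\<phi> p) = p"
    unfolding \<phi>p \<psi>_point[OF fw0(2) fw(3)] using fw(1,2) q_nz[OF x(3)] by (simp add: p proj_point_scale)
  moreover have "\<phi> p \<in> U2" unfolding \<phi>p by (rule U2I[OF fw(3) fw0(1) fw(4)])
  ultimately show "\<phi> p \<in> U2 \<and> \<psi> (\<phi> p) = p" by blast
qed

lemma \<psi>_U2: "p \<in> U2 \<Longrightarrow> \<psi> p \<in> U1 \<and> \<phi> (\<psi> p) = p"
proof (erule U2E)
  fix w c
  assume p: "p = (proj_point w, proj_point c)" and w0: "w \<noteq> 0" and w: "c \<noteq> 0" "f w \<noteq> 0" "q (Xi w c) \<noteq> 0"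
  define x where "x = Xi w c"
  define y where "y = Yt w x"
  note b = backward[OF w(2,1,3), folded x_def, folded y_def]
  define \<mu> where "\<mu> = wedge (S1 x) (S2 x) $ p0"
  obtain u v where uv: "x = wedge u v" using b(1) by blast
  have \<psi>p: "\<psi> p = (proj_point x, proj_point y)"
    unfolding p x_def y_def by (rule \<psi>_point[OF w0 w(1)])
  have W: "Wt x y = \<mu> *s w" "\<mu> \<noteq> 0" using b(5,6) by (simp_all add: \<mu>_def)
  have "f (Wt x y) \<noteq> 0" unfolding W form_homogeneous[OF f_form] using W(2) w(2) by simp
  then have "\<psi> p \<in> U1"
    unfolding \<psi>p using U1I[of u v y] b w(3) uv by (simp add: x_def)
  moreover have "Cr (Wt x y) x = (\<mu> ^ ((CARD('m) - 1) * (1 + e2)) * det (N w)) *s c"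
    unfolding W(1) using Cr_scale[of \<mu> w 1 x] by (simp add: x_def Cr_Xi vector_smult_assoc)
  then have "\<phi> (\<psi> p) = p"
    unfolding \<psi>p \<phi>_point[OF b(2,4)] using W f_det[OF w(2)] by (simp add: p proj_point_scale N_def)
  ultimately show "\<psi> p \<in> U1 \<and> \<phi> (\<psi> p) = p" by blast
qed

lemma act_point: "act_fst (proj_act \<sigma>) g (proj_point x, M) = (proj_point (\<sigma> g *v x), M)"
  by (simp add: act_fst_def proj_act_point)

lemma \<phi>_equivariant:
  assumes g: "g \<in> carrier G" and "p \<in> U1"
  shows "actX g p \<in> U1"
    "\<phi> (actX g p) = actW g (\<phi> p)"
proof -
  from \<open>p \<in> U1\<close> obtain u v y where p: "p = (proj_point (wedge u v), proj_point y)" and y: "y \<noteq> 0"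
    and x: "wedge u v \<noteq> 0" "wedge u v \<in> V" "q (wedge u v) \<noteq> 0" "f (Wt (wedge u v) y) \<noteq> 0"
    by (metis U1E)
  let ?gu = "\<rho> g *v u" and ?gv = "\<rho> g *v v"
  have gp: "actX g p = (proj_point (wedge ?gu ?gv), proj_point y)"
    by (simp add: p act_point tensor_square_wedge)
  have T: "wedge ?gu ?gv = T g *v wedge u v" by (simp add: tensor_square_wedge)
  have gx: "wedge ?gu ?gv \<noteq> 0" "wedge ?gu ?gv \<in> V" "q (wedge ?gu ?gv) \<noteq> 0" "f (Wt (wedge ?gu ?gv) y) \<noteq> 0"
    unfolding T using x representation_eq_0_iff[OF grp T_rep g] stabV[OF g] q_stab[OF g] f_stab[OF g]
    by (simp_all add: Wt_equiv[OF g])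
  show "actX g p \<in> U1"
    unfolding gp by (rule U1I[OF gx(1) y gx(2-4)])
  define w where "w = Wt (wedge u v) y"
  define c where "c = Cr w (wedge u v)"
  note fw = forward[OF x, folded w_def, folded c_def]
  have gw: "Wt (wedge ?gu ?gv) y = \<rho> g *v w" unfolding T w_def by (rule Wt_equiv[OF g])
  have "Xi (\<rho> g *v w) c = det (N w) *s wedge ?gu ?gv"
    unfolding Xi_equiv[OF g] fw(1) T by (simp add: vector_scalar_commute)
  \<comment> \<open>\<open>\<alpha>\<close> and \<open>\<beta>\<close> are not assumed invariant
    under \<open>G\<close>, so \<open>Cr\<close> need not be equivariant. The coordinates still
    agree up to a scalar, because \<open>Xi\<close> is equivariant and \<open>Cr_Xi\<close> recovers
    them.\<close>
  then have "det (N (\<rho> g *v w)) *s c = det (N w) *s Cr (\<rho> g *v w) (wedge ?gu ?gv)"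
    using Cr_Xi[of "\<rho> g *v w" c] Cr_scale[of 1 "\<rho> g *v w" "det (N w)" "wedge ?gu ?gv"] by simp
  moreover have "det (N (\<rho> g *v w)) \<noteq> 0" using f_det gx(4) gw by (simp add: N_def)
  ultimately have "proj_point (Cr (\<rho> g *v w) (wedge ?gu ?gv)) = proj_point c"
    using proj_point_scale fw(2) by metis
  moreover have "\<phi> p = (proj_point w, proj_point c)"
    unfolding p w_def c_def by (rule \<phi>_point[OF x(1) y])
  ultimately show "\<phi> (actX g p) = actW g (\<phi> p)"
    using \<phi>_point[OF gx(1) y] by (simp only: gp gw act_point)
qed

lemma U2_stable: "g \<in> carrier G \<Longrightarrow> p \<in> U2 \<Longrightarrow> actW g p \<in> U2"
  by (erule U2E) (simp add: act_point U2I f_stab q_stab Xi_equiv)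

text \<open>The conditions \<open>q\<close> and \<open>f\<close> live on different spaces.
  Contraction with a functional picks a vector in each plane by a linear formula, which turns
  \<open>f\<close> into a second form on the cone over \<open>X\<close>; irreducibility of
  \<open>X\<close> then combines it with \<open>q\<close>.\<close>

lemma U1_nonempty: "U1 \<noteq> {}"
proof -
  obtain x1 where x1: "x1 \<noteq> 0" "proj_point x1 \<in> X" "q x1 \<noteq> 0" using q_ex by blast
  obtain w1 where w1: "f w1 \<noteq> 0" using f_ex by blast
  define contr :: "'k^'n \<Rightarrow> 'k^('n \<times> 'n) \<Rightarrow> 'k^'n" where
    "contr a x = (\<chi> i. \<Sum>j\<in>UNIV. a $ j * x $ (i, j))" for a x
  have contr: "contr a (wedge u v) = pairing a v *s u - pairing a u *s v" for a u v
    by (simp add: contr_def pairing_def wedge_nth vec_eq_iff sum_distrib_left sum_subtractf algebra_simps)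
  obtain i :: 'm where True by simp
  have x2: "Xi w1 (axis i 1) \<noteq> 0"
    using Xi_nonzero[OF w1, of "axis i 1"] by (auto simp: axis_eq_0_iff)
  then obtain z where z: "Xi w1 (axis i 1) = wedge w1 z" by (auto simp: Xi_def)
  have "z \<notin> vec.span {w1}" using x2 unfolding z by (auto simp: wedge_eq_0_iff vec.span_singleton)
  then have "vec.independent {z, w1}" "z \<noteq> w1"
    using f_nonzero[OF w1] vec.span_base[of w1 "{w1}"] by (auto simp: vec.independent_insert)
  \<comment> \<open>This functional makes the contraction of \<open>wedge w1 z\<close> equal to
    \<open>w1\<close>, where \<open>f\<close> is nonzero.\<close>
  then obtain a where a: "pairing a z = 1" "pairing a w1 = 0"
    using dual_vector[of "{z, w1}" z] by (metis insertCI)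
  have form: "form (df * 1) (\<lambda>x. f (contr a x))"
    by (rule form_compose[OF f_form])
      (auto simp: contr_def simp del: One_nat_def intro!: form_sum form_cmult form_nth)
  obtain x where x: "x \<noteq> 0" "proj_point x \<in> X" "\<And>i. i \<in> UNIV \<Longrightarrow> \<exists>p::unit. (if i then q x else f (contr a x)) \<noteq> 0"
  proof (rule irreducible_zariski_finite[OF irrX, of "UNIV :: bool set" "\<lambda>i. if i then dq else df * 1"
        "\<lambda>i p x. if i then q x else f (contr a x)"])
    show "form (if i then dq else df * 1) (\<lambda>x. if i then q x else f (contr a x))" for i
      using q_form form by (cases i) simp_all
    have "Xi w1 (axis i 1) \<noteq> 0 \<and> proj_point (Xi w1 (axis i 1)) \<in> X \<and> f (contr a (Xi w1 (axis i 1))) \<noteq> 0"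
      using X_iff[of "wedge w1 z"] x2 Xi_in_V[of w1 "axis i 1"] w1 unfolding z by (auto simp: contr a)
    then show "\<exists>x p. x \<noteq> 0 \<and> proj_point x \<in> X \<and> (if i then q x else f (contr a x)) \<noteq> 0" for i
      using x1 by (cases i) auto
  qed auto
  have q: "q x \<noteq> 0" and fc: "f (contr a x) \<noteq> 0" using x(3)[of True] x(3)[of False] by auto
  obtain u v where uv: "x = wedge u v" "x \<in> V" using X_iff[of x] x by blast
  have mem: "contr a x \<in> vec.span {u, v}"
    unfolding uv(1) contr by (intro vec.span_diff vec.span_scale vec.span_base) auto
  define y where "y = Yt (contr a x) x"
  have W: "Wt x y = wedge (S1 x) (S2 x) $ p0 *s contr a x"
    unfolding y_def by (rule Wt_Yt[OF q uv(1) mem])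
  have fW: "f (Wt x y) \<noteq> 0"
    unfolding W form_homogeneous[OF f_form] using fc q_nz[OF q] by simp
  then have "Wt x y \<noteq> 0" by (rule f_nonzero)
  then have "y \<noteq> 0" by (auto simp: Wt_def)
  then show ?thesis using U1I[of u v y] x(1) q fW uv by auto
qed

theorem equivariantly_birational_sections:
  "equivariantly_birational G
     actX (X \<times> proj_space (UNIV :: ('k^2) set))
     actW (proj_space (UNIV :: ('k^'n) set) \<times> proj_space (UNIV :: ('k^'m) set))"
  unfolding equivariantly_birational_def
proof (intro exI conjI ballI)
  have XU: "X \<subseteq> proj_space UNIV" by (auto simp: proj_space_def)
  have irr1: "irreducible_space (subtopology zariski2 (X \<times> proj_space (UNIV :: ('k^2) set)))"
    by (rule irreducible_times_proj_space[OF irrX XU])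
  have irr2: "irreducible_space (subtopology zariski2 (proj_space (UNIV :: ('k^'n) set) \<times> proj_space (UNIV :: ('k^'m) set)))"
    by (rule irreducible_times_proj_space[OF irreducible_proj_space order_refl])
  show "dense_open (subtopology zariski2 (X \<times> proj_space UNIV)) U1"
    using U1_nonempty openin_nonvanishing2[OF P1_biform]
    by (intro irreducible_space_dense_open[OF irr1]) (auto simp: U1_def intro: openin_subtopology_Int2)
  have "U2 \<noteq> {}" using U1_nonempty \<phi>_U1 by blast
  then show "dense_open (subtopology zariski2 (proj_space UNIV \<times> proj_space UNIV)) U2"
    using openin_nonvanishing2[OF P2_biform]
    by (intro irreducible_space_dense_open[OF irr2]) (auto simp: U2_def intro: openin_subtopology_Int2)
  show "stable_under G actX U1"
    using \<phi>_equivariant(1) by (auto simp: stable_under_def)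
  show "stable_under G actW U2"
    using U2_stable by (auto simp: stable_under_def)
  have sub1: "U1 \<subseteq> proj_space UNIV \<times> proj_space UNIV" using XU by (auto simp: U1_def)
  have sub2: "U2 \<subseteq> proj_space UNIV \<times> proj_space UNIV" by (auto simp: U2_def)
  have U1D: "Wt x y \<noteq> 0 \<and> Cr (Wt x y) x \<noteq> 0" if xy: "x \<noteq> 0" "y \<noteq> 0" "(proj_point x, proj_point y) \<in> U1" for x y
  proof -
    have P: "q x \<noteq> 0" "f (Wt x y) \<noteq> 0" and "proj_point x \<in> X"
      using xy by (auto simp: U1_def proj_point_nonvanishing2[OF P1_biform] P1_def)
    then obtain u v where "x = wedge u v" "x \<in> V" using X_iff[of x] xy(1) by blast
    then show ?thesis using forward(3)[of u v y] P xy(1) f_nonzero by auto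
  qed
  have U2D: "Xi w c \<noteq> 0 \<and> Yt w (Xi w c) \<noteq> 0" if wc: "w \<noteq> 0" "c \<noteq> 0" "(proj_point w, proj_point c) \<in> U2" for w c
  proof -
    have "f w \<noteq> 0" "q (Xi w c) \<noteq> 0"
      using wc by (auto simp: U2_def proj_point_nonvanishing2[OF P2_biform] P2_def)
    then show ?thesis using backward(2,4)[of w c] wc(2) by blast
  qed
  obtain d e where Cr_deg: "\<And>i. biform d e (\<lambda>x y. Cr (Wt x y) x $ i)" using Cr_Wt_biform by blast
  obtain d' e' where Yt_deg: "\<And>i. biform d' e' (\<lambda>w c. Yt w (Xi w c) $ i)" using Yt_Xi_biform by blast
  have "regular_map U1 (lift2 Wt)" "regular_map U1 (lift2 (\<lambda>x y. Cr (Wt x y) x))"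
    by (rule regular_lift2[OF Wt_biform sub1] regular_lift2[OF Cr_deg sub1], use U1D in blast)+
  then show "regular_map2 U1 \<phi>" by (simp add: regular_map2_def \<phi>_def[abs_def] comp_def)
  have "regular_map U2 (lift2 Xi)" "regular_map U2 (lift2 (\<lambda>w c. Yt w (Xi w c)))"
    by (rule regular_lift2[OF Xi_biform sub2] regular_lift2[OF Yt_deg sub2], use U2D in blast)+
  then show "regular_map2 U2 \<psi>" by (simp add: regular_map2_def \<psi>_def[abs_def] comp_def)
qed (use \<phi>_U1 \<psi>_U2 \<phi>_equivariant(2) in auto)

end

text \<open>The norm of \<open>f\<close> over the group; for a representation of a finite group its
  nonvanishing locus is the largest stable subset of that of \<open>f\<close>.\<close>

definition orbit_prod ::
  "('g, 'x) monoid_scheme \<Rightarrow> ('g \<Rightarrow> 'k::field^'a^'a) \<Rightarrow> ('k^'a \<Rightarrow> 'k) \<Rightarrow> 'k^'a \<Rightarrow> 'k" where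
  "orbit_prod G A f x = (\<Prod>g\<in>carrier G. f (A g *v x))"

lemma orbit_prod_form:
  assumes "form d f"
  shows "form (\<Sum>g\<in>carrier G. d * 1) (orbit_prod G A f)"
  unfolding orbit_prod_def[abs_def] by (intro form_prod form_compose[OF assms] form_matrix)

lemma orbit_prod_nonzero_iff:
  "finite (carrier G) \<Longrightarrow> orbit_prod G A f x \<noteq> 0 \<longleftrightarrow> (\<forall>g\<in>carrier G. f (A g *v x) \<noteq> 0)"
  by (simp add: orbit_prod_def)

lemma orbit_prod_nonzero:
  assumes "group G" "finite (carrier G)" "representation G A" "orbit_prod G A f x \<noteq> 0"
  shows "f x \<noteq> 0" "g \<in> carrier G \<Longrightarrow> orbit_prod G A f (A g *v x) \<noteq> 0"
proof -
  interpret group G by fact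
  have *: "f (A h *v x) \<noteq> 0" if "h \<in> carrier G" for h
    using assms(2,4) that by (simp add: orbit_prod_nonzero_iff)
  show "f x \<noteq> 0" using *[of "\<one>\<^bsub>G\<^esub>"] representation_one[OF assms(1,3)] by simp
  assume g: "g \<in> carrier G"
  have "f (A h *v (A g *v x)) \<noteq> 0" if "h \<in> carrier G" for h
    using *[of "h \<otimes>\<^bsub>G\<^esub> g"] that g representation_mult[OF assms(3) that g]
    by (simp add: matrix_vector_mul_assoc)
  then show "orbit_prod G A f (A g *v x) \<noteq> 0" using assms(2) by (simp add: orbit_prod_nonzero_iff)
qed

text \<open>The translate of \<open>f\<close> by \<open>g\<close> is nonzero at the image of
  \<open>x\<close> under the inverse of \<open>g\<close>, so irreducibility applies to the finitely
  many translates. The unit type marks a single form per condition.\<close>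

lemma orbit_prod_nonzero_ex:
  fixes A :: "'g \<Rightarrow> 'k::field^'a^'a"
  assumes G: "group G" "finite (carrier G)" and A: "representation G A"
    and irr: "irreducible_space (subtopology zariski S)" and f: "form d f"
    and stab: "\<And>g. g \<in> carrier G \<Longrightarrow> proj_point (A g *v x) \<in> S" and x: "x \<noteq> 0" "f x \<noteq> 0"
  shows "\<exists>y. y \<noteq> 0 \<and> proj_point y \<in> S \<and> orbit_prod G A f y \<noteq> 0"
proof -
  interpret group G by fact
  obtain y where y: "y \<noteq> 0" "proj_point y \<in> S" "\<And>g. g \<in> carrier G \<Longrightarrow> \<exists>p::unit. f (A g *v y) \<noteq> 0"
  proof (rule irreducible_zariski_finite[OF irr G(2), of "\<lambda>_. d * 1" "\<lambda>g p x. f (A g *v x)"])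
    show "form (d * 1) (\<lambda>x. f (A g *v x))" for g by (rule form_compose[OF f form_matrix])
    show "\<exists>y p. y \<noteq> 0 \<and> proj_point y \<in> S \<and> f (A g *v y) \<noteq> 0" if "g \<in> carrier G" for g
      using that stab[of "inv\<^bsub>G\<^esub> g"] x representation_inv(1)[OF G(1) A that]
        representation_eq_0_iff[OF G(1) A, of "inv\<^bsub>G\<^esub> g" x]
      by (intro exI[of _ "A (inv\<^bsub>G\<^esub> g) *v x"]) auto
  qed blast
  then show ?thesis using G(2) by (auto simp: orbit_prod_nonzero_iff)
qed

theorem proposition4:
  fixes G :: "('g, 'x) monoid_scheme"
    and \<rho> :: "'g \<Rightarrow> 'k::{alg_closed_field, field_char_0} ^ 'n ^ 'n"
    and V :: "('k ^ ('n::finite \<times> 'n)) set"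
    and X :: "('k ^ ('n \<times> 'n)) set set"
    and n r :: nat
  assumes "group G" and "finite (carrier G)"
    and "n = CARD('n)"
    and "representation G \<rho>"
    and "V \<subseteq> ext_square (UNIV :: ('k ^ 'n) set)"
    and "subrepresentation G (tensor_square \<circ> \<rho>) V"
    and "vec.dim V + r = vec.dim (ext_square (UNIV :: ('k ^ 'n) set))"
    and "r + 2 \<le> n"
    and "generically_free G (proj_act \<rho>)
           (subtopology zariski (proj_space (UNIV :: ('k ^ 'n) set)))"
    and "generically_free G (proj_act (tensor_square \<circ> \<rho>)) (subtopology zariski (proj_space V))"
    and "X = pluecker_gr2 \<inter> proj_space V"
    and "irreducible_space (subtopology zariski X)"
    and "krull_dim (subtopology zariski X) = enat (2 * (n - 2) - r)"
    and "CARD('m) = (n - 2 - r) + 1"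
  shows "equivariantly_birational G
           (act_fst (proj_act (tensor_square \<circ> \<rho>)))
           (X \<times> proj_space (UNIV :: ('k ^ 2) set))
           (act_fst (proj_act \<rho>))
           (proj_space (UNIV :: ('k ^ 'n) set) \<times> proj_space (UNIV :: ('k ^ 'm) set))"
proof -
  note G = assms(1,2) and rep = assms(4)
  note irr = assms(12)[unfolded assms(11)]
  interpret group G by fact
  let ?T = "\<lambda>g. tensor_square (\<rho> g)"
  have subV: "vec.subspace V" and stabV: "\<And>g x. g \<in> carrier G \<Longrightarrow> x \<in> V \<Longrightarrow> ?T g *v x \<in> V"
    using assms(6) by (simp_all add: subrepresentation_def)
  have T: "representation G ?T" using representation_tensor_square[OF rep] by (simp add: comp_def)
  have rn: "r + 2 \<le> CARD('n)" using assms(3,8) by simp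
  \<comment> \<open>\<open>CARD('m)\<close> counts the homogeneous coordinates of the second factor;
    the generic kernel at \<open>w\<close> has one more dimension, that of the line of
    \<open>w\<close>.\<close>
  have m: "CARD('n) - r = CARD('m) + 1" using assms(3,8,14) by simp
  note X_iff = plane_section_iff[OF subV]

  obtain x0 where x0: "x0 \<noteq> 0" "proj_point x0 \<in> pluecker_gr2 \<inter> proj_space V"
    "\<And>g. g \<in> carrier G \<Longrightarrow> proj_act (tensor_square \<circ> \<rho>) g (proj_point x0) = proj_point x0 \<Longrightarrow> g = \<one>\<^bsub>G\<^esub>"
    using free_point_on_section[OF G rep assms(5-7) rn assms(9,10) irr] by blast
  obtain u0 v0 where uv0: "x0 = wedge u0 v0" "x0 \<in> V" using X_iff x0 by blast
  have "proj_act ?T g (proj_point x0) = proj_point x0 \<Longrightarrow> g = \<one>\<^bsub>G\<^esub>" if "g \<in> carrier G" for g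
    using x0(3)[OF that] by (simp add: proj_act_point)
  then obtain d1 h1 where h1: "form d1 h1" "h1 x0 \<noteq> 0"
    "\<And>g. g \<in> carrier G \<Longrightarrow> g \<noteq> \<one>\<^bsub>G\<^esub> \<Longrightarrow> h1 (?T g *v x0) = 0"
    using form_separating_orbit[OF G(2) x0(1)] by blast
  obtain j1 j2 where j: "x0 $ (j1, j2) \<noteq> 0" using x0(1) by (auto simp: vec_prod_eq_iff)
  \<comment> \<open>The columns of a decomposable bivector, read as a matrix, lie in its plane; they
    are linear sections of the tautological bundle, defined everywhere.\<close>
  define col :: "'n \<Rightarrow> 'k^('n \<times> 'n) \<Rightarrow> 'k^'n" where "col j x = (\<chi> i. x $ (i, j))" for j x
  have col: "col j (wedge u v) = v $ j *s u + (- u $ j) *s v" for j u v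
    by (simp add: col_def wedge_nth vec_eq_iff algebra_simps)
  define S where "S j = average G ?T \<rho> h1 (col j)" for j
  have S_form: "form (d1 + 1) (\<lambda>x. S j x $ i)" for i j
    unfolding S_def by (rule average_form[OF h1(1)]) (simp add: col_def form_nth[unfolded One_nat_def])
  have S_mem: "S j (wedge u v) \<in> vec.span {u, v}" for j u v
    unfolding S_def
  proof (rule average_mem)
    fix g assume g: "g \<in> carrier G"
    then show "\<rho> g *v col j (?T (inv\<^bsub>G\<^esub> g) *v wedge u v) \<in> vec.span {u, v}"
      by (simp only: tensor_square_wedge col matrix_vector_right_distrib vector_scalar_commute
          representation_inv(1)[OF G(1) rep] mem_span_pair) blast
  qed simp
  have S_equiv: "S j (?T g *v x) = \<rho> g *v S j x" if "g \<in> carrier G" for g j x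
    unfolding S_def by (rule average_equivariant[OF G(1) T rep that])
  \<comment> \<open>The coordinate \<open>(j1, j2)\<close> of \<open>x0\<close> is nonzero, so the
    columns \<open>j1\<close> and \<open>j2\<close> form a basis of the plane of \<open>x0\<close>:
    their wedge is this coordinate times \<open>x0\<close>.\<close>
  define q0 where "q0 x = wedge (S j1 x) (S j2 x) $ (j1, j2)" for x
  have q0_form: "form ((d1 + 1) + (d1 + 1)) q0"
    unfolding q0_def[abs_def] by (intro form_wedge S_form)
  have "q0 x0 = h1 x0 * h1 x0 * (x0 $ (j1, j2) * x0 $ (j1, j2))"
  proof -
    have "S j x0 = h1 x0 *s col j x0" for j
      unfolding S_def by (rule average_at[OF G T rep]) (rule h1(3))
    moreover have "wedge (col j1 x0) (col j2 x0) = x0 $ (j1, j2) *s x0"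
      unfolding uv0(1) col wedge_combination by (simp add: wedge_nth algebra_simps)
    ultimately show ?thesis by (simp add: q0_def wedge_simps)
  qed
  then have q0x: "q0 x0 \<noteq> 0" using h1(2) j by simp
  define q where "q = orbit_prod G ?T q0"
  have q_form: "form (\<Sum>g\<in>carrier G. ((d1 + 1) + (d1 + 1)) * 1) q"
    unfolding q_def by (rule orbit_prod_form[OF q0_form])
  have "proj_point (?T g *v x0) \<in> pluecker_gr2 \<inter> proj_space V" if g: "g \<in> carrier G" for g
  proof -
    have "?T g *v x0 \<noteq> 0" using representation_eq_0_iff[OF G(1) T g] x0(1) by simp
    moreover have "?T g *v x0 = wedge (\<rho> g *v u0) (\<rho> g *v v0)" by (simp add: uv0(1) tensor_square_wedge)
    ultimately show ?thesis using X_iff stabV[OF g uv0(2)] by blast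
  qed
  then have q_ex: "\<exists>x. x \<noteq> 0 \<and> proj_point x \<in> pluecker_gr2 \<inter> proj_space V \<and> q x \<noteq> 0"
    unfolding q_def by (rule orbit_prod_nonzero_ex[OF G T irr q0_form _ x0(1) q0x])

  obtain w0 where w0: "w0 \<noteq> 0" "vec.dim (wedge_ker V w0) = CARD('n) - r"
    "\<And>w'. CARD('n) - r \<le> vec.dim (wedge_ker V w')"
    "\<And>g. g \<in> carrier G \<Longrightarrow> proj_act \<rho> g (proj_point w0) = proj_point w0 \<Longrightarrow> g = \<one>\<^bsub>G\<^esub>"
    using generic_kernel_point[OF subV assms(5,7) rn assms(9)] assms(13)[unfolded assms(3,11)] by blast
  obtain d2 h2 where h2: "form d2 h2" "h2 w0 \<noteq> 0"
    "\<And>g. g \<in> carrier G \<Longrightarrow> g \<noteq> \<one>\<^bsub>G\<^esub> \<Longrightarrow> h2 (\<rho> g *v w0) = 0"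
    using form_separating_orbit[OF G(2) w0(1,4)] by blast
  have min: "vec.dim (wedge_ker V w0) \<le> vec.dim (wedge_ker V w)" for w using w0(2,3) by simp
  obtain dD D e and s :: "'k^'n \<Rightarrow> 'k^'n \<Rightarrow> 'k^'n" where D: "form dD D" "D w0 \<noteq> 0"
    "\<And>w. D w \<noteq> 0 \<Longrightarrow> vec.dim (wedge_ker V w) = vec.dim (wedge_ker V w0)"
    and s: "\<And>c i. form e (\<lambda>w. s c w $ i)" "\<And>c. c \<in> wedge_ker V w0 \<Longrightarrow> s c w0 = c"
    "\<And>c w. c \<in> wedge_ker V w0 \<Longrightarrow> s c w \<in> wedge_ker V w"
    "\<And>c w i. \<forall>j. polyfun (\<lambda>s. c s $ j) \<Longrightarrow> \<forall>j. polyfun (\<lambda>s. w s $ j) \<Longrightarrow>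
       polyfun (\<lambda>x. s (c x) (w x) $ i)"
    using wedge_ker_sections[OF subV w0(1) min] by blast
  obtain b a where b: "b 0 = w0" "\<And>i. i < vec.dim (wedge_ker V w0) \<Longrightarrow> b i \<in> wedge_ker V w0"
    "\<And>i j. i < CARD('n) \<Longrightarrow> j < CARD('n) \<Longrightarrow> pairing (a i) (b j) = (if i = j then 1 else 0)"
    using enumerated_basis[OF subspace_wedge_ker[OF subV] self_mem_wedge_ker[OF subV] w0(1)] by metis
  \<comment> \<open>The indices start at 1 because \<open>b 0 = w0\<close> is zero modulo
    \<open>w0\<close>.\<close>
  have "card (UNIV :: 'm set) = card {1..CARD('m)}" by simp
  then obtain idx where idx: "bij_betw idx (UNIV :: 'm set) {1..CARD('m)}"
    using finite_same_card_bij[of "UNIV :: 'm set" "{1..CARD('m)}"] by auto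
  have idx_range: "1 \<le> idx i" "idx i < CARD('m) + 1" for i
    using bspec[OF bij_betwE[OF idx], of i] by simp_all
  have idx_eq: "idx i = idx j \<longleftrightarrow> i = j" for i j
    using bij_betw_imp_inj_on[OF idx] by (simp add: inj_on_eq_iff)
  have bK: "b (idx i) \<in> wedge_ker V w0" for i using b(2)[of "idx i"] idx_range[of i] w0(2) m by simp
  define t where "t i = average G \<rho> \<rho> h2 (s (b (idx i)))" for i
  have t_form: "form (d2 + e) (\<lambda>w. t i w $ k)" for i k
    unfolding t_def by (rule average_form[OF h2(1) s(1)])
  have t_mem: "t i w \<in> wedge_ker V w" for i w
    unfolding t_def
  proof (rule average_mem)
    fix g assume g: "g \<in> carrier G"
    have "wedge (\<rho> (inv\<^bsub>G\<^esub> g) *v w) (s (b (idx i)) (\<rho> (inv\<^bsub>G\<^esub> g) *v w)) \<in> V"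
      using s(3)[OF bK] by (simp add: wedge_ker_def)
    from stabV[OF g this]
    show "\<rho> g *v s (b (idx i)) (\<rho> (inv\<^bsub>G\<^esub> g) *v w) \<in> wedge_ker V w"
      by (simp add: tensor_square_wedge representation_inv(1)[OF G(1) rep g] wedge_ker_def)
  qed (rule subspace_wedge_ker[OF subV])
  have t_equiv: "t i (\<rho> g *v w) = \<rho> g *v t i w" if "g \<in> carrier G" for g i w
    unfolding t_def by (rule average_equivariant[OF G(1) rep rep that])
  define N :: "'k^'n \<Rightarrow> 'k^'m^'m" where
    "N w = (\<chi> j i. pairing2 (a 0) (a (idx j)) (wedge w (t i w)))" for w
  have "form (1 * (1 + (d2 + e))) (\<lambda>w. N w $ j $ i)" for i j
    unfolding N_def vec_lambda_beta
    by (intro form_compose[OF form_pairing2] form_wedge form_nth t_form)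
  then have det_form: "form (\<Sum>j\<in>(UNIV :: 'm set). 1 * (1 + (d2 + e))) (\<lambda>w. det (N w))"
    by (rule form_det)
  have det0: "det (N w0) \<noteq> 0"
  proof -
    \<comment> \<open>At \<open>w0\<close> the averaging only multiplies by \<open>h2 w0\<close>,
      and the dual basis makes the matrix diagonal.\<close>
    have N0: "N w0 $ j $ i = (if j = i then h2 w0 else 0)" for i j
    proof -
      have ti: "t i w0 = h2 w0 *s b (idx i)"
        unfolding t_def by (subst average_at[OF G rep rep]) (simp_all add: h2(3) s(2)[OF bK])
      have "idx k < CARD('n)" for k using idx_range[of k] m by simp
      then have "pairing (a 0) w0 = 1" "pairing (a (idx j)) w0 = 0" "pairing (a 0) (b (idx i)) = 0"
        "pairing (a (idx j)) (b (idx i)) = (if j = i then 1 else 0)"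
        using b(3)[of 0 0] b(3)[of "idx j" 0] b(3)[of 0 "idx i"] b(3)[of "idx j" "idx i"]
          idx_range(1)[of i] idx_range(1)[of j] by (auto simp: b(1) idx_eq)
      then show ?thesis by (simp add: N_def ti pairing2_wedge pairing_simps)
    qed
    have "det (N w0) = (\<Prod>i\<in>UNIV. N w0 $ i $ i)" by (rule det_diagonal) (simp add: N0)
    then show ?thesis using h2(2) by (simp add: N0)
  qed
  \<comment> \<open>\<open>D\<close> guards the kernel dimension, the determinant the independence
    of the frame, and the orbit product the stability under \<open>G\<close>.\<close>
  define f where "f = orbit_prod G \<rho> (\<lambda>w. D w * det (N w))"
  note f0_form = form_mult[OF D(1) det_form]
  have f_nz: "D w \<noteq> 0 \<and> det (N w) \<noteq> 0" if "f w \<noteq> 0" for w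
    using orbit_prod_nonzero(1)[OF G rep that[unfolded f_def]] by simp
  have "proj_point (\<rho> g *v w0) \<in> proj_space UNIV" if "g \<in> carrier G" for g
    using representation_eq_0_iff[OF G(1) rep that] w0(1) by simp
  then have f_ex: "\<exists>w. f w \<noteq> 0"
    using orbit_prod_nonzero_ex[OF G rep irreducible_proj_space f0_form _ w0(1)] D(2) det0
    unfolding f_def by fastforce

  interpret plane_sections G \<rho> V "S j1" "S j2" "d1 + 1" t "d2 + e" "a 0" "\<lambda>i. a (idx i)" "(j1, j2)"
    q "\<Sum>g\<in>carrier G. ((d1 + 1) + (d1 + 1)) * 1"
    f "\<Sum>g\<in>carrier G. (dD + (\<Sum>j\<in>(UNIV :: 'm set). 1 * (1 + (d2 + e)))) * 1"
  proof
    show "form (\<Sum>g\<in>carrier G. (dD + (\<Sum>j\<in>(UNIV :: 'm set). 1 * (1 + (d2 + e)))) * 1) f"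
      unfolding f_def by (rule orbit_prod_form[OF f0_form])
    show "wedge (S j1 x) (S j2 x) $ (j1, j2) \<noteq> 0" if "q x \<noteq> 0" for x
      using orbit_prod_nonzero(1)[OF G T that[unfolded q_def]] by (simp add: q0_def)
    show "q (?T g *v x) \<noteq> 0" if "g \<in> carrier G" "q x \<noteq> 0" for g x
      using orbit_prod_nonzero(2)[OF G T that(2)[unfolded q_def] that(1)] by (simp add: q_def)
    show "f (\<rho> g *v w) \<noteq> 0" if "g \<in> carrier G" "f w \<noteq> 0" for g w
      using orbit_prod_nonzero(2)[OF G rep that(2)[unfolded f_def] that(1)] by (simp add: f_def)
    show "det (\<chi> j i. pairing2 (a 0) (a (idx j)) (wedge w (t i w))) \<noteq> 0" if "f w \<noteq> 0" for w
      using f_nz[OF that] by (simp add: N_def)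
    show "vec.dim (wedge_ker V w) = CARD('m) + 1" if "f w \<noteq> 0" for w
      using D(3)[of w] f_nz[OF that] w0(2) m by simp
  qed (fact rep subV stabV irr S_form S_mem S_equiv t_form t_mem t_equiv q_form q_ex f_ex)+
  show ?thesis unfolding assms(11) by (rule equivariantly_birational_sections)
qed

end
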